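(* Let $L/K$ be a normal finite field extension (of arbitrary characteristic). Then: (1) $\mathcal{A}(E(L/K),L)=\{C_{E(L/K)}(M)=\mathcal{D}(L/M)\rtimes G(L/M)=\mathcal{D}(L/K)^M\rtimes G(L/K)^M\mid M\in\mathcal{F}(L/K)\}$. (2) The map $$\mathcal{F}(L/K)\to\mathcal{A}(E(L/K),L),\quad M\mapsto C_{E(L/K)}(M)=\mathcal{D}(L/M)\rtimes G(L/M)=\mathcal{D}(L/K)^M\rtimes G(L/K)^M$$ is a bijection. Its inverse is $$A\mapsto C_{E(L/K)}(A)=C_L(A\cap\mathcal{D}(L/K)_+)\cap L^{A\cap G(L/K)}=\big(C_L(A\cap\mathcal{D}(L/K)_+)\big)^{A\cap G(L/K)}=L^{A\cap\mathcal{D}(L/K)_+}\cap L^{A\cap G(L/K)}=\big(L^{A\cap\mathcal{D}(L/K)_+}\big)^{A\cap G(L/K)}.$$ In particular, the inverse sends $\mathcal{D}(L/M)\rtimes G(L/M)$ to $L^{\mathcal{D}(L/M)_+}\cap L^{G(L/M)}$. (3) For all $M\in\mathcal{F}(L/K)$, $[M:K]\,|G(L/M)|\,\dim_K(\mathcal{D}(L/M))=[L:K]^2$. Equivalently, $|G(L/M)|\,\dim_M(\mathcal{D}(L/M))=[L:M]^2$.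
   Context: Notation and conventions. - $E(L/M)=\mathrm{End}_M(L)\subseteq E(L/K)$, with $L$ identified with its multiplication operators. - $G(L/M)$ is the group of $M$-algebra automorphisms of $L$. - $\mathcal{D}(L/M)$ is the algebra of $M$-linear differential operators on $L$. It is defined as $\bigcup_i\mathcal{D}_i$, where $\mathcal{D}_0=L$ and $\mathcal{D}_i=\{\delta\in E(L/M)\mid[\delta,l]\in\mathcal{D}_{i-1}\ \forall l\in L\}$. - $\mathcal{D}(L/K)_+=\{\delta\in\mathcal{D}(L/K)\mid\delta(1)=0\}$, and similarly for $\mathcal{D}(L/M)_+$. - $\mathcal{D}(L/K)^M$ is the set of elements of $\mathcal{D}(L/K)$ commuting with all $m\in M$. - $G(L/K)^M$ is the set of elements of $G(L/K)$ fixing $M$ pointwise. - $D\rtimes H$ denotes $\sum_{h\in H}Dh\subseteq E(L/K)$; the notation asserts that the sum is direct. - $\mathcal{F}(L/K)$ is the set of intermediate fields. - $\mathcal{A}(E(L/K),L)$ is the set of $K$-subalgebras of $E(L/K)$ containing $L$. - $C_E(S)$ is the centralizer of $S$ in $E$, and $C_L(S)=\{l\in L\mid ls=sl\ \forall s\in S\}$. - For $S\subseteq\mathcal{D}(L/K)_+$, $L^S=\{l\in L\mid s(l)=0\ \forall s\in S\}$. - $L^H$ is the fixed field of a set $H$ of automorphisms. *)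

theory Defs
  imports "HOL-Algebra.Algebra"
begin

definition normal_extension :: "('a, 'b) ring_scheme \<Rightarrow> 'a set \<Rightarrow> bool" where
  "normal_extension L K \<longleftrightarrow>
     (\<forall>x\<in>carrier L. ring.algebraic L K x) \<and>
     (\<forall>p\<in>carrier (K[X]\<^bsub>L\<^esub>). pirreducible\<^bsub>L\<^esub> K p \<longrightarrow>
        (\<exists>x\<in>carrier L. ring.eval L p x = \<zero>\<^bsub>L\<^esub>) \<longrightarrow> ring.splitted L p)"

definition intermediate_fields :: "('a, 'b) ring_scheme \<Rightarrow> 'a set \<Rightarrow> 'a set set" where
  "intermediate_fields L K = {M. subfield M L \<and> K \<subseteq> M}"

text \<open>The ring \<open>E(L/M)\<close>. Operators are extensional functions, so that equality of operators is
  equality on \<open>L\<close>. For \<open>M \<subseteq> M'\<close> the ring operations of \<open>E(L/M')\<close> and \<open>E(L/M)\<close> are the same.\<close>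

definition End_ring :: "('a, 'b) ring_scheme \<Rightarrow> 'a set \<Rightarrow> ('a \<Rightarrow> 'a) ring" where
  "End_ring L M =
     \<lparr>carrier = {f \<in> carrier L \<rightarrow>\<^sub>E carrier L.
        (\<forall>x\<in>carrier L. \<forall>y\<in>carrier L. f (x \<oplus>\<^bsub>L\<^esub> y) = f x \<oplus>\<^bsub>L\<^esub> f y) \<and>
        (\<forall>m\<in>M. \<forall>x\<in>carrier L. f (m \<otimes>\<^bsub>L\<^esub> x) = m \<otimes>\<^bsub>L\<^esub> f x)},
      monoid.mult = compose (carrier L),
      one = (\<lambda>x\<in>carrier L. x),
      ring.zero = (\<lambda>x\<in>carrier L. \<zero>\<^bsub>L\<^esub>),
      add = (\<lambda>f g. \<lambda>x\<in>carrier L. f x \<oplus>\<^bsub>L\<^esub> g x)\<rparr>"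

text \<open>The identification of \<open>L\<close> with its multiplication operators is made explicit:
  \<open>V \<subseteq> L\<close> is regarded as the set \<open>mulop L ` V\<close> of operators.\<close>

definition mulop :: "('a, 'b) ring_scheme \<Rightarrow> 'a \<Rightarrow> 'a \<Rightarrow> 'a" where
  "mulop L l = (\<lambda>x\<in>carrier L. l \<otimes>\<^bsub>L\<^esub> x)"

definition Gal :: "('a, 'b) ring_scheme \<Rightarrow> 'a set \<Rightarrow> ('a \<Rightarrow> 'a) set" where
  "Gal L M = ring_iso L L \<inter> carrier (End_ring L M)"

primrec diff_ops_upto :: "('a, 'b) ring_scheme \<Rightarrow> 'a set \<Rightarrow> nat \<Rightarrow> ('a \<Rightarrow> 'a) set" where
  "diff_ops_upto L M 0 = mulop L ` carrier L"
| "diff_ops_upto L M (Suc i) =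
     {d \<in> carrier (End_ring L M). \<forall>l\<in>carrier L.
        (d \<otimes>\<^bsub>End_ring L M\<^esub> mulop L l) \<ominus>\<^bsub>End_ring L M\<^esub> (mulop L l \<otimes>\<^bsub>End_ring L M\<^esub> d)
          \<in> diff_ops_upto L M i}"

definition diff_ops :: "('a, 'b) ring_scheme \<Rightarrow> 'a set \<Rightarrow> ('a \<Rightarrow> 'a) set" where
  "diff_ops L M = (\<Union>i. diff_ops_upto L M i)"

definition diff_ops_plus :: "('a, 'b) ring_scheme \<Rightarrow> 'a set \<Rightarrow> ('a \<Rightarrow> 'a) set" where
  "diff_ops_plus L M = {d \<in> diff_ops L M. d \<one>\<^bsub>L\<^esub> = \<zero>\<^bsub>L\<^esub>}"

definition centralizer :: "('c, 'd) ring_scheme \<Rightarrow> 'c set \<Rightarrow> 'c set" where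
  "centralizer E S = {e \<in> carrier E. \<forall>s\<in>S. e \<otimes>\<^bsub>E\<^esub> s = s \<otimes>\<^bsub>E\<^esub> e}"

text \<open>\<open>C\<^sub>L(S)\<close> as a subset of \<open>L\<close> itself, for a set \<open>S\<close> of operators in \<open>E(L/K)\<close>.\<close>

definition field_centralizer ::
    "('a, 'b) ring_scheme \<Rightarrow> 'a set \<Rightarrow> ('a \<Rightarrow> 'a) set \<Rightarrow> 'a set" where
  "field_centralizer L K S =
     {l \<in> carrier L. \<forall>s\<in>S. mulop L l \<otimes>\<^bsub>End_ring L K\<^esub> s = s \<otimes>\<^bsub>End_ring L K\<^esub> mulop L l}"

definition diff_ops_commuting ::
    "('a, 'b) ring_scheme \<Rightarrow> 'a set \<Rightarrow> 'a set \<Rightarrow> ('a \<Rightarrow> 'a) set" where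
  "diff_ops_commuting L K M =
     {d \<in> diff_ops L K. \<forall>m\<in>M.
        d \<otimes>\<^bsub>End_ring L K\<^esub> mulop L m = mulop L m \<otimes>\<^bsub>End_ring L K\<^esub> d}"

definition Gal_fixing :: "('a, 'b) ring_scheme \<Rightarrow> 'a set \<Rightarrow> 'a set \<Rightarrow> ('a \<Rightarrow> 'a) set" where
  "Gal_fixing L K M = {g \<in> Gal L K. \<forall>m\<in>M. g m = m}"

definition zeros_in :: "('a, 'b) ring_scheme \<Rightarrow> 'a set \<Rightarrow> ('a \<Rightarrow> 'a) set \<Rightarrow> 'a set" where
  "zeros_in L V S = {x \<in> V. \<forall>s\<in>S. s x = \<zero>\<^bsub>L\<^esub>}"

definition fixed_in :: "'a set \<Rightarrow> ('a \<Rightarrow> 'a) set \<Rightarrow> 'a set" where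
  "fixed_in V H = {x \<in> V. \<forall>h\<in>H. h x = x}"

text \<open>\<open>D \<rtimes> H\<close> in the ring \<open>E\<close>: \<open>skew_sum\<close> is the set \<open>\<Sum>\<^sub>h D h\<close> of finite sums, and
  \<open>skew_direct\<close> is the assertion, implicit in the notation, that this sum is direct.\<close>

definition skew_sum :: "('c, 'd) ring_scheme \<Rightarrow> 'c set \<Rightarrow> 'c set \<Rightarrow> 'c set" where
  "skew_sum E D H =
     {finsum E f F | f F. finite F \<and> F \<subseteq> H \<and> f \<in> (\<Pi> h\<in>F. D #>\<^bsub>E\<^esub> h)}"

definition skew_direct :: "('c, 'd) ring_scheme \<Rightarrow> 'c set \<Rightarrow> 'c set \<Rightarrow> bool" where
  "skew_direct E D H \<longleftrightarrow>
     (\<forall>F f. finite F \<and> F \<subseteq> H \<and> f \<in> (\<Pi> h\<in>F. D #>\<^bsub>E\<^esub> h) \<and> finsum E f F = \<zero>\<^bsub>E\<^esub>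
        \<longrightarrow> (\<forall>h\<in>F. f h = \<zero>\<^bsub>E\<^esub>))"

definition subalgebras_over :: "('a, 'b) ring_scheme \<Rightarrow> 'a set \<Rightarrow> ('a \<Rightarrow> 'a) set set" where
  "subalgebras_over L K =
     {A. subring A (End_ring L K) \<and> subalgebra (mulop L ` K) A (End_ring L K) \<and>
         mulop L ` carrier L \<subseteq> A}"

definition field_to_algebra :: "('a, 'b) ring_scheme \<Rightarrow> 'a set \<Rightarrow> 'a set \<Rightarrow> ('a \<Rightarrow> 'a) set" where
  "field_to_algebra L K M = centralizer (End_ring L K) (mulop L ` M)"

end

(* Right multiplications f |-> f o x act on E(L/M) by commuting left-L-linear maps, and since L/K
   is normal their minimal polynomials split over L.  Hence E(L/M) is the direct sum of its
   simultaneous generalised eigenspaces.  A common eigenvector e satisfies e(x y) = chi(x) e(y),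
   so chi(x) = e(x) / e(1) is an M-automorphism g of L; the generalised eigenspace of the identity
   is D(L/M), and the one of g is D(L/M) g.  As these are all isomorphic over L and
   dim_L E(L/M) = [L:M], we get |G(L/M)| dim_L D(L/M) = [L:M].  That every intermediate algebra
   has the form E(L/M) is the Jacobson-Bourbaki correspondence, proved by a density argument. *)

theory Submission
  imports Defs
begin

text \<open>\<open>E(L/M)\<close> is the \<open>L\<close>-dual of the Artinian ring
  \<open>L \<otimes> L\<close> formed over \<open>M\<close>: one factor acts through values, the
  other through arguments. The decomposition is the dual of that of this ring into local factors,
  one for each automorphism. Normality makes every residue field equal to \<open>L\<close>, and the
  size of the local factors absorbs inseparability, so no case distinction on the characteristic
  arises. Minimal polynomials over \<open>K\<close> serve every \<open>M\<close>, since
  \<open>M\<close>-linear operators are \<open>K\<close>-linear. The obstacle is that nilpotency of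
  iterated commutators is a condition on each element separately, whereas a differential operator
  needs one order for all chains of commutators with varying elements. A finite spanning set closes
  the gap: commutators are linear in the element and commute with each other, so the exponents at
  the spanning elements add up to a bound. \<open>dimension\<close> refers to an ambient ring, and
  part (3) needs it in \<open>E(L/K)\<close> and in \<open>E(L/M)\<close>. Hence the counting lemmas
  carry a parameter \<open>F \<subseteq> M\<close> and place \<open>E(L/M)\<close> inside
  \<open>E(L/F)\<close>.\<close>

subsection \<open>Endomorphism rings\<close>

text \<open>For \<open>a = x\<close> this is the commutator \<open>[f, x]\<close> with the multiplication by \<open>x\<close>.\<close>

definition twisted_comm :: "('a, 'b) ring_scheme \<Rightarrow> 'a \<Rightarrow> 'a \<Rightarrow> ('a \<Rightarrow> 'a) \<Rightarrow> 'a \<Rightarrow> 'a" where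
  "twisted_comm R x a f = (\<lambda>y\<in>carrier R. f (x \<otimes>\<^bsub>R\<^esub> y) \<ominus>\<^bsub>R\<^esub> a \<otimes>\<^bsub>R\<^esub> f y)"

lemma End_ring_ops:
  "f \<oplus>\<^bsub>End_ring R M\<^esub> g = (\<lambda>x\<in>carrier R. f x \<oplus>\<^bsub>R\<^esub> g x)"
  "f \<otimes>\<^bsub>End_ring R M\<^esub> g = compose (carrier R) f g"
  "\<zero>\<^bsub>End_ring R M\<^esub> = (\<lambda>x\<in>carrier R. \<zero>\<^bsub>R\<^esub>)"
  "\<one>\<^bsub>End_ring R M\<^esub> = (\<lambda>x\<in>carrier R. x)"
  by (auto simp: End_ring_def)

lemma End_ring_mem:
  "f \<in> carrier (End_ring R M) \<longleftrightarrow> f \<in> carrier R \<rightarrow>\<^sub>E carrier R \<and>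
     (\<forall>x\<in>carrier R. \<forall>y\<in>carrier R. f (x \<oplus>\<^bsub>R\<^esub> y) = f x \<oplus>\<^bsub>R\<^esub> f y) \<and>
     (\<forall>m\<in>M. \<forall>x\<in>carrier R. f (m \<otimes>\<^bsub>R\<^esub> x) = m \<otimes>\<^bsub>R\<^esub> f x)"
  by (auto simp: End_ring_def)

lemma End_ring_mono: "M \<subseteq> N \<Longrightarrow> carrier (End_ring R N) \<subseteq> carrier (End_ring R M)"
  by (fastforce simp: End_ring_mem)

lemma End_ring_closed:
  "f \<in> carrier (End_ring R M) \<Longrightarrow> x \<in> carrier R \<Longrightarrow> f x \<in> carrier R"
  by (auto simp: End_ring_mem)

lemma End_ring_add:
  "f \<in> carrier (End_ring R M) \<Longrightarrow> x \<in> carrier R \<Longrightarrow> y \<in> carrier R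
     \<Longrightarrow> f (x \<oplus>\<^bsub>R\<^esub> y) = f x \<oplus>\<^bsub>R\<^esub> f y"
  by (auto simp: End_ring_mem)

lemma End_ring_smult:
  "f \<in> carrier (End_ring R M) \<Longrightarrow> m \<in> M \<Longrightarrow> x \<in> carrier R
     \<Longrightarrow> f (m \<otimes>\<^bsub>R\<^esub> x) = m \<otimes>\<^bsub>R\<^esub> f x"
  by (auto simp: End_ring_mem)

lemma End_ring_eqI:
  assumes "f \<in> carrier (End_ring R M)" "g \<in> carrier (End_ring R N)"
    and "\<And>x. x \<in> carrier R \<Longrightarrow> f x = g x"
  shows "f = g"
  using assms by (auto simp: End_ring_mem PiE_def intro: extensionalityI)

context cring
begin

lemma ring_End_ring:
  assumes M: "M \<subseteq> carrier R" shows "ring (End_ring R M)"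
proof (rule ringI)
  show "abelian_group (End_ring R M)"
  proof (rule abelian_groupI)
    fix f g h assume f: "f \<in> carrier (End_ring R M)" and g: "g \<in> carrier (End_ring R M)"
    show "f \<oplus>\<^bsub>End_ring R M\<^esub> g \<in> carrier (End_ring R M)"
      using f g M by (auto simp: End_ring_mem End_ring_ops PiE_iff a_ac r_distr subset_iff)
    show "f \<oplus>\<^bsub>End_ring R M\<^esub> g = g \<oplus>\<^bsub>End_ring R M\<^esub> f"
      using f g by (auto simp: End_ring_ops End_ring_mem PiE_iff a_comm)
    assume h: "h \<in> carrier (End_ring R M)"
    show "f \<oplus>\<^bsub>End_ring R M\<^esub> g \<oplus>\<^bsub>End_ring R M\<^esub> h
        = f \<oplus>\<^bsub>End_ring R M\<^esub> (g \<oplus>\<^bsub>End_ring R M\<^esub> h)"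
      using f g h by (auto simp: End_ring_ops End_ring_mem PiE_iff a_assoc)
  next
    show "\<zero>\<^bsub>End_ring R M\<^esub> \<in> carrier (End_ring R M)"
      using M by (auto simp: End_ring_ops End_ring_mem)
  next
    fix f assume f: "f \<in> carrier (End_ring R M)"
    then show "\<zero>\<^bsub>End_ring R M\<^esub> \<oplus>\<^bsub>End_ring R M\<^esub> f = f"
      by (auto simp: End_ring_ops End_ring_mem PiE_iff extensional_def)
    have "(\<lambda>x\<in>carrier R. \<ominus> f x) \<in> carrier (End_ring R M)"
      using f M by (auto simp: End_ring_mem PiE_iff subset_iff minus_add r_minus)
    moreover have "(\<lambda>x\<in>carrier R. \<ominus> f x) \<oplus>\<^bsub>End_ring R M\<^esub> f = \<zero>\<^bsub>End_ring R M\<^esub>"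
      using f by (auto simp: End_ring_ops End_ring_mem PiE_iff l_neg)
    ultimately show "\<exists>g\<in>carrier (End_ring R M). g \<oplus>\<^bsub>End_ring R M\<^esub> f = \<zero>\<^bsub>End_ring R M\<^esub>"
      by blast
  qed
  show "monoid (End_ring R M)"
    using M by (unfold_locales)
      (auto simp: End_ring_mem End_ring_ops PiE_iff compose_def subset_iff extensional_def fun_eq_iff)
qed (auto simp: End_ring_mem End_ring_ops PiE_iff compose_def)

lemma mulop_closed: "a \<in> carrier R \<Longrightarrow> M \<subseteq> carrier R \<Longrightarrow> mulop R a \<in> carrier (End_ring R M)"
  by (auto simp: End_ring_mem mulop_def r_distr m_lcomm subset_iff)

lemma End_ring_zero: "f \<in> carrier (End_ring R M) \<Longrightarrow> f \<zero> = \<zero>"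
  using End_ring_add[of f R M \<zero> \<zero>] End_ring_closed[of f R M \<zero>] by (simp add: add.l_cancel_one')

lemma End_ring_minus:
  assumes "f \<in> carrier (End_ring R M)" "x \<in> carrier R" shows "f (\<ominus> x) = \<ominus> f x"
proof -
  have "f (\<ominus> x) \<oplus> f x = \<zero>"
    using End_ring_add[OF assms(1), of "\<ominus> x" x] assms(2) End_ring_zero[OF assms(1)] by (simp add: l_neg)
  then show ?thesis
    using assms by (simp add: End_ring_closed minus_equality)
qed

lemma End_ring_diff:
  assumes "f \<in> carrier (End_ring R M)" "x \<in> carrier R" "y \<in> carrier R"
  shows "f (x \<ominus> y) = f x \<ominus> f y"
  using assms by (simp add: a_minus_def End_ring_add[OF assms(1)] End_ring_minus[OF assms(1)])

lemma End_ring_a_inv: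
  assumes M: "M \<subseteq> carrier R" and f: "f \<in> carrier (End_ring R M)"
  shows "\<ominus>\<^bsub>End_ring R M\<^esub> f = (\<lambda>x\<in>carrier R. \<ominus> f x)"
proof -
  interpret E: ring "End_ring R M" using M by (rule ring_End_ring)
  have "(\<lambda>x\<in>carrier R. \<ominus> f x) \<in> carrier (End_ring R M)"
    using f M by (auto simp: End_ring_mem PiE_iff subset_iff minus_add r_minus)
  moreover have "(\<lambda>x\<in>carrier R. \<ominus> f x) \<oplus>\<^bsub>End_ring R M\<^esub> f = \<zero>\<^bsub>End_ring R M\<^esub>"
    using f by (auto simp: End_ring_ops End_ring_mem PiE_iff l_neg)
  ultimately show ?thesis using f by (simp add: E.minus_equality)
qed

lemma End_ring_a_minus:
  assumes M: "M \<subseteq> carrier R" and f: "f \<in> carrier (End_ring R M)" and g: "g \<in> carrier (End_ring R M)"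
  shows "f \<ominus>\<^bsub>End_ring R M\<^esub> g = (\<lambda>x\<in>carrier R. f x \<ominus> g x)"
  by (auto simp: a_minus_def[of "End_ring R M"] End_ring_a_inv[OF M g] End_ring_ops a_minus_def)

lemma twisted_comm_closed:
  assumes M: "M \<subseteq> carrier R" and "x \<in> carrier R" "a \<in> carrier R" "f \<in> carrier (End_ring R M)"
  shows "twisted_comm R x a f \<in> carrier (End_ring R M)"
proof -
  have f: "\<And>y. y \<in> carrier R \<Longrightarrow> f y \<in> carrier R" using assms by (auto simp: End_ring_mem)
  { fix y z assume yz: "y \<in> carrier R" "z \<in> carrier R"
    have "f (x \<otimes> (y \<oplus> z)) = f (x \<otimes> y) \<oplus> f (x \<otimes> z)"
      using yz assms by (simp add: r_distr End_ring_add[OF assms(4)])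
    then have "twisted_comm R x a f (y \<oplus> z) = twisted_comm R x a f y \<oplus> twisted_comm R x a f z"
      using f[of "x \<otimes> y"] f[of "x \<otimes> z"] f[of y] f[of z] yz assms
      by (simp add: twisted_comm_def End_ring_add[OF assms(4)]) algebra }
  moreover
  { fix m y assume my: "m \<in> M" "y \<in> carrier R"
    then have m: "m \<in> carrier R" using M by auto
    have "f (x \<otimes> (m \<otimes> y)) = m \<otimes> f (x \<otimes> y)"
      using my m assms by (simp add: m_lcomm[of x m y] End_ring_smult[OF assms(4)])
    then have "twisted_comm R x a f (m \<otimes> y) = m \<otimes> twisted_comm R x a f y"
      using f[of "x \<otimes> y"] f[of y] my m assms
      by (simp add: twisted_comm_def End_ring_smult[OF assms(4)]) algebra }
  ultimately show ?thesis using f assms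
    by (auto simp: End_ring_mem twisted_comm_def)
qed

lemma twisted_comm_eq:
  assumes M: "M \<subseteq> carrier R" and "x \<in> carrier R" "a \<in> carrier R" "f \<in> carrier (End_ring R M)"
  shows "f \<otimes>\<^bsub>End_ring R M\<^esub> mulop R x \<ominus>\<^bsub>End_ring R M\<^esub> mulop R a \<otimes>\<^bsub>End_ring R M\<^esub> f = twisted_comm R x a f"
proof -
  interpret E: ring "End_ring R M" using M by (rule ring_End_ring)
  have "f \<otimes>\<^bsub>End_ring R M\<^esub> mulop R x \<in> carrier (End_ring R M)"
    "mulop R a \<otimes>\<^bsub>End_ring R M\<^esub> f \<in> carrier (End_ring R M)"
    using assms mulop_closed by auto
  then show ?thesis using assms
    by (auto simp: End_ring_a_minus twisted_comm_def End_ring_ops compose_def mulop_def End_ring_closed fun_eq_iff)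
qed

end

subsection \<open>Subrings of the endomorphism ring containing the multiplications\<close>

context field
begin

lemma inv_closed': "x \<in> carrier R \<Longrightarrow> x \<noteq> \<zero> \<Longrightarrow> inv x \<in> carrier R"
  using field_Units by auto

lemma inv_l: "x \<in> carrier R \<Longrightarrow> x \<noteq> \<zero> \<Longrightarrow> inv x \<otimes> x = \<one>"
  using field_Units by auto

lemma inv_r: "x \<in> carrier R \<Longrightarrow> x \<noteq> \<zero> \<Longrightarrow> x \<otimes> inv x = \<one>"
  using field_Units by auto

end

text \<open>The algebra side of the Jacobson-Bourbaki correspondence. Closure of \<open>A\<close>
  under scalars from \<open>K\<close> comes with \<open>mulops\<close>.\<close>

locale operator_algebra = field R for R (structure) +
  fixes K and A
  assumes K: "subfield K R"
    and A: "subring A (End_ring R K)"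
    and mulops: "mulop R ` carrier R \<subseteq> A"
begin

lemma K_carrier: "K \<subseteq> carrier R"
  using K by (rule subfieldE(3))

lemma A_End: "a \<in> A \<Longrightarrow> a \<in> carrier (End_ring R K)"
  using subringE(1)[OF A] by auto

lemma A_closed: "a \<in> A \<Longrightarrow> x \<in> carrier R \<Longrightarrow> a x \<in> carrier R"
  using A_End End_ring_closed by metis

lemma A_add: "a \<in> A \<Longrightarrow> b \<in> A \<Longrightarrow> (\<lambda>x\<in>carrier R. a x \<oplus> b x) \<in> A"
  using subringE(7)[OF A, of a b] by (simp add: End_ring_ops)

lemma A_comp: "a \<in> A \<Longrightarrow> b \<in> A \<Longrightarrow> (\<lambda>x\<in>carrier R. a (b x)) \<in> A"
  using subringE(6)[OF A, of a b] by (simp add: End_ring_ops compose_def)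

lemma A_mul:
  assumes "l \<in> carrier R" "a \<in> A" shows "(\<lambda>x\<in>carrier R. l \<otimes> a x) \<in> A"
proof -
  have "(\<lambda>x\<in>carrier R. mulop R l (a x)) \<in> A"
    using A_comp[of "mulop R l" a] mulops assms by auto
  moreover have "(\<lambda>x\<in>carrier R. mulop R l (a x)) = (\<lambda>x\<in>carrier R. l \<otimes> a x)"
    using A_closed[OF assms(2)] by (auto simp: mulop_def fun_eq_iff)
  ultimately show ?thesis by simp
qed

lemma A_diff:
  assumes "a \<in> A" "b \<in> A" shows "(\<lambda>x\<in>carrier R. a x \<ominus> b x) \<in> A"
proof -
  have "(\<lambda>x\<in>carrier R. a x \<oplus> (\<lambda>y\<in>carrier R. \<ominus> \<one> \<otimes> b y) x) \<in> A"
    by (intro A_add A_mul) (use assms in auto)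
  moreover have "(\<lambda>x\<in>carrier R. a x \<oplus> (\<lambda>y\<in>carrier R. \<ominus> \<one> \<otimes> b y) x) = (\<lambda>x\<in>carrier R. a x \<ominus> b x)"
    using A_closed[OF assms(2)] by (auto simp: fun_eq_iff a_minus_def l_minus)
  ultimately show ?thesis by simp
qed

lemma id_A: "(\<lambda>x\<in>carrier R. x) \<in> A"
  using subringE(3)[OF A] by (simp add: End_ring_ops)

lemma field_centralizer_iff:
  "m \<in> field_centralizer R K A \<longleftrightarrow>
     m \<in> carrier R \<and> (\<forall>a\<in>A. \<forall>x\<in>carrier R. a (m \<otimes> x) = m \<otimes> a x)"
proof -
  have "(mulop R m \<otimes>\<^bsub>End_ring R K\<^esub> a = a \<otimes>\<^bsub>End_ring R K\<^esub> mulop R m)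
      \<longleftrightarrow> (\<forall>x\<in>carrier R. a (m \<otimes> x) = m \<otimes> a x)" if "a \<in> A" for a
    using A_closed[OF that] by (auto simp: End_ring_ops compose_def mulop_def fun_eq_iff)
  then show ?thesis by (auto simp: field_centralizer_def)
qed

lemma K_le_field_centralizer: "K \<subseteq> field_centralizer R K A"
  using K_carrier End_ring_smult[OF A_End] by (auto simp: field_centralizer_iff)

lemma subfield_field_centralizer: "subfield (field_centralizer R K A) R"
proof (rule subfieldI')
  show "subring (field_centralizer R K A) R"
  proof (rule subringI)
    show "field_centralizer R K A \<subseteq> carrier R" by (auto simp: field_centralizer_iff)
    show "\<one> \<in> field_centralizer R K A"
      using A_closed by (auto simp: field_centralizer_iff)
  next
    fix h assume h: "h \<in> field_centralizer R K A"
    then show "\<ominus> h \<in> field_centralizer R K A"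
      by (auto simp: field_centralizer_iff l_minus A_closed End_ring_minus[OF A_End])
  next
    fix h g assume h: "h \<in> field_centralizer R K A" "g \<in> field_centralizer R K A"
    then show "h \<otimes> g \<in> field_centralizer R K A"
      by (auto simp: field_centralizer_iff m_assoc A_closed)
    from h show "h \<oplus> g \<in> field_centralizer R K A"
      by (auto simp: field_centralizer_iff l_distr A_closed End_ring_add[OF A_End])
  qed
next
  fix k assume "k \<in> field_centralizer R K A - {\<zero>}"
  then have k: "k \<in> carrier R" "k \<noteq> \<zero>"
    and c: "\<And>a x. a \<in> A \<Longrightarrow> x \<in> carrier R \<Longrightarrow> a (k \<otimes> x) = k \<otimes> a x"
    by (auto simp: field_centralizer_iff)
  { fix a x assume a: "a \<in> A" "x \<in> carrier R"
    \<comment> \<open>Write \<open>x\<close> as \<open>k \<otimes> (inv k \<otimes> x)\<close> and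
      pull \<open>k\<close> out of \<open>a\<close>.\<close>
    have "inv k \<otimes> a x = inv k \<otimes> a (k \<otimes> (inv k \<otimes> x))"
      using k a by (simp add: m_assoc[symmetric] inv_r inv_closed')
    also have "\<dots> = a (inv k \<otimes> x)"
      using k a c[of a "inv k \<otimes> x"] by (simp add: m_assoc[symmetric] inv_l inv_closed' A_closed)
    finally have "a (inv k \<otimes> x) = inv k \<otimes> a x" by simp }
  then show "inv k \<in> field_centralizer R K A"
    using k by (auto simp: field_centralizer_iff inv_closed')
qed

text \<open>Let \<open>M\<close> be the centralizer field. If no \<open>a \<in> A\<close> vanishing on \<open>V = Mv + W\<close> separated \<open>x\<close>,
  then \<open>a v \<mapsto> a x\<close>, for \<open>a\<close> vanishing on \<open>W\<close>, would be a well-defined \<open>A\<close>-linear map of the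
  field to itself, hence multiplication by some \<open>m \<in> M\<close>, and \<open>x - mv\<close> could not be separated
  from \<open>W\<close>.\<close>

lemma separation:
  assumes V: "dimension n (field_centralizer R K A) V"
  shows "x \<in> carrier R \<Longrightarrow> x \<notin> V \<Longrightarrow> \<exists>a\<in>A. (\<forall>v\<in>V. a v = \<zero>) \<and> a x \<noteq> \<zero>"
  using V
proof (induct n "field_centralizer R K A" V arbitrary: x rule: dimension.induct)
  case zero_dim
  then show ?case using id_A by (intro bexI[OF _ id_A]) auto
next
  case (Suc_dim v W n)
  let ?M = "field_centralizer R K A"
  have M: "subfield ?M R" by (rule subfield_field_centralizer)
  have W: "W \<subseteq> carrier R" using space_subgroup_props(1)[OF M Suc_dim.hyps(3)] .
  show ?case
  proof (rule ccontr)
    assume neg: "\<not> ?thesis"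
    have lin: "a (m \<otimes> v \<oplus> w) = m \<otimes> a v \<oplus> a w" if "a \<in> A" "m \<in> ?M" "w \<in> W" for a m w
      using that W Suc_dim.hyps(1) by (auto simp: field_centralizer_iff End_ring_add[OF A_End])
    \<comment> \<open>The negated claim, reduced to the generators of the line extension: an
      operator killing \<open>W\<close> and \<open>v\<close> kills \<open>x\<close> as well.\<close>
    have kill: "a x = \<zero>" if a: "a \<in> A" "\<And>w. w \<in> W \<Longrightarrow> a w = \<zero>" "a v = \<zero>" for a
    proof (rule ccontr)
      assume ax: "a x \<noteq> \<zero>"
      have "a u = \<zero>" if "u \<in> line_extension ?M v W" for u
      proof -
        obtain m w where "m \<in> ?M" "w \<in> W" "u = m \<otimes> v \<oplus> w"
          using \<open>u \<in> line_extension ?M v W\<close> unfolding line_extension_mem_iff by blast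
        then show ?thesis using lin[OF a(1)] a(2,3) subfieldE(3)[OF M] by auto
      qed
      then show False using neg a(1) ax by blast
    qed
    obtain a0 where a0: "a0 \<in> A" "\<And>w. w \<in> W \<Longrightarrow> a0 w = \<zero>" "a0 v \<noteq> \<zero>"
      using Suc_dim.hyps(4)[OF Suc_dim.hyps(1,2)] by blast
    \<comment> \<open>A coordinate functional for \<open>v\<close> relative to \<open>W\<close>,
      normalised to \<open>\<one>\<close> at \<open>v\<close>; the scalar \<open>m\<close> sought is
      its value at \<open>x\<close>.\<close>
    define a1 where "a1 = (\<lambda>y\<in>carrier R. inv (a0 v) \<otimes> a0 y)"
    have iv: "inv (a0 v) \<in> carrier R" using a0 Suc_dim.hyps(1) by (simp add: inv_closed' A_closed)
    have a1: "a1 \<in> A" "\<And>w. w \<in> W \<Longrightarrow> a1 w = \<zero>" "a1 v = \<one>"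
      using A_mul[OF iv a0(1)] a0 iv W Suc_dim.hyps(1) by (auto simp: a1_def inv_l A_closed)
    define m where "m = a1 x"
    have m: "m \<in> carrier R" using A_closed[OF a1(1) Suc_dim.prems(1)] by (simp add: m_def)
    have ax: "a x = a v \<otimes> m" if a: "a \<in> A" "\<And>w. w \<in> W \<Longrightarrow> a w = \<zero>" for a
    proof -
      have av: "a v \<in> carrier R" using a(1) Suc_dim.hyps(1) A_closed by blast
      \<comment> \<open>Subtracting \<open>a v\<close> times \<open>a1\<close> leaves an operator
        that kills both \<open>W\<close> and \<open>v\<close>, so \<open>kill\<close>
        applies.\<close>
      define b where "b = (\<lambda>y\<in>carrier R. a y \<ominus> (\<lambda>y\<in>carrier R. a v \<otimes> a1 y) y)"
      have "b \<in> A" unfolding b_def by (intro A_diff A_mul a a1 av)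
      moreover have "b w = \<zero>" if "w \<in> W" for w
        using that W a a1 av by (auto simp: b_def)
      moreover have "b v = \<zero>" using av a1 Suc_dim.hyps(1) by (simp add: b_def)
      ultimately have "b x = \<zero>" by (rule kill)
      then show ?thesis
        using Suc_dim.prems(1) A_closed[OF a(1)] m av by (simp add: b_def m_def[symmetric])
    qed
    have mM: "m \<in> ?M"
      unfolding field_centralizer_iff
    proof (intro conjI ballI m)
      fix b l assume b: "b \<in> A" and l: "l \<in> carrier R"
      \<comment> \<open>Since \<open>a1 v = \<one>\<close>, the composite of \<open>b\<close>,
        multiplication by \<open>l\<close> and \<open>a1\<close> has the value \<open>b l\<close> at
        \<open>v\<close> and \<open>b (l \<otimes> m)\<close> at \<open>x\<close>. Comparing them by
        \<open>ax\<close> shows that \<open>b\<close> commutes with \<open>m\<close>.\<close>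
      define c where "c = (\<lambda>y\<in>carrier R. b ((\<lambda>y\<in>carrier R. l \<otimes> a1 y) y))"
      have "c \<in> A" unfolding c_def by (intro A_comp A_mul b l a1)
      moreover have "c w = \<zero>" if "w \<in> W" for w
        using that W l a1 End_ring_zero[OF A_End[OF b]] by (auto simp: c_def)
      ultimately have "c x = c v \<otimes> m" by (rule ax)
      then show "b (m \<otimes> l) = m \<otimes> b l"
        using l m Suc_dim.prems(1) Suc_dim.hyps(1) A_closed[OF b] a1(3)
        by (simp add: c_def m_def[symmetric] m_comm)
    qed
    \<comment> \<open>As \<open>m\<close> lies in the centralizer field, \<open>x'\<close> is still
      outside \<open>W\<close>, yet by \<open>ax\<close> every operator of \<open>A\<close> killing
      \<open>W\<close> kills \<open>x'\<close>. This contradicts the induction hypothesis.\<close>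
    define x' where "x' = x \<ominus> m \<otimes> v"
    have x': "x' \<in> carrier R" using m Suc_dim by (simp add: x'_def)
    have mv: "m \<otimes> v \<in> carrier R" using m Suc_dim by simp
    have "x = m \<otimes> v \<oplus> x'" using m Suc_dim.prems(1) mv
      by (simp add: x'_def a_minus_def a_lcomm[of "m \<otimes> v" x] r_neg)
    then have "x' \<notin> W" using Suc_dim.prems(2) mM by (auto simp: line_extension_mem_iff)
    then obtain a where a: "a \<in> A" "\<And>w. w \<in> W \<Longrightarrow> a w = \<zero>" "a x' \<noteq> \<zero>"
      using Suc_dim.hyps(4)[OF x'] by blast
    have "a x' = a x \<ominus> m \<otimes> a v"
      using mM a(1) mv Suc_dim.hyps(1) Suc_dim.prems(1)
      by (simp add: x'_def End_ring_diff[OF A_End[OF a(1)]] field_centralizer_iff)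
    also have "\<dots> = \<zero>"
      using ax[OF a(1,2)] m A_closed[OF a(1) Suc_dim.hyps(1)] by (simp add: m_comm)
    finally show False using a(3) by simp
  qed
qed

text \<open>Density in the manner of Newton interpolation: an operator that is right on
  \<open>W\<close> is corrected at one further vector \<open>v\<close> by a multiple of an operator
  from \<open>separation\<close>, which vanishes on \<open>W\<close> and so disturbs
  nothing.\<close>

lemma interpolation:
  assumes f: "f \<in> carrier (End_ring R (field_centralizer R K A))"
    and V: "dimension n (field_centralizer R K A) V"
  shows "\<exists>a\<in>A. \<forall>v\<in>V. a v = f v"
  using V
proof (induct n "field_centralizer R K A" V rule: dimension.induct)
  case zero_dim
  then show ?case using id_A End_ring_zero[OF f] by (intro bexI[OF _ id_A]) auto
next
  case (Suc_dim v W n)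
  let ?M = "field_centralizer R K A"
  have W: "W \<subseteq> carrier R" using space_subgroup_props(1)[OF subfield_field_centralizer Suc_dim.hyps(3)] .
  obtain a where a: "a \<in> A" "\<And>w. w \<in> W \<Longrightarrow> a w = f w" using Suc_dim.hyps(4) by blast
  obtain c where c: "c \<in> A" "\<And>w. w \<in> W \<Longrightarrow> c w = \<zero>" "c v \<noteq> \<zero>"
    using separation[OF Suc_dim.hyps(3,1,2)] by blast
  define l where "l = (f v \<ominus> a v) \<otimes> inv (c v)"
  have cl: "a v \<in> carrier R" "c v \<in> carrier R" "f v \<in> carrier R" "inv (c v) \<in> carrier R"
    using a c Suc_dim.hyps(1) f by (auto simp: A_closed End_ring_closed inv_closed')
  then have l: "l \<in> carrier R" by (simp add: l_def)
  define b where "b = (\<lambda>y\<in>carrier R. a y \<oplus> (\<lambda>y\<in>carrier R. l \<otimes> c y) y)"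
  have b: "b \<in> A" unfolding b_def by (intro A_add A_mul a c l)
  have "l \<otimes> c v = f v \<ominus> a v"
    using cl c by (simp add: l_def m_assoc inv_l)
  then have bv: "b v = f v"
    using cl Suc_dim.hyps(1) by (simp add: b_def a_minus_def a_lcomm[of "a v"] r_neg)
  have bw: "b w = f w" if "w \<in> W" for w
    using that W a c l f by (auto simp: b_def subset_iff End_ring_closed)
  have "b (m \<otimes> v \<oplus> w) = f (m \<otimes> v \<oplus> w)" if "m \<in> ?M" "w \<in> W" for m w
    using that W b f bv bw[OF that(2)] Suc_dim.hyps(1)
    by (auto simp: field_centralizer_iff End_ring_add[OF A_End] End_ring_add[OF f] End_ring_smult[OF f] subset_iff)
  then show ?case using b by (intro bexI[OF _ b]) (auto simp: line_extension_mem_iff)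
qed

text \<open>Finite dimension lets \<open>interpolation\<close> be applied to the whole field at
  once, where agreement on all vectors is equality.\<close>

theorem jacobson_bourbaki:
  assumes "finite_dimension (field_centralizer R K A) (carrier R)"
  shows "A = carrier (End_ring R (field_centralizer R K A))"
proof
  show "A \<subseteq> carrier (End_ring R (field_centralizer R K A))"
  proof
    fix a assume a: "a \<in> A"
    then show "a \<in> carrier (End_ring R (field_centralizer R K A))"
      using A_End[OF a] by (auto simp: End_ring_mem field_centralizer_iff)
  qed
  show "carrier (End_ring R (field_centralizer R K A)) \<subseteq> A"
  proof
    fix f assume f: "f \<in> carrier (End_ring R (field_centralizer R K A))"
    obtain n where "dimension n (field_centralizer R K A) (carrier R)" using assms by blast
    then obtain a where "a \<in> A" "\<And>v. v \<in> carrier R \<Longrightarrow> a v = f v" using interpolation[OF f] by blast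
    then show "f \<in> A" using End_ring_eqI[OF A_End f, of a] by auto
  qed
qed

end

subsection \<open>Dimension of the endomorphism ring\<close>

context field
begin

section \<open>Hyperplanes and linear functionals\<close>

lemma in_line_extension:
  assumes "subfield M R" "v \<in> carrier R" "dimension k M V"
  shows "v \<in> line_extension M v V" "V \<subseteq> line_extension M v V"
proof -
  have V: "V \<subseteq> carrier R" "\<zero> \<in> V" using space_subgroup_props[OF assms(1,3)] by auto
  have M: "\<one> \<in> M" "\<zero> \<in> M" using subringE(2,3)[OF subfieldE(1)[OF assms(1)]] by auto
  show "v \<in> line_extension M v V"
    unfolding line_extension_mem_iff
    by (rule bexI[OF _ M(1)], rule bexI[OF _ V(2)]) (simp add: assms(2))
  show "V \<subseteq> line_extension M v V"
  proof
    fix w assume w: "w \<in> V"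
    then have "w = \<zero> \<otimes> v \<oplus> w" using V(1) assms(2) by (simp add: subset_iff)
    then show "w \<in> line_extension M v V" using M(2) w unfolding line_extension_mem_iff by blast
  qed
qed

text \<open>Steinitz exchange for one vector: the coefficient of \<open>y\<close> in
  \<open>x\<close> is nonzero because \<open>x\<close> is outside \<open>V\<close>, so the relation
  can be solved for \<open>y\<close>.\<close>

lemma line_extension_exchange:
  assumes M: "subfield M R" and V: "dimension k M V"
    and "x \<in> carrier R" "y \<in> carrier R" "x \<notin> V" "x \<in> line_extension M y V"
  shows "y \<in> line_extension M x V"
proof -
  obtain m v where mv: "m \<in> M" "v \<in> V" "x = m \<otimes> y \<oplus> v"
    using assms(6) by (auto simp: line_extension_mem_iff)
  note props = space_subgroup_props[OF M V]
  have m: "m \<in> carrier R" and v: "v \<in> carrier R" using mv props(1) subfieldE(3)[OF M] by auto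
  have "m \<noteq> \<zero>" using mv assms v by auto
  then have im: "inv m \<in> M" using subfield_m_inv(1)[OF M, of m] mv(1) by auto
  have imc: "inv m \<in> carrier R" using im subfieldE(3)[OF M] by auto
  have "inv m \<otimes> x = inv m \<otimes> m \<otimes> y \<oplus> inv m \<otimes> v"
    using mv(3) m v imc assms(4) by (simp add: r_distr m_assoc)
  then have "inv m \<otimes> x = y \<oplus> inv m \<otimes> v"
    using inv_l[OF m \<open>m \<noteq> \<zero>\<close>] assms(4) by simp
  then have "y = inv m \<otimes> x \<oplus> \<ominus> (inv m \<otimes> v)"
    using imc v assms(4) by (simp add: a_assoc r_neg)
  moreover have "\<ominus> (inv m \<otimes> v) \<in> V" using props im mv by auto
  ultimately show ?thesis using im by (auto simp: line_extension_mem_iff)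
qed

text \<open>A hyperplane through \<open>V\<close> that misses \<open>x\<close> is grown one vector
  at a time. The new vector is taken outside \<open>line_extension M x V\<close>, and exchange then
  keeps \<open>x\<close> outside. The codimension \<open>n - k\<close> decreases.\<close>

lemma complement:
  assumes M: "subfield M R" and L: "dimension n M (carrier R)"
    and V: "dimension k M V" and x: "x \<in> carrier R" "x \<notin> V"
  shows "\<exists>W m. dimension m M W \<and> V \<subseteq> W \<and> x \<notin> W \<and> carrier R = line_extension M x W"
  using V x(2)
proof (induction "n - k" arbitrary: k V rule: less_induct)
  case less
  note V = less.prems(1)
  have dx: "dimension (Suc k) M (line_extension M x V)" using Suc_dim[OF x(1) less.prems(2) V] .
  show ?case
  proof (cases "line_extension M x V = carrier R")
    case True
    then show ?thesis using less.prems by blast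
  next
    case False
    then obtain y where y: "y \<in> carrier R" "y \<notin> line_extension M x V"
      using space_subgroup_props(1)[OF M dx] by auto
    then have "y \<notin> V" using in_line_extension(2)[OF M x(1) V] by auto
    then have d: "dimension (Suc k) M (line_extension M y V)" using Suc_dim[OF y(1) _ V] by auto
    have "x \<notin> line_extension M y V"
      using line_extension_exchange[OF M V x(1) y(1) less.prems(2)] y(2) by auto
    \<comment> \<open>Needed because of truncated subtraction: \<open>n - k\<close> drops strictly
      only while \<open>k < n\<close>.\<close>
    moreover have "Suc k \<le> n"
    proof -
      obtain Us where Us: "independent M Us" "length Us = Suc k" "set Us \<subseteq> carrier R"
        using exists_base[OF M d] by auto
      then show ?thesis using independent_length_le_dimension[OF M L Us(1,3)] by simp
    qed
    ultimately obtain W m where "dimension m M W \<and> line_extension M y V \<subseteq> W \<and> x \<notin> W \<and> carrier R = line_extension M x W"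
      using less.hyps[OF _ d] by (metis Suc_le_lessD diff_less_mono2 lessI)
    then show ?thesis using in_line_extension(2)[OF M y(1) V] by blast
  qed
qed

text \<open>The functional reads off the coefficient of \<open>x\<close> in the decomposition along
  a hyperplane containing \<open>V\<close>. Its values lie in \<open>M\<close>, but it is regarded
  as an operator on the whole field.\<close>

lemma functional:
  assumes M: "subfield M R" and L: "finite_dimension M (carrier R)"
    and V: "dimension k M V" and x: "x \<in> carrier R" "x \<notin> V"
  obtains f where "f \<in> carrier (End_ring R M)" "\<And>v. v \<in> V \<Longrightarrow> f v = \<zero>" "f x = \<one>"
proof -
  obtain n where n: "dimension n M (carrier R)" using L by blast
  obtain W m where W: "dimension m M W" "V \<subseteq> W" "x \<notin> W" "carrier R = line_extension M x W"
    using complement[OF M n V x] by blast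
  note props = space_subgroup_props[OF M W(1)]
  have Mc: "M \<subseteq> carrier R" using M by (rule subfieldE(3))
  note Mr = subringE[OF subfieldE(1)[OF M]]
  \<comment> \<open>Two different coefficients would, after division by their difference, put
    \<open>x\<close> into \<open>W\<close>.\<close>
  have uniq: "a = b" if "a \<in> M" "b \<in> M" "v \<in> W" "w \<in> W" "a \<otimes> x \<oplus> v = b \<otimes> x \<oplus> w" for a b v w
  proof (rule ccontr)
    assume "a \<noteq> b"
    have c: "a \<in> carrier R" "b \<in> carrier R" "v \<in> carrier R" "w \<in> carrier R"
      using that Mc props(1) by auto
    then have "a \<ominus> b \<noteq> \<zero>" using \<open>a \<noteq> b\<close> by simp
    moreover have "a \<ominus> b \<in> M" using that Mr by (auto simp: a_minus_def)
    moreover have "(a \<ominus> b) \<otimes> x = w \<ominus> v"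
    proof -
      have "(a \<ominus> b) \<otimes> x = (a \<otimes> x \<oplus> v) \<ominus> b \<otimes> x \<ominus> v" using c x(1) by algebra
      also have "\<dots> = (b \<otimes> x \<oplus> w) \<ominus> b \<otimes> x \<ominus> v" using that(5) by simp
      also have "\<dots> = w \<ominus> v" using c x(1) by algebra
      finally show ?thesis .
    qed
    moreover have "w \<ominus> v \<in> W" using that props by (auto simp: a_minus_def)
    ultimately show False using props(6)[of "a \<ominus> b" x] x(1) W(3) by auto
  qed
  define f where "f = (\<lambda>y\<in>carrier R. SOME a. a \<in> M \<and> (\<exists>w\<in>W. y = a \<otimes> x \<oplus> w))"
  have f: "f (a \<otimes> x \<oplus> w) = a" if "a \<in> M" "w \<in> W" for a w
  proof -
    have "a \<otimes> x \<oplus> w \<in> carrier R" using that x(1) Mc props(1) by auto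
    then show ?thesis unfolding f_def
      using that uniq by (auto intro!: some_equality)
  qed
  have ex: "\<exists>a\<in>M. \<exists>w\<in>W. y = a \<otimes> x \<oplus> w" if "y \<in> carrier R" for y
    using that W(4) by (auto simp: line_extension_mem_iff)
  have "f \<in> carrier (End_ring R M)"
    unfolding End_ring_mem
  proof (intro conjI ballI)
    show "f \<in> carrier R \<rightarrow>\<^sub>E carrier R"
    proof (rule PiE_I)
      fix y assume "y \<in> carrier R"
      then obtain a w where "a \<in> M" "w \<in> W" "y = a \<otimes> x \<oplus> w" using ex by blast
      then show "f y \<in> carrier R" using f Mc by auto
    qed (simp add: f_def)
  next
    fix y z assume "y \<in> carrier R" "z \<in> carrier R"
    then obtain a w b v where aw: "a \<in> M" "w \<in> W" "y = a \<otimes> x \<oplus> w" "b \<in> M" "v \<in> W" "z = b \<otimes> x \<oplus> v"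
      using ex by meson
    then have "y \<oplus> z = (a \<oplus> b) \<otimes> x \<oplus> (w \<oplus> v)"
      using x(1) Mc props(1) by (simp add: subset_iff) algebra
    moreover have "w \<oplus> v \<in> W" "a \<oplus> b \<in> M" using aw props Mr by auto
    ultimately show "f (y \<oplus> z) = f y \<oplus> f z" using aw f by auto
  next
    fix k y assume k: "k \<in> M" and "y \<in> carrier R"
    then obtain a w where aw: "a \<in> M" "w \<in> W" "y = a \<otimes> x \<oplus> w" using ex by meson
    then have "k \<otimes> y = (k \<otimes> a) \<otimes> x \<oplus> (k \<otimes> w)"
      using x(1) k Mc props(1) by (simp add: subset_iff) algebra
    moreover have "k \<otimes> w \<in> W" "k \<otimes> a \<in> M" using aw k props Mr by auto
    ultimately show "f (k \<otimes> y) = k \<otimes> f y" using aw f by auto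
  qed
  moreover have "f v = \<zero>" if "v \<in> V" for v
  proof -
    have "v \<in> W" "v \<in> carrier R" using that W(2) props(1) by auto
    then show ?thesis using f[of \<zero> v] x(1) Mr(2) by simp
  qed
  moreover have "f x = \<one>"
    using f[of \<one> \<zero>] x(1) Mr(3) props(2) by simp
  ultimately show ?thesis by (rule that)
qed

text \<open>Recovers \<open>M\<close> from the operators linear over it, which yields injectivity of
  the correspondence and the centralizer of \<open>E(L/M)\<close>. For \<open>x\<close> outside
  \<open>M\<close>, a functional that kills the line \<open>M\<close> and is \<open>\<one>\<close>
  at \<open>x\<close> violates the equation, since it also vanishes at
  \<open>\<one>\<close>.\<close>

lemma mem_subfield_iff_End_ring:
  assumes M: "subfield M R" and L: "finite_dimension M (carrier R)" and x: "x \<in> carrier R"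
  shows "x \<in> M \<longleftrightarrow> (\<forall>f\<in>carrier (End_ring R M). f x = x \<otimes> f \<one>)"
proof
  assume "x \<in> M"
  then show "\<forall>f\<in>carrier (End_ring R M). f x = x \<otimes> f \<one>"
    using x End_ring_smult[of _ R M x \<one>] by auto
next
  assume *: "\<forall>f\<in>carrier (End_ring R M). f x = x \<otimes> f \<one>"
  show "x \<in> M"
  proof (rule ccontr)
    assume "x \<notin> M"
    obtain f where "f \<in> carrier (End_ring R M)" "\<And>v. v \<in> M \<Longrightarrow> f v = \<zero>" "f x = \<one>"
      using functional[OF M L dimension_one[OF M] x \<open>x \<notin> M\<close>] by blast
    then show False using * x subringE(3)[OF subfieldE(1)[OF M]] by auto
  qed
qed

section \<open>The copy of \<open>L\<close> in the operator ring, and dimensions over it\<close>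

lemma ring_hom_mulop:
  assumes F: "F \<subseteq> carrier R" shows "ring_hom_ring R (End_ring R F) (mulop R)"
  by (intro ring_hom_ringI2 ring_axioms ring_End_ring ring_hom_memI)
    (use F mulop_closed in \<open>auto simp: End_ring_ops mulop_def compose_def l_distr m_assoc fun_eq_iff\<close>)

lemma inj_mulop: "inj_on (mulop R) (carrier R)"
proof (rule inj_onI)
  fix x y assume xy: "x \<in> carrier R" "y \<in> carrier R" "mulop R x = mulop R y"
  then have "mulop R x \<one> = mulop R y \<one>" by simp
  then show "x = y" using xy by (simp add: mulop_def)
qed

lemma End_ring_one_not_zero: "\<one>\<^bsub>End_ring R F\<^esub> \<noteq> \<zero>\<^bsub>End_ring R F\<^esub>"
proof
  assume "\<one>\<^bsub>End_ring R F\<^esub> = \<zero>\<^bsub>End_ring R F\<^esub>"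
  then have "\<one>\<^bsub>End_ring R F\<^esub> \<one> = \<zero>\<^bsub>End_ring R F\<^esub> \<one>" by simp
  then show False by (simp add: End_ring_ops)
qed

lemma subfield_mulop:
  assumes F: "F \<subseteq> carrier R" and M: "subfield M R"
  shows "subfield (mulop R ` M) (End_ring R F)"
proof -
  interpret h: ring_hom_ring R "End_ring R F" "mulop R" using F by (rule ring_hom_mulop)
  show ?thesis using h.img_is_subfield(2)[OF M End_ring_one_not_zero] .
qed

lemma dimension_mulop:
  assumes F: "F \<subseteq> carrier R" and M: "subfield M R" and V: "dimension n M V"
  shows "ring.dimension (End_ring R F) n (mulop R ` M) (mulop R ` V)"
proof -
  interpret h: ring_hom_ring R "End_ring R F" "mulop R" using F by (rule ring_hom_mulop)
  show ?thesis
    using h.inj_hom_dimension[OF M End_ring_one_not_zero _ V] inj_on_subset[OF inj_mulop]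
      space_subgroup_props(1)[OF M V] by auto
qed

definition annihilator :: "'a set \<Rightarrow> 'a set \<Rightarrow> ('a \<Rightarrow> 'a) set" where
  "annihilator M V = {f \<in> carrier (End_ring R M). \<forall>v\<in>V. f v = \<zero>}"

text \<open>As \<open>V\<close> shrinks to zero, its annihilator grows to everything, by one
  dimension over \<open>L\<close> with each basis vector removed. The induction peels
  \<open>V\<close>, so the dimension \<open>j\<close> already reached has to be arbitrary.\<close>

lemma dimension_End_ring_aux:
  assumes V: "dimension k M V" and M: "subfield M R" and L: "finite_dimension M (carrier R)"
    and F: "F \<subseteq> M"
    and "ring.dimension (End_ring R F) j (mulop R ` carrier R) (annihilator M V)"
  shows "ring.dimension (End_ring R F) (j + k) (mulop R ` carrier R) (carrier (End_ring R M))"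
  using assms
proof (induct k M V arbitrary: j rule: dimension.induct)
  case (zero_dim M)
  have "annihilator M {\<zero>} = carrier (End_ring R M)"
    using End_ring_zero by (auto simp: annihilator_def)
  then show ?case using zero_dim by simp
next
  case (Suc_dim v W n M)
  note M = \<open>subfield M R\<close> and L = \<open>finite_dimension M (carrier R)\<close> and F = \<open>F \<subseteq> M\<close>
  have Mc: "M \<subseteq> carrier R" using M by (rule subfieldE(3))
  interpret EM: ring "End_ring R M" using Mc by (rule ring_End_ring)
  interpret E: ring "End_ring R F" using F Mc by (intro ring_End_ring) auto
  let ?Lm = "mulop R ` carrier R"
  let ?V = "line_extension M v W"
  have W: "W \<subseteq> carrier R" using space_subgroup_props(1)[OF M Suc_dim.hyps(3)] .
  \<comment> \<open>A dual vector to \<open>v\<close>. Splitting off \<open>f v\<close> times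
    \<open>c\<close> from \<open>f\<close> exhibits \<open>annihilator M W\<close> as one line
    larger than \<open>annihilator M ?V\<close>.\<close>
  obtain c where c: "c \<in> carrier (End_ring R M)" "\<And>w. w \<in> W \<Longrightarrow> c w = \<zero>" "c v = \<one>"
    using functional[OF M L Suc_dim.hyps(3,1,2)] by blast
  have sub: "carrier (End_ring R M) \<subseteq> carrier (End_ring R F)" using F by (rule End_ring_mono)
  have "annihilator M W = E.line_extension ?Lm c (annihilator M ?V)"
  proof
    show "annihilator M W \<subseteq> E.line_extension ?Lm c (annihilator M ?V)"
    proof
      fix f assume f: "f \<in> annihilator M W"
      then have fE: "f \<in> carrier (End_ring R M)" by (simp add: annihilator_def)
      have fv: "f v \<in> carrier R" using fE Suc_dim.hyps(1) by (rule End_ring_closed)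
      define h where "h = mulop R (f v) \<otimes>\<^bsub>End_ring R M\<^esub> c"
      have h: "h \<in> carrier (End_ring R M)" using c fv Mc mulop_closed by (auto simp: h_def)
      have hx: "h x = f v \<otimes> c x" if "x \<in> carrier R" for x
        using that End_ring_closed[OF c(1)] by (simp add: h_def End_ring_ops compose_def mulop_def)
      define g where "g = f \<ominus>\<^bsub>End_ring R M\<^esub> h"
      have g: "g \<in> carrier (End_ring R M)" using fE h by (simp add: g_def)
      have gx: "g x = f x \<ominus> f v \<otimes> c x" if "x \<in> carrier R" for x
        using that hx by (simp add: g_def End_ring_a_minus[OF Mc fE h])
      have "g u = \<zero>" if "u \<in> ?V" for u
      proof -
        obtain m w where "m \<in> M" "w \<in> W" and u: "u = m \<otimes> v \<oplus> w"
          using \<open>u \<in> ?V\<close> unfolding line_extension_mem_iff by blast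
        have "g w = \<zero>" using \<open>w \<in> W\<close> W f fv c by (auto simp: gx subset_iff annihilator_def)
        moreover have "g v = \<zero>" using Suc_dim.hyps(1) fv c by (simp add: gx)
        ultimately show ?thesis
          using \<open>m \<in> M\<close> \<open>w \<in> W\<close> W Mc Suc_dim.hyps(1)
          by (auto simp: u End_ring_add[OF g] End_ring_smult[OF g] subset_iff)
      qed
      then have "g \<in> annihilator M ?V" using g by (simp add: annihilator_def)
      moreover have "f = mulop R (f v) \<otimes>\<^bsub>End_ring R F\<^esub> c \<oplus>\<^bsub>End_ring R F\<^esub> g"
      proof (rule End_ring_eqI[OF fE])
        show "mulop R (f v) \<otimes>\<^bsub>End_ring R F\<^esub> c \<oplus>\<^bsub>End_ring R F\<^esub> g \<in> carrier (End_ring R F)"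
          using fv c(1) g sub F Mc mulop_closed[of "f v" F] by (intro E.add.m_closed E.m_closed) auto
        fix x assume x: "x \<in> carrier R"
        then have "f x \<in> carrier R" "c x \<in> carrier R"
          using fE c(1) by (auto intro: End_ring_closed)
        then show "f x = (mulop R (f v) \<otimes>\<^bsub>End_ring R F\<^esub> c \<oplus>\<^bsub>End_ring R F\<^esub> g) x"
          using x fv by (simp add: End_ring_ops compose_def mulop_def gx) algebra
      qed
      ultimately show "f \<in> E.line_extension ?Lm c (annihilator M ?V)"
        unfolding E.line_extension_mem_iff using fv by blast
    qed
  next
    show "E.line_extension ?Lm c (annihilator M ?V) \<subseteq> annihilator M W"
    proof
      fix f assume "f \<in> E.line_extension ?Lm c (annihilator M ?V)"
      then obtain l g where l: "l \<in> carrier R" and g: "g \<in> annihilator M ?V"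
        and f: "f = mulop R l \<otimes>\<^bsub>End_ring R F\<^esub> c \<oplus>\<^bsub>End_ring R F\<^esub> g"
        unfolding E.line_extension_mem_iff by blast
      have f': "f = mulop R l \<otimes>\<^bsub>End_ring R M\<^esub> c \<oplus>\<^bsub>End_ring R M\<^esub> g"
        unfolding f by (simp add: End_ring_ops)
      have "f \<in> carrier (End_ring R M)"
        unfolding f' using g c(1) l mulop_closed[OF l Mc] by (auto simp: annihilator_def)
      moreover have "f w = \<zero>" if "w \<in> W" for w
      proof -
        have "g w = \<zero>" using that g in_line_extension(2)[OF M Suc_dim.hyps(1,3)]
          by (auto simp: annihilator_def)
        then show ?thesis using that W l c(2) by (auto simp: f End_ring_ops compose_def mulop_def)
      qed
      ultimately show "f \<in> annihilator M W" by (simp add: annihilator_def)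
    qed
  qed
  moreover have "c \<notin> annihilator M ?V"
  proof
    assume "c \<in> annihilator M ?V"
    then have "c v = \<zero>" using in_line_extension(1)[OF M Suc_dim.hyps(1,3)] by (simp add: annihilator_def)
    then show False using c(3) by simp
  qed
  ultimately have "E.dimension (Suc j) ?Lm (annihilator M W)"
    using E.Suc_dim[of c "annihilator M ?V" j ?Lm] c(1) sub Suc_dim.prems(4) by auto
  then have "E.dimension (Suc j + n) ?Lm (carrier (End_ring R M))"
    by (rule Suc_dim.hyps(4)[OF M L F])
  then show ?case by simp
qed

lemma dimension_End_ring:
  assumes M: "subfield M R" and L: "dimension n M (carrier R)" and F: "F \<subseteq> M"
  shows "ring.dimension (End_ring R F) n (mulop R ` carrier R) (carrier (End_ring R M))"
proof -
  have Mc: "M \<subseteq> carrier R" using M by (rule subfieldE(3))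
  interpret E: ring "End_ring R F" using F Mc by (intro ring_End_ring) auto
  have "annihilator M (carrier R) = {\<zero>\<^bsub>End_ring R F\<^esub>}"
  proof -
    interpret EM: ring "End_ring R M" using Mc by (rule ring_End_ring)
    have z: "\<zero>\<^bsub>End_ring R F\<^esub> = \<zero>\<^bsub>End_ring R M\<^esub>" by (simp add: End_ring_ops)
    have "f = \<zero>\<^bsub>End_ring R M\<^esub>" if "f \<in> annihilator M (carrier R)" for f
    proof (rule End_ring_eqI[OF _ EM.zero_closed])
      show "f \<in> carrier (End_ring R M)" using that by (simp add: annihilator_def)
      show "f x = \<zero>\<^bsub>End_ring R M\<^esub> x" if "x \<in> carrier R" for x
        using that \<open>f \<in> annihilator M (carrier R)\<close> by (simp add: annihilator_def End_ring_ops)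
    qed
    moreover have "\<zero>\<^bsub>End_ring R M\<^esub> \<in> annihilator M (carrier R)"
      using EM.zero_closed unfolding annihilator_def by (simp add: End_ring_ops)
    ultimately show ?thesis unfolding z by blast
  qed
  then have "E.dimension 0 (mulop R ` carrier R) (annihilator M (carrier R))" by simp
  from dimension_End_ring_aux[OF L M finite_dimensionI[OF L] F this] show ?thesis by simp
qed

end

subsection \<open>Generalised eigenspaces of right multiplications\<close>

text \<open>The operations of the operator rings detached from the field of scalars, so that one
  calculus serves all intermediate fields.\<close>

definition op_add :: "('a, 'b) ring_scheme \<Rightarrow> ('a \<Rightarrow> 'a) \<Rightarrow> ('a \<Rightarrow> 'a) \<Rightarrow> 'a \<Rightarrow> 'a" where
  "op_add R f g = (\<lambda>y\<in>carrier R. f y \<oplus>\<^bsub>R\<^esub> g y)"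

definition left_scale :: "('a, 'b) ring_scheme \<Rightarrow> 'a \<Rightarrow> ('a \<Rightarrow> 'a) \<Rightarrow> 'a \<Rightarrow> 'a" where
  "left_scale R l f = (\<lambda>y\<in>carrier R. l \<otimes>\<^bsub>R\<^esub> f y)"

definition right_scale :: "('a, 'b) ring_scheme \<Rightarrow> 'a \<Rightarrow> ('a \<Rightarrow> 'a) \<Rightarrow> 'a \<Rightarrow> 'a" where
  "right_scale R x f = (\<lambda>y\<in>carrier R. f (x \<otimes>\<^bsub>R\<^esub> y))"

definition op_zero :: "('a, 'b) ring_scheme \<Rightarrow> 'a \<Rightarrow> 'a" where
  "op_zero R = (\<lambda>y\<in>carrier R. \<zero>\<^bsub>R\<^esub>)"

text \<open>Modules over the tensor product of \<open>L\<close> with itself, acting through values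
  and through arguments. Such a set is stable under every \<open>twisted_comm R x a\<close>, and
  eigenspaces inside it are of the same kind, which lets eigenspaces be taken repeatedly.\<close>

definition bimodule :: "('a, 'b) ring_scheme \<Rightarrow> ('a \<Rightarrow> 'a) set \<Rightarrow> bool" where
  "bimodule R U \<longleftrightarrow> U \<subseteq> carrier (End_ring R {}) \<and> op_zero R \<in> U \<and>
     (\<forall>f\<in>U. \<forall>g\<in>U. op_add R f g \<in> U) \<and>
     (\<forall>l\<in>carrier R. \<forall>f\<in>U. left_scale R l f \<in> U \<and> right_scale R l f \<in> U)"

text \<open>Here \<open>twisted_comm R x a\<close> is right multiplication by \<open>x\<close> minus
  the scalar \<open>a\<close> acting on values, so its nilpotent vectors are generalised
  eigenvectors for the eigenvalue \<open>a\<close>.\<close>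

definition gen_eigenspace ::
    "('a, 'b) ring_scheme \<Rightarrow> ('a \<Rightarrow> 'a) set \<Rightarrow> 'a \<Rightarrow> 'a \<Rightarrow> ('a \<Rightarrow> 'a) set" where
  "gen_eigenspace R U x a = {f \<in> U. \<exists>k. (twisted_comm R x a ^^ k) f = op_zero R}"

section \<open>Calculus of right multiplications minus scalars\<close>

context cring
begin

text \<open>Over the empty set of scalars, \<open>End_ring\<close> consists of all additive endomorphisms.\<close>

abbreviation "additive_End \<equiv> carrier (End_ring R {})"

lemma additive_End_closed: "f \<in> additive_End \<Longrightarrow> x \<in> carrier R \<Longrightarrow> f x \<in> carrier R"
  by (rule End_ring_closed)

lemma additive_End_eqI:
  "f \<in> additive_End \<Longrightarrow> g \<in> additive_End \<Longrightarrow> (\<And>x. x \<in> carrier R \<Longrightarrow> f x = g x) \<Longrightarrow> f = g"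
  by (rule End_ring_eqI)

lemma op_zero_closed: "M \<subseteq> carrier R \<Longrightarrow> op_zero R \<in> carrier (End_ring R M)"
  by (auto simp: op_zero_def End_ring_mem)

lemma op_add_closed:
  "M \<subseteq> carrier R \<Longrightarrow> f \<in> carrier (End_ring R M) \<Longrightarrow> g \<in> carrier (End_ring R M)
     \<Longrightarrow> op_add R f g \<in> carrier (End_ring R M)"
  using ring.ring_simprules(1)[OF ring_End_ring, of M f g] by (simp add: End_ring_ops op_add_def)

lemma left_scale_closed:
  assumes "M \<subseteq> carrier R" "l \<in> carrier R" "f \<in> carrier (End_ring R M)"
  shows "left_scale R l f \<in> carrier (End_ring R M)"
  using assms by (auto simp: left_scale_def End_ring_mem PiE_iff r_distr m_lcomm subset_iff)

lemma right_scale_closed: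
  assumes "M \<subseteq> carrier R" "l \<in> carrier R" "f \<in> carrier (End_ring R M)"
  shows "right_scale R l f \<in> carrier (End_ring R M)"
  using assms by (auto simp: right_scale_def End_ring_mem PiE_iff r_distr m_lcomm[of l] subset_iff)

lemma bimodule_End_ring: "M \<subseteq> carrier R \<Longrightarrow> bimodule R (carrier (End_ring R M))"
  by (simp add: bimodule_def op_zero_closed op_add_closed left_scale_closed right_scale_closed End_ring_mono)

lemma bimoduleD:
  assumes "bimodule R U"
  shows "U \<subseteq> additive_End" "op_zero R \<in> U" "f \<in> U \<Longrightarrow> g \<in> U \<Longrightarrow> op_add R f g \<in> U"
    "l \<in> carrier R \<Longrightarrow> f \<in> U \<Longrightarrow> left_scale R l f \<in> U" "l \<in> carrier R \<Longrightarrow> f \<in> U \<Longrightarrow> right_scale R l f \<in> U"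
  using assms by (auto simp: bimodule_def)

lemmas additive_End_ops = bimoduleD(2-)[OF bimodule_End_ring[OF empty_subsetI]]

lemma twisted_comm_additive_End: "x \<in> carrier R \<Longrightarrow> a \<in> carrier R \<Longrightarrow> f \<in> additive_End \<Longrightarrow> twisted_comm R x a f \<in> additive_End"
  by (rule twisted_comm_closed) auto

lemma twisted_comm_expand:
  assumes "x \<in> carrier R" "a \<in> carrier R" "f \<in> additive_End"
  shows "twisted_comm R x a f = op_add R (right_scale R x f) (left_scale R (\<ominus> a) f)"
  using additive_End_closed[OF assms(3)] assms
  by (auto simp: twisted_comm_def op_add_def right_scale_def left_scale_def a_minus_def l_minus fun_eq_iff)

lemma twisted_comm_bimodule:
  "bimodule R U \<Longrightarrow> x \<in> carrier R \<Longrightarrow> a \<in> carrier R \<Longrightarrow> f \<in> U \<Longrightarrow> twisted_comm R x a f \<in> U"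
  using bimoduleD[of U] by (simp add: twisted_comm_expand subset_iff)

lemma twisted_comm_pow_bimodule:
  "bimodule R U \<Longrightarrow> x \<in> carrier R \<Longrightarrow> a \<in> carrier R \<Longrightarrow> f \<in> U \<Longrightarrow> (twisted_comm R x a ^^ k) f \<in> U"
  by (induction k) (auto intro: twisted_comm_bimodule)

lemmas twisted_comm_pow_additive_End = twisted_comm_pow_bimodule[OF bimodule_End_ring[OF empty_subsetI]]

lemma twisted_comm_op_zero: "x \<in> carrier R \<Longrightarrow> a \<in> carrier R \<Longrightarrow> twisted_comm R x a (op_zero R) = op_zero R"
  by (auto simp: twisted_comm_def op_zero_def)

lemma twisted_comm_op_add:
  assumes "x \<in> carrier R" "a \<in> carrier R" "f \<in> additive_End" "g \<in> additive_End"
  shows "twisted_comm R x a (op_add R f g) = op_add R (twisted_comm R x a f) (twisted_comm R x a g)"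
proof (rule additive_End_eqI)
  fix y assume y: "y \<in> carrier R"
  have "f y \<in> carrier R" "f (x \<otimes> y) \<in> carrier R" "g y \<in> carrier R" "g (x \<otimes> y) \<in> carrier R"
    using assms y additive_End_closed by auto
  then show "twisted_comm R x a (op_add R f g) y = op_add R (twisted_comm R x a f) (twisted_comm R x a g) y"
    using assms y by (simp add: twisted_comm_def op_add_def) algebra
qed (use assms in \<open>auto intro!: twisted_comm_additive_End additive_End_ops\<close>)

lemma twisted_comm_left_scale:
  assumes "x \<in> carrier R" "a \<in> carrier R" "l \<in> carrier R" "f \<in> additive_End"
  shows "twisted_comm R x a (left_scale R l f) = left_scale R l (twisted_comm R x a f)"
proof (rule additive_End_eqI)
  fix y assume y: "y \<in> carrier R"
  have "f y \<in> carrier R" "f (x \<otimes> y) \<in> carrier R" using assms y additive_End_closed by auto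
  then show "twisted_comm R x a (left_scale R l f) y = left_scale R l (twisted_comm R x a f) y"
    using assms y by (simp add: twisted_comm_def left_scale_def) algebra
qed (use assms in \<open>auto intro!: twisted_comm_additive_End additive_End_ops\<close>)

lemma twisted_comm_right_scale:
  assumes "x \<in> carrier R" "a \<in> carrier R" "l \<in> carrier R" "f \<in> additive_End"
  shows "twisted_comm R x a (right_scale R l f) = right_scale R l (twisted_comm R x a f)"
  using assms by (auto simp: twisted_comm_def right_scale_def m_lcomm fun_eq_iff)

lemma twisted_comm_commute:
  assumes "x \<in> carrier R" "a \<in> carrier R" "z \<in> carrier R" "b \<in> carrier R" "f \<in> additive_End"
  shows "twisted_comm R x a (twisted_comm R z b f) = twisted_comm R z b (twisted_comm R x a f)"
  using assms
  by (simp add: twisted_comm_expand[of z b] twisted_comm_additive_End twisted_comm_op_add twisted_comm_left_scale twisted_comm_right_scale additive_End_ops)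

text \<open>Changing the eigenvalue alters the operator by a scalar, which is invertible for
  distinct eigenvalues in a field. Both lemmas on pairs of eigenvalues rest on this.\<close>

lemma twisted_comm_shift:
  assumes "x \<in> carrier R" "a \<in> carrier R" "b \<in> carrier R" "f \<in> additive_End"
  shows "twisted_comm R x a f = op_add R (twisted_comm R x b f) (left_scale R (b \<ominus> a) f)"
proof (rule additive_End_eqI)
  fix y assume y: "y \<in> carrier R"
  have "f y \<in> carrier R" "f (x \<otimes> y) \<in> carrier R" using assms y additive_End_closed by auto
  then show "twisted_comm R x a f y = op_add R (twisted_comm R x b f) (left_scale R (b \<ominus> a) f) y"
    using assms y by (simp add: twisted_comm_def left_scale_def op_add_def) algebra
qed (use assms in \<open>auto intro!: twisted_comm_additive_End additive_End_ops\<close>)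

lemma twisted_comm_pow_op_zero:
  "x \<in> carrier R \<Longrightarrow> a \<in> carrier R \<Longrightarrow> (twisted_comm R x a ^^ k) (op_zero R) = op_zero R"
  by (induction k) (auto simp: twisted_comm_op_zero)

lemma twisted_comm_pow_op_add:
  assumes "x \<in> carrier R" "a \<in> carrier R" "f \<in> additive_End" "g \<in> additive_End"
  shows "(twisted_comm R x a ^^ k) (op_add R f g) = op_add R ((twisted_comm R x a ^^ k) f) ((twisted_comm R x a ^^ k) g)"
  using assms by (induction k) (auto simp: twisted_comm_op_add twisted_comm_pow_additive_End)

lemma twisted_comm_pow_left_scale:
  assumes "x \<in> carrier R" "a \<in> carrier R" "l \<in> carrier R" "f \<in> additive_End"
  shows "(twisted_comm R x a ^^ k) (left_scale R l f) = left_scale R l ((twisted_comm R x a ^^ k) f)"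
  using assms by (induction k) (auto simp: twisted_comm_left_scale twisted_comm_pow_additive_End)

lemma twisted_comm_pow_right_scale:
  assumes "x \<in> carrier R" "a \<in> carrier R" "l \<in> carrier R" "f \<in> additive_End"
  shows "(twisted_comm R x a ^^ k) (right_scale R l f) = right_scale R l ((twisted_comm R x a ^^ k) f)"
  using assms by (induction k) (auto simp: twisted_comm_right_scale twisted_comm_pow_additive_End)

lemma twisted_comm_pow_commute:
  assumes "x \<in> carrier R" "a \<in> carrier R" "z \<in> carrier R" "b \<in> carrier R" "f \<in> additive_End"
  shows "(twisted_comm R x a ^^ k) (twisted_comm R z b f) = twisted_comm R z b ((twisted_comm R x a ^^ k) f)"
  using assms by (induction k) (auto simp: twisted_comm_commute[of x a z b] twisted_comm_pow_additive_End)

lemma op_add_op_zero: "f \<in> additive_End \<Longrightarrow> op_add R f (op_zero R) = f" "f \<in> additive_End \<Longrightarrow> op_add R (op_zero R) f = f"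
  by (auto intro!: additive_End_eqI additive_End_ops) (simp_all add: op_add_def op_zero_def additive_End_closed)

lemma left_scale_op_zero: "l \<in> carrier R \<Longrightarrow> left_scale R l (op_zero R) = op_zero R"
  by (auto simp: left_scale_def op_zero_def)

lemma right_scale_op_zero: "l \<in> carrier R \<Longrightarrow> right_scale R l (op_zero R) = op_zero R"
  by (auto simp: right_scale_def op_zero_def)

lemma twisted_comm_pow_mono:
  assumes "x \<in> carrier R" "a \<in> carrier R" "(twisted_comm R x a ^^ k) f = op_zero R" "k \<le> m"
  shows "(twisted_comm R x a ^^ m) f = op_zero R"
proof -
  have "(twisted_comm R x a ^^ m) f = (twisted_comm R x a ^^ (m - k)) ((twisted_comm R x a ^^ k) f)"
    using assms(4) by (metis funpow_add comp_apply le_add_diff_inverse2)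
  then show ?thesis using assms by (simp add: twisted_comm_pow_op_zero)
qed

lemma bimodule_gen_eigenspace:
  assumes U: "bimodule R U" and x: "x \<in> carrier R" "a \<in> carrier R"
  shows "bimodule R (gen_eigenspace R U x a)"
  unfolding bimodule_def
proof (intro conjI ballI)
  show "gen_eigenspace R U x a \<subseteq> additive_End" using bimoduleD(1)[OF U] by (auto simp: gen_eigenspace_def)
  show "op_zero R \<in> gen_eigenspace R U x a"
    using bimoduleD(2)[OF U] by (auto simp: gen_eigenspace_def intro: exI[of _ 0])
next
  fix f g assume f: "f \<in> gen_eigenspace R U x a" and g: "g \<in> gen_eigenspace R U x a"
  then obtain k m where km: "(twisted_comm R x a ^^ k) f = op_zero R" "(twisted_comm R x a ^^ m) g = op_zero R"
    by (auto simp: gen_eigenspace_def)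
  have fg: "f \<in> U" "g \<in> U" "f \<in> additive_End" "g \<in> additive_End" using f g bimoduleD(1)[OF U] by (auto simp: gen_eigenspace_def)
  have "(twisted_comm R x a ^^ max k m) (op_add R f g) = op_zero R"
    using twisted_comm_pow_mono[OF x km(1), of "max k m"] twisted_comm_pow_mono[OF x km(2), of "max k m"] fg x
    by (simp add: twisted_comm_pow_op_add op_add_op_zero additive_End_ops)
  then show "op_add R f g \<in> gen_eigenspace R U x a"
    using bimoduleD(3)[OF U] fg by (auto simp: gen_eigenspace_def)
next
  fix l f assume l: "l \<in> carrier R" and f: "f \<in> gen_eigenspace R U x a"
  then obtain k where k: "(twisted_comm R x a ^^ k) f = op_zero R" and fU: "f \<in> U" "f \<in> additive_End"
    using bimoduleD(1)[OF U] by (auto simp: gen_eigenspace_def)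
  then have "(twisted_comm R x a ^^ k) (left_scale R l f) = op_zero R" "(twisted_comm R x a ^^ k) (right_scale R l f) = op_zero R"
    using x l by (simp_all add: twisted_comm_pow_left_scale twisted_comm_pow_right_scale left_scale_op_zero right_scale_op_zero)
  then show "left_scale R l f \<in> gen_eigenspace R U x a" "right_scale R l f \<in> gen_eigenspace R U x a"
    using bimoduleD(4,5)[OF U l] fU by (auto simp: gen_eigenspace_def)
qed

lemma bimodule_eigenspace:
  assumes U: "bimodule R U" and x: "x \<in> carrier R" "a \<in> carrier R"
  shows "bimodule R {f \<in> U. twisted_comm R x a f = op_zero R}"
  using bimoduleD[OF U] x
  by (auto simp: bimodule_def subset_iff twisted_comm_op_zero twisted_comm_op_add twisted_comm_left_scale twisted_comm_right_scale left_scale_op_zero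
      right_scale_op_zero op_add_op_zero additive_End_ops)

end

context field
begin

lemma left_scale_eq_op_zero:
  assumes "l \<in> carrier R" "l \<noteq> \<zero>" "f \<in> additive_End" "left_scale R l f = op_zero R"
  shows "f = op_zero R"
proof (rule additive_End_eqI[OF assms(3) additive_End_ops(1)])
  fix y assume y: "y \<in> carrier R"
  have "l \<otimes> f y = \<zero>" using fun_cong[OF assms(4), of y] y by (simp add: left_scale_def op_zero_def)
  then show "f y = op_zero R y" using assms y additive_End_closed[of f y] by (simp add: integral_iff op_zero_def)
qed

text \<open>On the kernel of the operator for \<open>a\<close>, the operator for \<open>b\<close> is
  the nonzero scalar \<open>a \<ominus> b\<close>, so no power of it kills a nonzero element. The
  general case descends on \<open>k\<close>, because the two operators commute.\<close>

lemma gen_eigen_disjoint: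
  assumes x: "x \<in> carrier R" "a \<in> carrier R" "b \<in> carrier R" "a \<noteq> b" and f: "f \<in> additive_End"
    and "(twisted_comm R x a ^^ k) f = op_zero R" "(twisted_comm R x b ^^ j) f = op_zero R"
  shows "f = op_zero R"
proof -
  have ab: "a \<ominus> b \<noteq> \<zero>" "a \<ominus> b \<in> carrier R" using x by auto
  have 1: "f = op_zero R" if "f \<in> additive_End" "twisted_comm R x a f = op_zero R" "(twisted_comm R x b ^^ j) f = op_zero R" for f j
    using that
  proof (induction j arbitrary: f)
    case (Suc j)
    have e: "twisted_comm R x b f = left_scale R (a \<ominus> b) f"
      using twisted_comm_shift[of x b a f] Suc.prems x by (simp add: op_add_op_zero additive_End_ops)
    have "twisted_comm R x b f = op_zero R"
    proof (rule Suc.IH)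
      show "twisted_comm R x b f \<in> additive_End" using Suc.prems x by (simp add: twisted_comm_additive_End)
      show "twisted_comm R x a (twisted_comm R x b f) = op_zero R"
        using Suc.prems x by (simp add: twisted_comm_commute[of x a x b] twisted_comm_op_zero)
      show "(twisted_comm R x b ^^ j) (twisted_comm R x b f) = op_zero R"
        using Suc.prems by (simp add: funpow_swap1)
    qed
    then show ?case using e left_scale_eq_op_zero[OF ab(2,1)] Suc.prems by simp
  qed simp
  show ?thesis
    using f assms(6,7)
  proof (induction k arbitrary: f)
    case (Suc k)
    have "(twisted_comm R x a ^^ k) f = op_zero R"
    proof (rule 1[of _ j])
      show "(twisted_comm R x a ^^ k) f \<in> additive_End" using Suc.prems x by (simp add: twisted_comm_pow_additive_End)
      show "twisted_comm R x a ((twisted_comm R x a ^^ k) f) = op_zero R" using Suc.prems by simp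
      have "(twisted_comm R x b ^^ j) ((twisted_comm R x a ^^ k) f) = (twisted_comm R x a ^^ k) ((twisted_comm R x b ^^ j) f)"
        using Suc.prems(1) x by (induction k) (simp_all add: twisted_comm_pow_commute twisted_comm_pow_additive_End)
      then show "(twisted_comm R x b ^^ j) ((twisted_comm R x a ^^ k) f) = op_zero R"
        using Suc.prems x by (simp add: twisted_comm_pow_op_zero)
    qed
    then show ?case using Suc by simp
  qed simp
qed

text \<open>On the generalised eigenspace for \<open>b\<close>, the operator for \<open>a\<close> is
  the nonzero scalar \<open>b \<ominus> a\<close> plus a nilpotent operator, hence invertible; the
  recursion computes the resulting finite geometric series.\<close>

lemma gen_eigen_surj:
  assumes x: "x \<in> carrier R" "a \<in> carrier R" "b \<in> carrier R" "a \<noteq> b"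
    and U: "bimodule R U" and "g \<in> U" "(twisted_comm R x b ^^ k) g = op_zero R"
  shows "\<exists>h\<in>U. (twisted_comm R x b ^^ k) h = op_zero R \<and> twisted_comm R x a h = g"
  using assms(6,7)
proof (induction k arbitrary: g)
  case 0
  then show ?case using x bimoduleD(2)[OF U] by (intro bexI[of _ "op_zero R"]) (auto simp: twisted_comm_op_zero)
next
  case (Suc k)
  have ba: "b \<ominus> a \<noteq> \<zero>" "b \<ominus> a \<in> carrier R" using x by auto
  note inv = inv_closed'[OF ba(2,1)] inv_l[OF ba(2,1)]
  have U': "f \<in> additive_End" if "f \<in> U" for f using that bimoduleD(1)[OF U] by auto
  have tg: "twisted_comm R x b g \<in> U" using Suc.prems U x by (simp add: twisted_comm_bimodule)
  obtain h' where h': "h' \<in> U" "(twisted_comm R x b ^^ k) h' = op_zero R" "twisted_comm R x a h' = twisted_comm R x b g"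
    using Suc.IH[OF tg] Suc.prems by (auto simp: funpow_swap1)
  \<comment> \<open>The operator for \<open>a\<close> takes \<open>h'\<close> to
    \<open>twisted_comm R x b g\<close>, so it takes the difference of \<open>g\<close> and
    \<open>h'\<close> to \<open>b \<ominus> a\<close> times \<open>g\<close>. The factor
    \<open>\<ominus> \<one>\<close> encodes the subtraction.\<close>
  define h where "h = left_scale R (inv (b \<ominus> a)) (op_add R g (left_scale R (\<ominus> \<one>) h'))"
  have hU: "h \<in> U" using bimoduleD[OF U] inv h' Suc.prems by (simp add: h_def)
  moreover have "(twisted_comm R x b ^^ Suc k) h = op_zero R"
    using Suc.prems h' U' inv x twisted_comm_pow_mono[OF x(1,3) h'(2), of "Suc k"]
    by (simp add: h_def twisted_comm_pow_left_scale twisted_comm_pow_op_add twisted_comm_left_scale twisted_comm_op_add left_scale_op_zero op_add_op_zero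
        additive_End_ops twisted_comm_pow_additive_End del: funpow.simps)
  moreover have "twisted_comm R x a h = g"
  proof (rule additive_End_eqI)
    fix y assume y: "y \<in> carrier R"
    have "twisted_comm R x a h = left_scale R (inv (b \<ominus> a)) (op_add R (op_add R (twisted_comm R x b g) (left_scale R (b \<ominus> a) g)) (left_scale R (\<ominus> \<one>) (twisted_comm R x b g)))"
      using Suc.prems h' U' inv x
      by (simp add: h_def twisted_comm_left_scale twisted_comm_op_add additive_End_ops flip: twisted_comm_shift)
    then have "twisted_comm R x a h y = inv (b \<ominus> a) \<otimes> (twisted_comm R x b g y \<oplus> (b \<ominus> a) \<otimes> g y \<oplus> \<ominus> \<one> \<otimes> twisted_comm R x b g y)"
      using y by (simp add: left_scale_def op_add_def)
    also have "\<dots> = inv (b \<ominus> a) \<otimes> (b \<ominus> a) \<otimes> g y"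
    proof -
      have "twisted_comm R x b g y \<in> carrier R" "g y \<in> carrier R"
        using y U' tg Suc.prems additive_End_closed by auto
      then show ?thesis using inv(1) ba(2) x by algebra
    qed
    also have "\<dots> = g y" using inv y U' Suc.prems additive_End_closed by simp
    finally show "twisted_comm R x a h y = g y" .
  qed (use hU U' Suc.prems x in \<open>auto intro: twisted_comm_additive_End\<close>)
  ultimately show ?case by blast
qed

end

subsection \<open>Decomposition into generalised eigenspaces\<close>

text \<open>The value at \<open>f\<close> of a polynomial in right multiplication by
  \<open>x\<close>, with coefficients acting from the left. Lists start with the leading
  coefficient, whence the exponent \<open>length p\<close>.\<close>

primrec right_poly_action :: "('a, 'b) ring_scheme \<Rightarrow> 'a \<Rightarrow> ('a \<Rightarrow> 'a) \<Rightarrow> 'a list \<Rightarrow> 'a \<Rightarrow> 'a" where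
  "right_poly_action R x f [] = op_zero R"
| "right_poly_action R x f (c # p) =
     op_add R (left_scale R c (right_scale R (x [^]\<^bsub>R\<^esub> length p) f)) (right_poly_action R x f p)"

context cring
begin

lemma left_scale_op_add:
  "l \<in> carrier R \<Longrightarrow> f \<in> additive_End \<Longrightarrow> g \<in> additive_End \<Longrightarrow> left_scale R l (op_add R f g) = op_add R (left_scale R l f) (left_scale R l g)"
  by (auto simp: left_scale_def op_add_def r_distr additive_End_closed fun_eq_iff)

lemma right_poly_action_bimodule:
  "bimodule R U \<Longrightarrow> x \<in> carrier R \<Longrightarrow> f \<in> U \<Longrightarrow> set p \<subseteq> carrier R \<Longrightarrow> right_poly_action R x f p \<in> U"
  by (induction p) (auto intro!: bimoduleD)

text \<open>Products of polynomials are understood through coefficients, so the list recursion is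
  replaced by a sum over exponents. The bound \<open>n\<close> is left free so that a polynomial and
  its multiples can be summed over matching ranges.\<close>

lemma right_poly_action_coeff:
  assumes "x \<in> carrier R" "f \<in> additive_End" "y \<in> carrier R" "set p \<subseteq> carrier R" "length p \<le> n"
  shows "right_poly_action R x f p y = (\<Oplus>i\<in>{..n}. coeff p i \<otimes> f (x [^] i \<otimes> y))"
  using assms(4,5)
proof (induction p)
  case Nil
  have "(\<Oplus>i\<in>{..n}. coeff [] i \<otimes> f (x [^] i \<otimes> y)) = (\<Oplus>i\<in>{..n}. \<zero>)"
    using assms by (intro finsum_cong') (auto simp: additive_End_closed)
  then show ?case using assms by (simp add: op_zero_def)
next
  case (Cons c p)
  have h: "f (x [^] i \<otimes> y) \<in> carrier R" for i :: nat using assms by (simp add: additive_End_closed)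
  have cp: "coeff p i \<in> carrier R" for i using Cons.prems by simp
  have "(\<Oplus>i\<in>{..n}. coeff (c # p) i \<otimes> f (x [^] i \<otimes> y))
      = (\<Oplus>i\<in>{..n}. (if length p = i then c \<otimes> f (x [^] i \<otimes> y) else \<zero>) \<oplus> coeff p i \<otimes> f (x [^] i \<otimes> y))"
    using Cons.prems h cp coeff_length[of p "length p"]
    by (intro finsum_cong') auto
  also have "\<dots> = (\<Oplus>i\<in>{..n}. (if length p = i then c \<otimes> f (x [^] i \<otimes> y) else \<zero>))
      \<oplus> (\<Oplus>i\<in>{..n}. coeff p i \<otimes> f (x [^] i \<otimes> y))"
    using Cons.prems h cp by (intro finsum_addf) auto
  also have "(\<Oplus>i\<in>{..n}. (if length p = i then c \<otimes> f (x [^] i \<otimes> y) else \<zero>)) = c \<otimes> f (x [^] length p \<otimes> y)"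
    using Cons.prems h by (intro add.finprod_singleton[of "length p" "{..n}" "\<lambda>i. c \<otimes> f (x [^] i \<otimes> y)"]) auto
  finally show ?case using Cons assms(3) by (simp add: op_add_def left_scale_def right_scale_def)
qed

text \<open>Coefficients from \<open>K\<close> pass through the \<open>K\<close>-linear
  \<open>f\<close>. In particular a polynomial over \<open>K\<close> with root \<open>x\<close>,
  applied to right multiplication by \<open>x\<close>, kills \<open>f\<close>.\<close>

lemma right_poly_action_eval:
  assumes "K \<subseteq> carrier R" "f \<in> carrier (End_ring R K)" "x \<in> carrier R" "y \<in> carrier R" "set p \<subseteq> K"
  shows "right_poly_action R x f p y = f (eval p x \<otimes> y)"
  using assms(5)
proof (induction p)
  case Nil
  then show ?case using assms by (simp add: op_zero_def End_ring_zero)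
next
  case (Cons c p)
  then have "c \<in> carrier R" "set p \<subseteq> carrier R" "c \<in> K" using assms(1) by auto
  moreover have "eval p x \<in> carrier R" using \<open>set p \<subseteq> carrier R\<close> assms(3) by (rule eval_in_carrier)
  ultimately show ?case
    using Cons assms
    by (simp add: op_add_def left_scale_def right_scale_def l_distr End_ring_add[OF assms(2)] m_assoc End_ring_smult[OF assms(2)])
qed

lemma coeff_monic_linear_mult:
  assumes "a \<in> carrier R" "set q \<subseteq> carrier R"
  shows "coeff (poly_mult [\<one>, \<ominus> a] q) i
    = (if i = 0 then \<zero> else coeff q (i - 1)) \<oplus> \<ominus> a \<otimes> coeff q i"
proof -
  have s: "set (map ((\<otimes>) b) q) \<subseteq> carrier R" if "b \<in> carrier R" for b using that assms(2) by auto
  have 1: "coeff (poly_mult [\<ominus> a] q) = (\<lambda>i. \<ominus> a \<otimes> coeff q i)"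
    using assms s[of "\<ominus> a"] by (simp add: poly_add_coeff scalar_coeff del: poly_add.simps)
  have "set (poly_mult [\<ominus> a] q) \<subseteq> carrier R"
    using assms by (intro poly_mult_in_carrier) auto
  moreover have "poly_mult [\<one>, \<ominus> a] q = poly_add (map ((\<otimes>) \<one>) q @ [\<zero>]) (poly_mult [\<ominus> a] q)"
    by (simp del: poly_add.simps)
  ultimately show ?thesis
    using assms s[of \<one>] by (simp add: poly_add_coeff append_coeff 1 scalar_coeff del: poly_mult.simps poly_add.simps)
qed

text \<open>A linear factor of the polynomial becomes one twisted commutator: multiplication by the
  indeterminate shifts the exponents, and this shift replaces the argument \<open>y\<close> by
  \<open>x \<otimes> y\<close>.\<close>

lemma right_poly_action_monic_linear_mult:
  assumes "x \<in> carrier R" "f \<in> additive_End" "a \<in> carrier R" "set q \<subseteq> carrier R"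
  shows "right_poly_action R x f (poly_mult [\<one>, \<ominus> a] q) = twisted_comm R x a (right_poly_action R x f q)"
proof (rule additive_End_eqI)
  let ?p = "poly_mult [\<one>, \<ominus> a] q"
  have p: "set ?p \<subseteq> carrier R" using assms by (intro poly_mult_in_carrier) auto
  note AEb = bimodule_End_ring[OF empty_subsetI]
  show "right_poly_action R x f ?p \<in> additive_End" using right_poly_action_bimodule[OF AEb] assms p by blast
  show "twisted_comm R x a (right_poly_action R x f q) \<in> additive_End"
    using right_poly_action_bimodule[OF AEb] assms by (intro twisted_comm_additive_End) auto
  fix y assume y: "y \<in> carrier R"
  define m where "m = length ?p + length q"
  have h: "f (x [^] i \<otimes> y) \<in> carrier R" for i :: nat using assms y by (simp add: additive_End_closed)
  have cq: "coeff q i \<in> carrier R" for i using assms by simp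
  have q0: "right_poly_action R x f q y \<in> carrier R" "right_poly_action R x f q (x \<otimes> y) \<in> carrier R"
    using right_poly_action_bimodule[OF AEb] assms y additive_End_closed by auto
  have "right_poly_action R x f ?p y = (\<Oplus>i\<in>{..Suc m}. coeff ?p i \<otimes> f (x [^] i \<otimes> y))"
    using assms p y by (intro right_poly_action_coeff) (auto simp: m_def)
  also have "\<dots> = (\<Oplus>i\<in>{..Suc m}. (if i = 0 then \<zero> else coeff q (i - 1)) \<otimes> f (x [^] i \<otimes> y)
      \<oplus> \<ominus> a \<otimes> (coeff q i \<otimes> f (x [^] i \<otimes> y)))"
    using assms h cq by (intro finsum_cong') (auto simp: coeff_monic_linear_mult l_distr m_assoc simp del: poly_mult.simps poly_add.simps)
  also have "\<dots> = (\<Oplus>i\<in>{..Suc m}. (if i = 0 then \<zero> else coeff q (i - 1)) \<otimes> f (x [^] i \<otimes> y))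
      \<oplus> (\<Oplus>i\<in>{..Suc m}. \<ominus> a \<otimes> (coeff q i \<otimes> f (x [^] i \<otimes> y)))"
    using assms h cq by (intro finsum_addf) auto
  also have "(\<Oplus>i\<in>{..Suc m}. \<ominus> a \<otimes> (coeff q i \<otimes> f (x [^] i \<otimes> y)))
      = \<ominus> a \<otimes> (\<Oplus>i\<in>{..Suc m}. coeff q i \<otimes> f (x [^] i \<otimes> y))"
    using assms h cq by (intro finsum_rdistr[symmetric]) auto
  also have "(\<Oplus>i\<in>{..Suc m}. coeff q i \<otimes> f (x [^] i \<otimes> y)) = right_poly_action R x f q y"
    using assms y by (intro right_poly_action_coeff[symmetric]) (auto simp: m_def)
  \<comment> \<open>The summand at \<open>i = 0\<close> is zero, so the index can be shifted
    down.\<close>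
  also have "(\<Oplus>i\<in>{..Suc m}. (if i = 0 then \<zero> else coeff q (i - 1)) \<otimes> f (x [^] i \<otimes> y))
      = (\<Oplus>i\<in>{..m}. coeff q i \<otimes> f (x [^] Suc i \<otimes> y))"
    using h h[of 0] h[of "Suc _"] cq by (subst finsum_Suc2) auto
  also have "\<dots> = (\<Oplus>i\<in>{..m}. coeff q i \<otimes> f (x [^] i \<otimes> (x \<otimes> y)))"
    using assms y h cq by (intro finsum_cong') (auto simp: m_assoc additive_End_closed)
  also have "\<dots> = right_poly_action R x f q (x \<otimes> y)"
    using assms y by (intro right_poly_action_coeff[symmetric]) (auto simp: m_def)
  finally show "right_poly_action R x f ?p y = twisted_comm R x a (right_poly_action R x f q) y"
    using y q0 assms by (simp add: twisted_comm_def a_minus_def l_minus)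
qed

end

context field
begin

text \<open>All that the eigenspace argument uses of normality: some polynomial over
  \<open>K\<close>, not necessarily minimal, has the root \<open>x\<close> and splits over the large
  field.\<close>

definition split_algebraic :: "'a set \<Rightarrow> 'a \<Rightarrow> bool" where
  "split_algebraic K x \<longleftrightarrow>
     (\<exists>p\<in>carrier (poly_ring R). p \<noteq> [] \<and> set p \<subseteq> K \<and> splitted p \<and> eval p x = \<zero>)"

lemma normal_extension_split_algebraic:
  assumes K: "subfield K R" and N: "normal_extension R K" and x: "x \<in> carrier R"
  shows "split_algebraic K x"
proof -
  have alg: "algebraic K x" using N x by (simp add: normal_extension_def)
  then have alg': "(algebraic over K) x" by (simp add: over_def)
  note I = IrrE[OF K x alg']
  have "splitted (Irr K x)"
    using N I x unfolding normal_extension_def by blast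
  moreover have "polynomial K (Irr K x)" using I(1) by (simp add: univ_poly_carrier)
  then have "set (Irr K x) \<subseteq> K" by (rule polynomial_incl)
  moreover have "Irr K x \<noteq> []" using pirreducibleE(1)[OF subfieldE(1)[OF K] I(1,2)] .
  moreover have "Irr K x \<in> carrier (poly_ring R)"
    using carrier_polynomial[OF subfieldE(1)[OF K]] \<open>polynomial K (Irr K x)\<close> by (simp add: univ_poly_carrier)
  ultimately show ?thesis using I(4) by (auto simp: split_algebraic_def)
qed

text \<open>Strips the linear factors of a split polynomial one by one, as membership in
  \<open>W\<close> can be pulled back along every twisted commutator; the remaining constant is
  cancelled by \<open>Wl\<close>.\<close>

lemma right_poly_action_splitted_mem:
  assumes U: "bimodule R U" and x: "x \<in> carrier R"
    and Wl: "\<And>f l. f \<in> U \<Longrightarrow> l \<in> carrier R \<Longrightarrow> l \<noteq> \<zero> \<Longrightarrow> left_scale R l f \<in> W \<Longrightarrow> f \<in> W"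
    and Wt: "\<And>f a. f \<in> U \<Longrightarrow> a \<in> carrier R \<Longrightarrow> twisted_comm R x a f \<in> W \<Longrightarrow> f \<in> W"
    and f: "f \<in> U"
  shows "p \<in> carrier (poly_ring R) \<Longrightarrow> p \<noteq> [] \<Longrightarrow> splitted p \<Longrightarrow> right_poly_action R x f p \<in> W \<Longrightarrow> f \<in> W"
proof (induction "degree p" arbitrary: p)
  case 0
  then obtain c where p: "p = [c]" by (cases p) auto
  have "polynomial (carrier R) p" using 0 by (simp add: univ_poly_carrier)
  then have c: "c \<in> carrier R" "c \<noteq> \<zero>" using p by (auto simp: polynomial_def)
  have fA: "f \<in> additive_End" using f bimoduleD(1)[OF U] by auto
  have "right_poly_action R x f p = left_scale R c f"
    using fA c by (auto intro!: additive_End_eqI op_add_closed additive_End_ops simp: p)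
      (simp add: op_add_def left_scale_def right_scale_def op_zero_def additive_End_closed)
  then show ?case using Wl[OF f c] 0 by simp
next
  case (Suc n)
  have "roots p \<noteq> {#}" using Suc.hyps(2) Suc.prems(3) by (auto simp: splitted_def)
  then obtain a where a: "a \<in> carrier R" and "[ \<one>, \<ominus> a ] pdivides p"
    and in_carrier: "[ \<one>, \<ominus> a ] \<in> carrier (poly_ring R)"
    using Suc.prems(1) by blast
  then obtain q where p: "p = [ \<one>, \<ominus> a ] \<otimes>\<^bsub>poly_ring R\<^esub> q" and q: "q \<in> carrier (poly_ring R)"
    unfolding pdivides_def by blast
  interpret UP: principal_domain "poly_ring R"
    using univ_poly_is_principal[OF carrier_is_subfield] .
  have "q \<noteq> []"
    using p \<open>p \<noteq> []\<close> in_carrier q unfolding sym[OF univ_poly_zero[of R "carrier R"]] by auto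
  then have dp: "degree p = Suc (degree q)"
    using p \<open>p \<noteq> []\<close> poly_mult_degree_eq[OF carrier_is_subring] in_carrier q
    unfolding univ_poly_carrier sym[OF univ_poly_mult[of R "carrier R"]] by auto
  have "splitted q"
    using poly_mult_degree_one_monic_imp_same_roots[OF a q \<open>q \<noteq> []\<close>] dp Suc.prems(3)
    unfolding sym[OF p] splitted_def by simp
  have qc: "set q \<subseteq> carrier R"
    using q polynomial_incl unfolding univ_poly_carrier[symmetric] by blast
  have fA: "f \<in> additive_End" using f bimoduleD(1)[OF U] by auto
  have "right_poly_action R x f p = twisted_comm R x a (right_poly_action R x f q)"
    using right_poly_action_monic_linear_mult[OF x fA a qc] by (simp add: p univ_poly_mult)
  then have "right_poly_action R x f q \<in> W"
    using Wt[OF right_poly_action_bimodule[OF U x f qc] a] Suc.prems(4) by simp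
  then show ?case using Suc.hyps(1)[of q] Suc.hyps(2) dp q \<open>q \<noteq> []\<close> \<open>splitted q\<close> by simp
qed

text \<open>The sum \<open>S\<close> of the generalised eigenspaces satisfies: if \<open>N g \<in> S\<close>, where
  \<open>N g = g \<circ> x - a g\<close>, then \<open>g \<in> S\<close>, since \<open>N\<close> is onto on every eigenspace for \<open>b \<noteq> a\<close>.
  Applied to the factors of a split polynomial \<open>p\<close> with \<open>p x = \<zero>\<close>, this gives the claim.\<close>

lemma gen_eigenspaces_span:
  assumes U: "bimodule R U" and UK: "U \<subseteq> carrier (End_ring R K)" and K: "K \<subseteq> carrier R"
    and x: "x \<in> carrier R" "split_algebraic K x"
    and W: "op_zero R \<in> W" "\<And>f g. f \<in> W \<Longrightarrow> g \<in> W \<Longrightarrow> op_add R f g \<in> W"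
      "\<And>a. a \<in> carrier R \<Longrightarrow> gen_eigenspace R U x a \<subseteq> W"
  shows "U \<subseteq> W"
proof
  fix f assume f: "f \<in> U"
  \<comment> \<open>The sum of the eigenspaces is taken as the smallest set that contains them and
    is closed under addition. A property of all its elements thus follows by checking
    \<open>P\<close> for the set of elements having it.\<close>
  define P where "P = (\<lambda>W. op_zero R \<in> W \<and> (\<forall>f\<in>W. \<forall>g\<in>W. op_add R f g \<in> W) \<and>
    (\<forall>a\<in>carrier R. gen_eigenspace R U x a \<subseteq> W))"
  define S where "S = \<Inter>{W. P W}"
  have S: "P S" unfolding S_def P_def by blast
  have minS: "S \<subseteq> W" if "P W" for W using that unfolding S_def by blast
  have Sa: "op_add R g h \<in> S" if "g \<in> S" "h \<in> S" for g h using S that unfolding P_def by blast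
  have Sg: "gen_eigenspace R U x a \<subseteq> S" if "a \<in> carrier R" for a using S that unfolding P_def by blast
  have Sz: "op_zero R \<in> S" using S unfolding P_def by blast
  have SU: "S \<subseteq> U" by (rule minS) (use bimoduleD[OF U] in \<open>auto simp: P_def gen_eigenspace_def\<close>)
  have UA: "g \<in> additive_End" if "g \<in> U" for g using that bimoduleD(1)[OF U] by auto
  have Sl: "left_scale R l g \<in> S" if l: "l \<in> carrier R" and g: "g \<in> S" for l g
  proof -
    have "P {g \<in> U. left_scale R l g \<in> S}"
      unfolding P_def
    proof (intro conjI ballI subsetI)
      show "op_zero R \<in> {g \<in> U. left_scale R l g \<in> S}" using Sz bimoduleD(2)[OF U] by (simp add: left_scale_op_zero l)
    next
      fix g h assume "g \<in> {g \<in> U. left_scale R l g \<in> S}" "h \<in> {g \<in> U. left_scale R l g \<in> S}"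
      then show "op_add R g h \<in> {g \<in> U. left_scale R l g \<in> S}"
        using Sa bimoduleD(3)[OF U] UA by (simp add: left_scale_op_add l)
    next
      fix a h assume a: "a \<in> carrier R" and h: "h \<in> gen_eigenspace R U x a"
      then have "left_scale R l h \<in> gen_eigenspace R U x a"
        using bimoduleD(4)[OF bimodule_gen_eigenspace[OF U x(1) a] l] by blast
      then show "h \<in> {g \<in> U. left_scale R l g \<in> S}" using Sg[OF a] h by (auto simp: gen_eigenspace_def)
    qed
    then show ?thesis using minS g by blast
  qed
  \<comment> \<open>Modulo the eigenspace for \<open>a\<close>, each element of \<open>S\<close> is
    an image under the operator for \<open>a\<close>: an element of that eigenspace takes
    \<open>h\<close> to be zero, one of another eigenspace has a preimage by
    \<open>gen_eigen_surj\<close>.\<close>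
  have corr: "\<exists>h\<in>S. op_add R g (left_scale R (\<ominus> \<one>) (twisted_comm R x a h)) \<in> gen_eigenspace R U x a"
    if a: "a \<in> carrier R" and "g \<in> S" for a g
  proof -
    let ?c = "\<lambda>g h. op_add R g (left_scale R (\<ominus> \<one>) (twisted_comm R x a h))"
    let ?G = "gen_eigenspace R U x a"
    note bG = bimoduleD[OF bimodule_gen_eigenspace[OF U x(1) a]]
    have "P {g \<in> U. \<exists>h\<in>S. ?c g h \<in> ?G}"
      unfolding P_def
    proof (intro conjI ballI subsetI)
      have "?c (op_zero R) (op_zero R) = op_zero R"
        by (simp add: twisted_comm_op_zero x a left_scale_op_zero op_add_op_zero additive_End_ops)
      then show "op_zero R \<in> {g \<in> U. \<exists>h\<in>S. ?c g h \<in> ?G}"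
        using bimoduleD(2)[OF U] Sz bG(2) by force
    next
      fix g1 g2 assume "g1 \<in> {g \<in> U. \<exists>h\<in>S. ?c g h \<in> ?G}" "g2 \<in> {g \<in> U. \<exists>h\<in>S. ?c g h \<in> ?G}"
      then obtain h1 h2 where h: "h1 \<in> S" "h2 \<in> S" "?c g1 h1 \<in> ?G" "?c g2 h2 \<in> ?G" and g: "g1 \<in> U" "g2 \<in> U"
        by blast
      have hU: "h1 \<in> U" "h2 \<in> U" using h SU by auto
      have "?c (op_add R g1 g2) (op_add R h1 h2) = op_add R (?c g1 h1) (?c g2 h2)"
      proof (rule additive_End_eqI)
        fix y assume y: "y \<in> carrier R"
        have "g1 y \<in> carrier R" "g2 y \<in> carrier R" "twisted_comm R x a h1 y \<in> carrier R" "twisted_comm R x a h2 y \<in> carrier R"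
          using y g hU UA x a additive_End_closed twisted_comm_additive_End by auto
        then show "?c (op_add R g1 g2) (op_add R h1 h2) y = op_add R (?c g1 h1) (?c g2 h2) y"
          using y hU UA x a by (simp add: twisted_comm_op_add) (simp add: op_add_def left_scale_def, algebra)
      qed (use g hU UA x a in \<open>auto intro!: additive_End_ops twisted_comm_additive_End\<close>)
      then have "?c (op_add R g1 g2) (op_add R h1 h2) \<in> ?G" using bG(3) h by simp
      then show "op_add R g1 g2 \<in> {g \<in> U. \<exists>h\<in>S. ?c g h \<in> ?G}"
        using Sa h g bimoduleD(3)[OF U] by blast
    next
      fix b g assume b: "b \<in> carrier R" and g: "g \<in> gen_eigenspace R U x b"
      then obtain k where gk: "g \<in> U" "(twisted_comm R x b ^^ k) g = op_zero R" by (auto simp: gen_eigenspace_def)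
      show "g \<in> {g \<in> U. \<exists>h\<in>S. ?c g h \<in> ?G}"
      proof (cases "b = a")
        case True
        have "?c g (op_zero R) = g"
          using gk UA by (simp add: twisted_comm_op_zero x a left_scale_op_zero op_add_op_zero)
        then show ?thesis using True g Sz gk by force
      next
        case False
        then obtain h where h: "h \<in> U" "(twisted_comm R x b ^^ k) h = op_zero R" "twisted_comm R x a h = g"
          using gen_eigen_surj[OF x(1) a b _ U gk] by blast
        then have "h \<in> S" using Sg[OF b] by (auto simp: gen_eigenspace_def)
        moreover have "?c g h = op_zero R"
        proof (rule additive_End_eqI)
          fix y assume y: "y \<in> carrier R"
          then have "g y \<in> carrier R" using gk UA additive_End_closed by auto
          then show "?c g h y = op_zero R y"
            using y by (simp add: h(3)) (simp add: op_add_def left_scale_def op_zero_def l_minus r_neg)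
        qed (use h gk UA x a in \<open>auto intro!: additive_End_ops twisted_comm_additive_End\<close>)
        ultimately show ?thesis using gk bG(2) by force
      qed
    qed
    then show ?thesis using minS \<open>g \<in> S\<close> by blast
  qed
  have St: "g \<in> S" if g: "g \<in> U" and a: "a \<in> carrier R" and tS: "twisted_comm R x a g \<in> S" for g a
  proof -
    obtain h where h: "h \<in> S" "op_add R (twisted_comm R x a g) (left_scale R (\<ominus> \<one>) (twisted_comm R x a h)) \<in> gen_eigenspace R U x a"
      using corr[OF a tS] by blast
    have hU: "h \<in> U" using h SU by auto
    \<comment> \<open>By the choice of \<open>h\<close>, the operator for \<open>a\<close> takes
      \<open>d\<close> into its own generalised eigenspace, so \<open>d\<close> lies there as
      well.\<close>
    define d where "d = op_add R g (left_scale R (\<ominus> \<one>) h)"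
    have dU: "d \<in> U" using bimoduleD[OF U] g hU by (simp add: d_def)
    have "twisted_comm R x a d = op_add R (twisted_comm R x a g) (left_scale R (\<ominus> \<one>) (twisted_comm R x a h))"
      using g hU UA x a by (simp add: d_def twisted_comm_op_add twisted_comm_left_scale additive_End_ops)
    then obtain k where "(twisted_comm R x a ^^ k) (twisted_comm R x a d) = op_zero R"
      using h(2) by (auto simp: gen_eigenspace_def)
    then have "(twisted_comm R x a ^^ Suc k) d = op_zero R" by (simp add: funpow_swap1)
    then have "d \<in> gen_eigenspace R U x a" using dU unfolding gen_eigenspace_def by blast
    then have "op_add R d h \<in> S" using Sg[OF a] h Sa by blast
    moreover have "op_add R d h = g"
    proof (rule additive_End_eqI)
      fix y assume y: "y \<in> carrier R"
      then have "g y \<in> carrier R" "h y \<in> carrier R" using g hU UA additive_End_closed by auto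
      then show "op_add R d h y = g y" using y
        by (simp add: d_def op_add_def left_scale_def l_minus a_assoc l_neg)
    qed (use g dU hU UA in \<open>auto intro!: additive_End_ops\<close>)
    ultimately show ?thesis by simp
  qed
  have Sl': "g \<in> S" if g: "g \<in> U" and l: "l \<in> carrier R" "l \<noteq> \<zero>" and "left_scale R l g \<in> S" for g l
  proof -
    have "left_scale R (inv l) (left_scale R l g) \<in> S" using Sl that inv_closed'[OF l] by blast
    moreover have "left_scale R (inv l) (left_scale R l g) = g"
    proof (rule additive_End_eqI)
      fix y assume y: "y \<in> carrier R"
      then have "g y \<in> carrier R" using g UA additive_End_closed by auto
      then show "left_scale R (inv l) (left_scale R l g) y = g y"
        using y l inv_closed'[OF l] inv_l[OF l] by (simp add: left_scale_def m_assoc[symmetric])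
    qed (use g UA l inv_closed'[OF l] in \<open>auto intro!: additive_End_ops\<close>)
    ultimately show ?thesis by simp
  qed
  obtain p where p: "p \<in> carrier (poly_ring R)" "p \<noteq> []" "set p \<subseteq> K" "splitted p" "eval p x = \<zero>"
    using x(2) by (auto simp: split_algebraic_def)
  have "right_poly_action R x f p = op_zero R"
  proof (rule additive_End_eqI)
    show "right_poly_action R x f p \<in> additive_End" using right_poly_action_bimodule[OF U x(1) f] p(3) K UA by blast
    fix y assume y: "y \<in> carrier R"
    have fK: "f \<in> carrier (End_ring R K)" using f UK by auto
    show "right_poly_action R x f p y = op_zero R y"
      using right_poly_action_eval[OF K fK x(1) y p(3)] End_ring_zero[OF fK] y by (simp add: p(5) op_zero_def)
  qed (rule additive_End_ops)
  then have "f \<in> S"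
    using right_poly_action_splitted_mem[OF U x(1) Sl' St f p(1,2,4)] Sz by simp
  moreover have "P W" using W by (auto simp: P_def)
  ultimately show "f \<in> W" using minS by blast
qed

text \<open>Splits \<open>U\<close> along one element of \<open>xs\<close> after another. The last
  premise speaks of arbitrary bimodules \<open>V\<close> inside \<open>U\<close> with one eigenvalue
  for each listed element, so that it passes to the smaller eigenspaces met in the
  induction.\<close>

lemma simultaneous_gen_eigenspaces_span:
  assumes K: "K \<subseteq> carrier R"
    and W: "op_zero R \<in> W" "\<And>f g. f \<in> W \<Longrightarrow> g \<in> W \<Longrightarrow> op_add R f g \<in> W"
  shows "bimodule R U \<Longrightarrow> U \<subseteq> carrier (End_ring R K) \<Longrightarrow>
    (\<And>x. x \<in> set xs \<Longrightarrow> x \<in> carrier R \<and> split_algebraic K x) \<Longrightarrow>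
    (\<And>ps V. map fst ps = xs \<Longrightarrow> snd ` set ps \<subseteq> carrier R \<Longrightarrow> bimodule R V \<Longrightarrow> V \<subseteq> U \<Longrightarrow>
       (\<forall>(x, a)\<in>set ps. \<forall>f\<in>V. \<exists>k. (twisted_comm R x a ^^ k) f = op_zero R) \<Longrightarrow> V \<subseteq> W) \<Longrightarrow>
    U \<subseteq> W"
proof (induction xs arbitrary: U)
  case Nil
  from Nil(4)[of "[]" U] Nil(1) show ?case by simp
next
  case (Cons x xs)
  have x: "x \<in> carrier R" "split_algebraic K x" using Cons.prems(3) by auto
  show ?case
  proof (rule gen_eigenspaces_span[OF Cons.prems(1,2) K x W])
    fix a assume a: "a \<in> carrier R"
    show "gen_eigenspace R U x a \<subseteq> W"
    proof (rule Cons.IH)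
      show "bimodule R (gen_eigenspace R U x a)"
        using bimodule_gen_eigenspace[OF Cons.prems(1) x(1) a] .
      show "gen_eigenspace R U x a \<subseteq> carrier (End_ring R K)"
        using Cons.prems(2) by (auto simp: gen_eigenspace_def)
      show "y \<in> carrier R \<and> split_algebraic K y" if "y \<in> set xs" for y
        using that Cons.prems(3) by auto
      fix ps V
      assume ps: "map fst ps = xs" "snd ` set ps \<subseteq> carrier R" and V: "bimodule R V" "V \<subseteq> gen_eigenspace R U x a"
        and nil: "\<forall>(x, a)\<in>set ps. \<forall>f\<in>V. \<exists>k. (twisted_comm R x a ^^ k) f = op_zero R"
      show "V \<subseteq> W"
      proof (rule Cons.prems(4)[of "(x, a) # ps"])
        show "\<forall>(y, b)\<in>set ((x, a) # ps). \<forall>f\<in>V. \<exists>k. (twisted_comm R y b ^^ k) f = op_zero R"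
          using nil V(2) by (auto simp: gen_eigenspace_def)
      qed (use ps V a in \<open>auto simp: gen_eigenspace_def\<close>)
    qed
  qed auto
qed

text \<open>The last nonzero iterate of the operator on \<open>f\<close> is an eigenvector. The
  eigenvectors for one pair again form a bimodule on which the remaining operators stay nilpotent,
  so the search continues inside it.\<close>

lemma common_eigenvector:
  "bimodule R V \<Longrightarrow> f \<in> V \<Longrightarrow> f \<noteq> op_zero R \<Longrightarrow>
    set ps \<subseteq> carrier R \<times> carrier R \<Longrightarrow>
    (\<forall>(x, a)\<in>set ps. \<forall>f\<in>V. \<exists>k. (twisted_comm R x a ^^ k) f = op_zero R) \<Longrightarrow>
    \<exists>e\<in>V. e \<noteq> op_zero R \<and> (\<forall>(x, a)\<in>set ps. twisted_comm R x a e = op_zero R)"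
proof (induction ps arbitrary: V f)
  case Nil
  then show ?case by auto
next
  case (Cons p ps)
  obtain x a where p: "p = (x, a)" by (cases p)
  have xa: "x \<in> carrier R" "a \<in> carrier R" using Cons.prems(4) p by auto
  define k where "k = (LEAST k. (twisted_comm R x a ^^ k) f = op_zero R)"
  have k: "(twisted_comm R x a ^^ k) f = op_zero R"
    unfolding k_def by (rule LeastI_ex) (use Cons.prems(2,5) p in auto)
  then have "k \<noteq> 0" using Cons.prems(3) by (auto intro: ccontr)
  define g where "g = (twisted_comm R x a ^^ (k - 1)) f"
  have g0: "g \<noteq> op_zero R"
    using not_less_Least[of "k - 1" "\<lambda>k. (twisted_comm R x a ^^ k) f = op_zero R"] \<open>k \<noteq> 0\<close>
    unfolding g_def k_def by auto
  have gV: "g \<in> V" using twisted_comm_pow_bimodule[OF Cons.prems(1) xa Cons.prems(2)] by (simp add: g_def)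
  have "twisted_comm R x a g = op_zero R"
    using k \<open>k \<noteq> 0\<close> unfolding g_def by (cases k) auto
  let ?V = "{f \<in> V. twisted_comm R x a f = op_zero R}"
  have "\<exists>e\<in>?V. e \<noteq> op_zero R \<and> (\<forall>(x, a)\<in>set ps. twisted_comm R x a e = op_zero R)"
  proof (rule Cons.IH)
    show "bimodule R ?V" using Cons.prems(1) xa by (rule bimodule_eigenspace)
    show "g \<in> ?V" using gV \<open>twisted_comm R x a g = op_zero R\<close> by simp
  qed (use g0 Cons.prems in auto)
  then show ?case using p by auto
qed

end

subsection \<open>Differential operators and automorphisms\<close>

text \<open>Stated for rings with a subfield of scalars because it is applied both to the field over
  \<open>K\<close> and to an operator ring over the copy of \<open>L\<close>.\<close>

lemma (in ring) dimension_image: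
  assumes V: "dimension n K V" and K: "subfield K R"
    and h: "h \<in> carrier R \<rightarrow> carrier R" "inj_on h (carrier R)"
      "\<And>x y. x \<in> carrier R \<Longrightarrow> y \<in> carrier R \<Longrightarrow> h (x \<oplus> y) = h x \<oplus> h y"
      "\<And>k x. k \<in> K \<Longrightarrow> x \<in> carrier R \<Longrightarrow> h (k \<otimes> x) = k \<otimes> h x"
  shows "dimension n K (h ` V)"
  using V K h
proof (induct n K V rule: dimension.induct)
  case (zero_dim K)
  have "h \<zero> \<oplus> h \<zero> = h \<zero>" using zero_dim(4)[of \<zero> \<zero>] by simp
  moreover have "h \<zero> \<in> carrier R" using zero_dim(2) by auto
  ultimately have "h \<zero> = \<zero>" by (simp add: add.l_cancel_one')
  then show ?case by simp
next
  case (Suc_dim v W n K)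
  note K = Suc_dim.prems(1) and h = Suc_dim.prems(2-)
  have W: "W \<subseteq> carrier R" using space_subgroup_props(1)[OF K Suc_dim.hyps(3)] .
  have "h ` line_extension K v W = line_extension K (h v) (h ` W)"
  proof -
    have *: "h (k \<otimes> v \<oplus> w) = k \<otimes> h v \<oplus> h w" if "k \<in> K" "w \<in> W" for k w
      using that h(3)[of "k \<otimes> v" w] h(4)[of k v] Suc_dim.hyps(1) W subfieldE(3)[OF K] by auto
    show ?thesis
      unfolding set_eq_iff image_iff line_extension_mem_iff Bex_def using * by (metis (no_types, lifting))
  qed
  moreover have "h v \<notin> h ` W"
    using inj_on_image_mem_iff[OF h(2) Suc_dim.hyps(1) W] Suc_dim.hyps(2) by simp
  ultimately show ?case
    using Suc_dim.hyps(4)[OF K h] h(1) Suc_dim.hyps(1) by (auto intro: dimension.Suc_dim)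
qed

context field
begin

lemma End_ring_inj_imp_surj:
  assumes K: "subfield K R" and fin: "finite_dimension K (carrier R)"
    and g: "g \<in> carrier (End_ring R K)" "inj_on g (carrier R)"
  shows "g ` carrier R = carrier R"
proof -
  obtain n where n: "dimension n K (carrier R)" using fin by blast
  have gc: "g \<in> carrier R \<rightarrow> carrier R" using g(1) by (auto simp: End_ring_mem)
  have gd: "dimension n K (g ` carrier R)"
    using dimension_image[OF n K gc g(2)] End_ring_add[OF g(1)] End_ring_smult[OF g(1)] by blast
  then obtain Us where "independent K Us" "length Us = n" "Span K Us = g ` carrier R" "set Us \<subseteq> carrier R"
    using exists_base[OF K gd] by blast
  then show ?thesis using independent_length_eq_dimension[OF K n] by blast
qed

section \<open>Automorphisms and their effect on eigenvalues\<close>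

lemma GalD:
  assumes "g \<in> Gal R M"
  shows "g \<in> carrier (End_ring R M)" "g \<one> = \<one>" "bij_betw g (carrier R) (carrier R)"
    "x \<in> carrier R \<Longrightarrow> g x \<in> carrier R"
    "x \<in> carrier R \<Longrightarrow> y \<in> carrier R \<Longrightarrow> g (x \<otimes> y) = g x \<otimes> g y"
  using assms by (auto simp: Gal_def ring_iso_def ring_hom_def)

lemma GalI:
  assumes "g \<in> carrier (End_ring R M)" "g \<one> = \<one>" "bij_betw g (carrier R) (carrier R)"
    "\<And>x y. x \<in> carrier R \<Longrightarrow> y \<in> carrier R \<Longrightarrow> g (x \<otimes> y) = g x \<otimes> g y"
  shows "g \<in> Gal R M"
  using assms by (auto simp: Gal_def ring_iso_def intro!: ring_hom_memI) (auto simp: End_ring_mem)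

lemma Gal_inverse:
  assumes M: "M \<subseteq> carrier R" and g: "g \<in> Gal R M"
  shows "\<exists>h\<in>Gal R M. (\<forall>x\<in>carrier R. h (g x) = x) \<and> (\<forall>x\<in>carrier R. g (h x) = x)"
proof -
  note G = GalD[OF g]
  define h where "h = (\<lambda>x\<in>carrier R. inv_into (carrier R) g x)"
  have hc: "h x \<in> carrier R" if "x \<in> carrier R" for x
    using that G(3) by (simp add: h_def bij_betw_def inv_into_into)
  have hg: "h (g x) = x" if "x \<in> carrier R" for x
    using that G(3) G(4)[OF that] by (simp add: h_def bij_betw_def)
  have gh: "g (h x) = x" if "x \<in> carrier R" for x
    using that G(3) by (simp add: h_def bij_betw_def f_inv_into_f)
  have h_eq: "h y = x" if "x \<in> carrier R" "y = g x" for x y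
    using that hg by simp
  have "h \<in> carrier (End_ring R M)"
    unfolding End_ring_mem
  proof (intro conjI ballI)
    show "h \<in> carrier R \<rightarrow>\<^sub>E carrier R" using hc by (auto simp: h_def)
    show "h (x \<oplus> y) = h x \<oplus> h y" if "x \<in> carrier R" "y \<in> carrier R" for x y
      using that by (intro h_eq) (auto simp: End_ring_add[OF G(1)] hc gh)
    show "h (m \<otimes> x) = m \<otimes> h x" if "m \<in> M" "x \<in> carrier R" for m x
      using that M by (intro h_eq) (auto simp: End_ring_smult[OF G(1)] hc gh)
  qed
  moreover have "h \<one> = \<one>" using G(2) by (intro h_eq) auto
  moreover have "h (x \<otimes> y) = h x \<otimes> h y" if "x \<in> carrier R" "y \<in> carrier R" for x y
    using that G(5) by (intro h_eq) (auto simp: hc gh)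
  moreover have "bij_betw h (carrier R) (carrier R)"
    by (rule bij_betwI[of _ _ _ g]) (auto simp: hc hg gh G(4))
  ultimately have "h \<in> Gal R M" by (intro GalI)
  then show ?thesis using hg gh by blast
qed

lemma compose_End_ring:
  assumes "M \<subseteq> carrier R" "f \<in> carrier (End_ring R M)" "g \<in> carrier (End_ring R M)"
  shows "compose (carrier R) f g \<in> carrier (End_ring R M)"
  using ring.ring_simprules(5)[OF ring_End_ring[OF assms(1)] assms(2,3)] by (simp add: End_ring_ops)

text \<open>Multiplicativity of \<open>g\<close> turns the argument \<open>x \<otimes> y\<close>
  into \<open>g x \<otimes> g y\<close>. Composition with \<open>g\<close> thus carries the
  eigenvalue \<open>g x\<close> at the element \<open>g x\<close>, as for differential operators, to
  the eigenvalue \<open>g x\<close> at \<open>x\<close>.\<close>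

lemma twisted_comm_compose:
  assumes "g \<in> Gal R M" "x \<in> carrier R" "f \<in> additive_End"
  shows "twisted_comm R x b (compose (carrier R) f g) = compose (carrier R) (twisted_comm R (g x) b f) g"
  using GalD(4,5)[OF assms(1)] assms by (auto simp: twisted_comm_def compose_def fun_eq_iff)

lemma twisted_comm_pow_compose:
  assumes "g \<in> Gal R M" "x \<in> carrier R" "b \<in> carrier R" "f \<in> additive_End"
  shows "(twisted_comm R x b ^^ k) (compose (carrier R) f g) = compose (carrier R) ((twisted_comm R (g x) b ^^ k) f) g"
  using assms by (induction k) (auto simp: twisted_comm_compose twisted_comm_pow_additive_End GalD(4))

lemma compose_op_zero: "g \<in> Gal R M \<Longrightarrow> compose (carrier R) (op_zero R) g = op_zero R"
  using GalD(4) by (auto simp: compose_def op_zero_def fun_eq_iff)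

section \<open>Differential operators as operators with nilpotent commutators\<close>

lemma diff_ops_upto_Suc:
  assumes "M \<subseteq> carrier R"
  shows "diff_ops_upto R M (Suc i) =
    {d \<in> carrier (End_ring R M). \<forall>l\<in>carrier R. twisted_comm R l l d \<in> diff_ops_upto R M i}"
  using twisted_comm_eq[OF assms] by (auto simp del: diff_ops_upto.simps(1))

declare diff_ops_upto.simps(2) [simp del]

lemma mulop_ops:
  assumes "a \<in> carrier R"
  shows "b \<in> carrier R \<Longrightarrow> op_add R (mulop R a) (mulop R b) = mulop R (a \<oplus> b)"
    "b \<in> carrier R \<Longrightarrow> left_scale R b (mulop R a) = mulop R (b \<otimes> a)"
    "b \<in> carrier R \<Longrightarrow> right_scale R b (mulop R a) = mulop R (b \<otimes> a)"
    "l \<in> carrier R \<Longrightarrow> twisted_comm R l l (mulop R a) = op_zero R" "mulop R \<zero> = op_zero R"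
  using assms
  by (auto simp: op_add_def left_scale_def right_scale_def twisted_comm_def op_zero_def mulop_def l_distr m_assoc m_lcomm fun_eq_iff)

lemma bimodule_mulop: "bimodule R (mulop R ` carrier R)"
  unfolding bimodule_def
proof (intro conjI ballI)
  show "mulop R ` carrier R \<subseteq> additive_End" using mulop_closed by auto
  show "op_zero R \<in> mulop R ` carrier R" using mulop_ops(5)[of \<zero>] by force
qed (auto simp: mulop_ops)

lemma bimodule_diff_ops_upto:
  assumes M: "M \<subseteq> carrier R" shows "bimodule R (diff_ops_upto R M i)"
proof (induction i)
  case 0
  then show ?case using bimodule_mulop by simp
next
  case (Suc i)
  have E: "f \<in> additive_End" if "f \<in> carrier (End_ring R M)" for f
    using that End_ring_mono[of "{}" M] by blast
  note B = bimoduleD(2-)[OF Suc] bimoduleD(2-)[OF bimodule_End_ring[OF M]]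
  show ?case
    unfolding bimodule_def
  proof (intro conjI ballI)
    show "diff_ops_upto R M (Suc i) \<subseteq> additive_End" using E M by (auto simp: diff_ops_upto_Suc)
    show "op_zero R \<in> diff_ops_upto R M (Suc i)" using M B by (simp add: diff_ops_upto_Suc twisted_comm_op_zero)
    show "op_add R f g \<in> diff_ops_upto R M (Suc i)"
      if "f \<in> diff_ops_upto R M (Suc i)" "g \<in> diff_ops_upto R M (Suc i)" for f g
    proof -
      have "f \<in> additive_End" "g \<in> additive_End" using that E M by (auto simp: diff_ops_upto_Suc)
      then show ?thesis using that B(2,6) by (simp add: diff_ops_upto_Suc[OF M] twisted_comm_op_add)
    qed
    show "left_scale R l f \<in> diff_ops_upto R M (Suc i)" "right_scale R l f \<in> diff_ops_upto R M (Suc i)"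
      if "l \<in> carrier R" "f \<in> diff_ops_upto R M (Suc i)" for l f
    proof -
      have "f \<in> additive_End" using that E M by (auto simp: diff_ops_upto_Suc)
      then show "left_scale R l f \<in> diff_ops_upto R M (Suc i)" "right_scale R l f \<in> diff_ops_upto R M (Suc i)"
        using that B(3,4,7,8) by (simp_all add: diff_ops_upto_Suc[OF M] twisted_comm_left_scale twisted_comm_right_scale)
    qed
  qed
qed

lemma diff_ops_upto_mono:
  assumes M: "M \<subseteq> carrier R" and "i \<le> j"
  shows "diff_ops_upto R M i \<subseteq> diff_ops_upto R M j"
proof -
  have "diff_ops_upto R M i \<subseteq> diff_ops_upto R M (Suc i)" for i
  proof (induction i)
    case 0
    have "op_zero R \<in> mulop R ` carrier R" using bimoduleD(2)[OF bimodule_mulop] .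
    then show ?case using mulop_closed M by (auto simp: diff_ops_upto_Suc mulop_ops)
  next
    case (Suc i)
    then show ?case using M by (auto simp: diff_ops_upto_Suc)
  qed
  then show ?thesis using \<open>i \<le> j\<close> by (rule lift_Suc_mono_le)
qed

lemma diff_ops_upto_End_ring: "M \<subseteq> carrier R \<Longrightarrow> diff_ops_upto R M i \<subseteq> carrier (End_ring R M)"
  by (cases i) (auto simp: diff_ops_upto_Suc mulop_closed)

lemma diff_ops_End_ring: "M \<subseteq> carrier R \<Longrightarrow> diff_ops R M \<subseteq> carrier (End_ring R M)"
  using diff_ops_upto_End_ring by (auto simp: diff_ops_def)

lemma bimodule_diff_ops:
  assumes M: "M \<subseteq> carrier R" shows "bimodule R (diff_ops R M)"
  unfolding bimodule_def
proof (intro conjI ballI)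
  note B = bimoduleD[OF bimodule_diff_ops_upto[OF M]]
  show "diff_ops R M \<subseteq> additive_End" using B(1) unfolding diff_ops_def by blast
  show "op_zero R \<in> diff_ops R M" using B(2) unfolding diff_ops_def by blast
  fix f g assume "f \<in> diff_ops R M" "g \<in> diff_ops R M"
  then obtain i j where "f \<in> diff_ops_upto R M i" "g \<in> diff_ops_upto R M j"
    unfolding diff_ops_def by blast
  then have "f \<in> diff_ops_upto R M (max i j)" "g \<in> diff_ops_upto R M (max i j)"
    using diff_ops_upto_mono[OF M, of i "max i j"] diff_ops_upto_mono[OF M, of j "max i j"] by auto
  from B(3)[OF this] show "op_add R f g \<in> diff_ops R M" unfolding diff_ops_def by blast
next
  note B = bimoduleD[OF bimodule_diff_ops_upto[OF M]]
  fix l f assume l: "l \<in> carrier R" and "f \<in> diff_ops R M"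
  then obtain i where "f \<in> diff_ops_upto R M i" unfolding diff_ops_def by blast
  from B(4,5)[OF l this] show "left_scale R l f \<in> diff_ops R M" "right_scale R l f \<in> diff_ops R M"
    unfolding diff_ops_def by blast+
qed

lemma mulop_diff_ops: "mulop R ` carrier R \<subseteq> diff_ops R M"
  unfolding diff_ops_def using diff_ops_upto.simps(1) by blast

text \<open>Each commutator lowers the order by one, and one more is needed to kill an operator of
  order zero, which is a multiplication; hence the exponent \<open>Suc i\<close>.\<close>

lemma diff_ops_upto_nilpotent:
  assumes M: "M \<subseteq> carrier R" and l: "l \<in> carrier R"
  shows "d \<in> diff_ops_upto R M i \<Longrightarrow> (twisted_comm R l l ^^ Suc i) d = op_zero R"
proof (induction i arbitrary: d)
  case 0
  then show ?case using l by (auto simp: mulop_ops)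
next
  case (Suc i)
  then have "twisted_comm R l l d \<in> diff_ops_upto R M i" using M l by (simp add: diff_ops_upto_Suc)
  from Suc.IH[OF this] show ?case by (simp only: funpow_Suc_right comp_apply)
qed

lemma diff_ops_nilpotent:
  assumes "M \<subseteq> carrier R" "l \<in> carrier R" "d \<in> diff_ops R M"
  obtains k where "(twisted_comm R l l ^^ k) d = op_zero R"
  using assms diff_ops_upto_nilpotent unfolding diff_ops_def by blast

lemma Span_Nil_neq_carrier: "Span K [] \<noteq> carrier R"
proof
  assume "Span K [] = carrier R"
  then have "carrier R = {\<zero>}" by simp
  then show False using one_closed one_not_zero by blast
qed

text \<open>The total exponent \<open>\<Sum>z\<in>set zs. \<kappa> z\<close> bounds the order of \<open>d\<close>: each commutator with a
  spanning element lowers it by one, or gives zero.\<close>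

lemma diff_ops_upto_of_nilpotent:
  assumes K: "subfield K R" and M: "M \<subseteq> carrier R" and KM: "K \<subseteq> M"
    and zs: "set zs \<subseteq> carrier R" "Span K zs = carrier R"
  shows "d \<in> carrier (End_ring R M) \<Longrightarrow> (\<Sum>z\<in>set zs. \<kappa> z) \<le> N \<Longrightarrow>
    (\<And>z. z \<in> set zs \<Longrightarrow> (twisted_comm R z z ^^ \<kappa> z) d = op_zero R) \<Longrightarrow> d \<in> diff_ops_upto R M N"
proof (induction N arbitrary: d \<kappa>)
  case 0
  have "zs \<noteq> []" using zs(2) Span_Nil_neq_carrier by metis
  then obtain z where z: "z \<in> set zs" by (cases zs) auto
  then have "\<kappa> z = 0" using 0(2) by simp
  then have "d = op_zero R" using 0(3)[OF z] by simp
  then show ?case using bimoduleD(2)[OF bimodule_mulop] by simp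
next
  case (Suc N)
  note B = bimoduleD[OF bimodule_diff_ops_upto[OF M, of N]]
  have dA: "d \<in> additive_End" using Suc.prems(1) End_ring_mono[of "{}" M] by blast
  \<comment> \<open>The commutator of \<open>d\<close> with \<open>l\<close> is additive in
    \<open>l\<close> and, as \<open>d\<close> is \<open>M\<close>-linear, also
    \<open>M\<close>-linear in \<open>l\<close>. So \<open>S\<close> is a subspace, and it suffices
    to find the spanning elements in it.\<close>
  define S where "S = {l \<in> carrier R. twisted_comm R l l d \<in> diff_ops_upto R M N}"
  have "set zs \<subseteq> S"
  proof
    fix z assume z: "z \<in> set zs"
    then have zc: "z \<in> carrier R" using zs by auto
    show "z \<in> S"
    proof (cases "\<kappa> z = 0")
      case True
      then have "d = op_zero R" using Suc.prems(3)[OF z] by simp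
      then show ?thesis using B(2) zc by (simp add: S_def twisted_comm_op_zero)
    next
      case False
      have "twisted_comm R z z d \<in> diff_ops_upto R M N"
      \<comment> \<open>Commutators with different elements commute, so the other exponents survive
        while the one at \<open>z\<close> drops by one.\<close>
      proof (rule Suc.IH[of _ "\<kappa>(z := \<kappa> z - 1)"])
        show "twisted_comm R z z d \<in> carrier (End_ring R M)" using twisted_comm_closed[OF M zc zc Suc.prems(1)] .
        have "(\<Sum>w\<in>set zs. \<kappa> w) = \<kappa> z + (\<Sum>w\<in>set zs - {z}. \<kappa> w)"
          using z by (simp add: sum.remove)
        moreover have "(\<Sum>w\<in>set zs. (\<kappa>(z := \<kappa> z - 1)) w) = (\<kappa> z - 1) + (\<Sum>w\<in>set zs - {z}. \<kappa> w)"
          using z by (simp add: sum.remove)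
        ultimately show "(\<Sum>w\<in>set zs. (\<kappa>(z := \<kappa> z - 1)) w) \<le> N" using Suc.prems(2) False by simp
        fix w assume w: "w \<in> set zs"
        then have wc: "w \<in> carrier R" using zs by auto
        show "(twisted_comm R w w ^^ (\<kappa>(z := \<kappa> z - 1)) w) (twisted_comm R z z d) = op_zero R"
        proof (cases "w = z")
          case True
          obtain j where j: "\<kappa> z = Suc j" using False by (cases "\<kappa> z") auto
          then show ?thesis using True Suc.prems(3)[OF z]
            by (simp only: fun_upd_same funpow_Suc_right comp_apply diff_Suc_1)
        next
          case False
          then show ?thesis
            using Suc.prems(3)[OF w] wc zc dA by (simp add: twisted_comm_pow_commute twisted_comm_op_zero)
        qed
      qed
      then show ?thesis using zc by (simp add: S_def)
    qed
  qed
  moreover have "subalgebra K S R"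
  proof (rule subalgebra.intro)
    have add: "x \<oplus> y \<in> S" if "x \<in> S" "y \<in> S" for x y
    proof -
      have xy: "x \<in> carrier R" "y \<in> carrier R" using that by (auto simp: S_def)
      have "twisted_comm R (x \<oplus> y) (x \<oplus> y) d = op_add R (twisted_comm R x x d) (twisted_comm R y y d)"
      proof (rule additive_End_eqI)
        fix w assume w: "w \<in> carrier R"
        then have "d (x \<otimes> w) \<in> carrier R" "d (y \<otimes> w) \<in> carrier R" "d w \<in> carrier R"
          using xy dA additive_End_closed by auto
        then show "twisted_comm R (x \<oplus> y) (x \<oplus> y) d w = op_add R (twisted_comm R x x d) (twisted_comm R y y d) w"
          using xy w by (simp add: twisted_comm_def op_add_def l_distr End_ring_add[OF dA]) algebra
      qed (use xy dA in \<open>auto intro!: twisted_comm_additive_End additive_End_ops\<close>)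
      then show ?thesis using that B(3) xy by (simp add: S_def)
    qed
    have sm: "k \<otimes> x \<in> S" if "k \<in> M" "x \<in> S" for k x
    proof -
      have k: "k \<in> carrier R" "x \<in> carrier R" using that M by (auto simp: S_def)
      have "twisted_comm R (k \<otimes> x) (k \<otimes> x) d = left_scale R k (twisted_comm R x x d)"
      proof (rule additive_End_eqI)
        fix w assume w: "w \<in> carrier R"
        then have "d (x \<otimes> w) \<in> carrier R" "d w \<in> carrier R"
          using k dA additive_End_closed by auto
        then show "twisted_comm R (k \<otimes> x) (k \<otimes> x) d w = left_scale R k (twisted_comm R x x d) w"
          using k w by (simp add: twisted_comm_def left_scale_def m_assoc End_ring_smult[OF Suc.prems(1) that(1)]) algebra
      qed (use k dA in \<open>auto intro!: twisted_comm_additive_End additive_End_ops\<close>)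
      then show ?thesis using that B(4) k by (simp add: S_def)
    qed
    show "subalgebra_axioms K S R"
      using sm KM by (auto intro!: subalgebra_axioms.intro)
    have "\<ominus> \<one> \<in> M" using subsetD[OF KM subringE(5)[OF subfieldE(1)[OF K] subringE(3)[OF subfieldE(1)[OF K]]]] .
    show "subgroup S (add_monoid R)"
    proof (rule add.subgroupI)
      show "S \<subseteq> carrier R" by (auto simp: S_def)
      have "zs \<noteq> []" using zs(2) Span_Nil_neq_carrier by metis
      then show "S \<noteq> {}" using \<open>set zs \<subseteq> S\<close> by (cases zs) auto
      show "\<ominus> a \<in> S" if "a \<in> S" for a
        using sm[OF \<open>\<ominus> \<one> \<in> M\<close> that] that by (simp add: S_def l_minus)
      show "a \<oplus> b \<in> S" if "a \<in> S" "b \<in> S" for a b using add that .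
    qed
  qed
  ultimately have "carrier R \<subseteq> S"
    using subalgebra_Span_incl[OF K] zs(2) by metis
  then show ?case using Suc.prems(1) M by (auto simp: diff_ops_upto_Suc S_def)
qed

text \<open>Together with \<open>diff_ops_nilpotent\<close> this identifies the generalised
  eigenspace of the identity automorphism with the differential operators.\<close>

lemma diff_ops_of_nilpotent:
  assumes "subfield K R" "M \<subseteq> carrier R" "K \<subseteq> M" "set zs \<subseteq> carrier R" "Span K zs = carrier R"
    and "d \<in> carrier (End_ring R M)" "\<And>z. z \<in> set zs \<Longrightarrow> \<exists>k. (twisted_comm R z z ^^ k) d = op_zero R"
  shows "d \<in> diff_ops R M"
proof -
  obtain \<kappa> where "\<And>z. z \<in> set zs \<Longrightarrow> (twisted_comm R z z ^^ \<kappa> z) d = op_zero R"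
    using assms(7) by metis
  then have "d \<in> diff_ops_upto R M (\<Sum>z\<in>set zs. \<kappa> z)"
    using diff_ops_upto_of_nilpotent[OF assms(1-6) order_refl] by blast
  then show ?thesis unfolding diff_ops_def by blast
qed

text \<open>Eigenvalues are given only on a spanning set; they extend to the whole field because the
  elements admitting one form a subspace. The resulting ring homomorphism is injective because
  nonzero elements are invertible, and surjective by finite dimension over \<open>K\<close>.\<close>

lemma eigenvector_Gal:
  assumes K: "subfield K R" and fin: "finite_dimension K (carrier R)" and M: "M \<subseteq> carrier R" and KM: "K \<subseteq> M"
    and xs: "set xs \<subseteq> carrier R" "Span K xs = carrier R"
    and e: "e \<in> carrier (End_ring R M)" "e \<noteq> op_zero R"
    and a: "\<And>x. x \<in> set xs \<Longrightarrow> \<exists>a\<in>carrier R. twisted_comm R x a e = op_zero R"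
  shows "\<exists>g\<in>Gal R M. \<forall>x\<in>carrier R. \<forall>a\<in>carrier R. twisted_comm R x a e = op_zero R \<longrightarrow> a = g x"
proof -
  have ec: "e y \<in> carrier R" if "y \<in> carrier R" for y using e(1) that by (rule End_ring_closed)
  have tc: "e (x \<otimes> y) = a \<otimes> e y"
    if "twisted_comm R x a e = op_zero R" "x \<in> carrier R" "a \<in> carrier R" "y \<in> carrier R" for x a y
    using fun_cong[OF that(1), of y] that ec by (simp add: twisted_comm_def op_zero_def)
  define S where "S = {l \<in> carrier R. \<exists>c\<in>carrier R. \<forall>y\<in>carrier R. e (l \<otimes> y) = c \<otimes> e y}"
  have "set xs \<subseteq> S"
    using a tc xs unfolding S_def by (simp add: subset_iff) metis
  moreover have "subalgebra K S R"
  proof (rule subalgebra.intro)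
    have sm: "k \<otimes> x \<in> S" if "k \<in> M" "x \<in> S" for k x
    proof -
      obtain c where c: "c \<in> carrier R" "\<And>y. y \<in> carrier R \<Longrightarrow> e (x \<otimes> y) = c \<otimes> e y"
        using \<open>x \<in> S\<close> by (auto simp: S_def)
      have k: "k \<in> carrier R" "x \<in> carrier R" using that M by (auto simp: S_def)
      have "e (k \<otimes> x \<otimes> y) = (k \<otimes> c) \<otimes> e y" if "y \<in> carrier R" for y
        using that k c ec \<open>k \<in> M\<close> by (simp add: m_assoc End_ring_smult[OF e(1)])
      then show ?thesis using k c(1) unfolding S_def by blast
    qed
    have add: "x \<oplus> y \<in> S" if "x \<in> S" "y \<in> S" for x y
    proof -
      obtain c where c: "c \<in> carrier R" "\<And>z. z \<in> carrier R \<Longrightarrow> e (x \<otimes> z) = c \<otimes> e z"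
        using \<open>x \<in> S\<close> by (auto simp: S_def)
      obtain c' where c': "c' \<in> carrier R" "\<And>z. z \<in> carrier R \<Longrightarrow> e (y \<otimes> z) = c' \<otimes> e z"
        using \<open>y \<in> S\<close> by (auto simp: S_def)
      have xy: "x \<in> carrier R" "y \<in> carrier R" using that by (auto simp: S_def)
      have "e ((x \<oplus> y) \<otimes> z) = (c \<oplus> c') \<otimes> e z" if "z \<in> carrier R" for z
        using that xy c c' ec by (simp add: l_distr End_ring_add[OF e(1)])
      then show ?thesis using xy c(1) c'(1) unfolding S_def by blast
    qed
    show "subalgebra_axioms K S R"
      using sm KM by (auto intro!: subalgebra_axioms.intro)
    have "\<ominus> \<one> \<in> M" using subsetD[OF KM subringE(5)[OF subfieldE(1)[OF K] subringE(3)[OF subfieldE(1)[OF K]]]] .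
    show "subgroup S (add_monoid R)"
    proof (rule add.subgroupI)
      show "S \<subseteq> carrier R" by (auto simp: S_def)
      have "xs \<noteq> []" using xs(2) Span_Nil_neq_carrier by metis
      then show "S \<noteq> {}" using \<open>set xs \<subseteq> S\<close> by (cases xs) auto
      show "\<ominus> a \<in> S" if "a \<in> S" for a
        using sm[OF \<open>\<ominus> \<one> \<in> M\<close> that] that by (simp add: S_def l_minus)
      show "a \<oplus> b \<in> S" if "a \<in> S" "b \<in> S" for a b using add that .
    qed
  qed
  ultimately have "carrier R \<subseteq> S"
    using subalgebra_Span_incl[OF K] xs(2) by metis
  then have S: "\<exists>c\<in>carrier R. \<forall>y\<in>carrier R. e (l \<otimes> y) = c \<otimes> e y" if "l \<in> carrier R" for l
    using that by (auto simp: S_def)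
  \<comment> \<open>Every value \<open>e l\<close> is a multiple of \<open>e \<one>\<close>, so
    otherwise \<open>e\<close> would vanish identically.\<close>
  have e1: "e \<one> \<noteq> \<zero>"
  proof
    assume "e \<one> = \<zero>"
    have "e l = op_zero R l" if l: "l \<in> carrier R" for l
    proof -
      obtain c where "c \<in> carrier R" "\<forall>y\<in>carrier R. e (l \<otimes> y) = c \<otimes> e y" using S[OF l] by blast
      then have "e (l \<otimes> \<one>) = c \<otimes> e \<one>" by blast
      then show ?thesis using l \<open>e \<one> = \<zero>\<close> \<open>c \<in> carrier R\<close> by (simp add: op_zero_def)
    qed
    then have "e = op_zero R" using End_ring_eqI[OF e(1) op_zero_closed[OF M]] by blast
    then show False using e(2) by simp
  qed
  note i = inv_closed'[OF ec[OF one_closed] e1] inv_l[OF ec[OF one_closed] e1]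
  define g where "g = left_scale R (inv (e \<one>)) e"
  have gE: "g \<in> carrier (End_ring R M)" unfolding g_def using M i(1) e(1) by (rule left_scale_closed)
  have gx: "g x = inv (e \<one>) \<otimes> e x" if "x \<in> carrier R" for x using that by (simp add: g_def left_scale_def)
  have uniq: "c = g x" if "x \<in> carrier R" "c \<in> carrier R" "\<forall>y\<in>carrier R. e (x \<otimes> y) = c \<otimes> e y" for x c
  proof -
    have "e x = c \<otimes> e \<one>" using that(1) bspec[OF that(3) one_closed] by simp
    then have "g x = inv (e \<one>) \<otimes> e \<one> \<otimes> c" using that gx ec i(1) by (simp add: m_assoc m_comm[of c])
    then show ?thesis using that i by simp
  qed
  have eg: "e (x \<otimes> y) = g x \<otimes> e y" if "x \<in> carrier R" "y \<in> carrier R" for x y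
    using S[OF that(1)] uniq[OF that(1)] that(2) by blast
  have gc: "g x \<in> carrier R" if "x \<in> carrier R" for x using gE that by (rule End_ring_closed)
  have g1: "g \<one> = \<one>" using gx i by simp
  have gm: "g (x \<otimes> y) = g x \<otimes> g y" if "x \<in> carrier R" "y \<in> carrier R" for x y
    using that i gc ec by (simp add: gx[of "x \<otimes> y"] gx[of y] eg m_lcomm)
  have gz: "g \<zero> = \<zero>" using End_ring_zero[OF gE] .
  have "inj_on g (carrier R)"
  proof (rule inj_onI)
    fix x y assume xy: "x \<in> carrier R" "y \<in> carrier R" "g x = g y"
    then have *: "g (x \<ominus> y) = \<zero>" using End_ring_diff[OF gE, of x y] gc by simp
    show "x = y"
    proof (rule ccontr)
      assume "x \<noteq> y"
      then have n: "x \<ominus> y \<noteq> \<zero>" "x \<ominus> y \<in> carrier R" using xy by auto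
      then have "g ((x \<ominus> y) \<otimes> inv (x \<ominus> y)) = \<zero>"
        using gm[OF n(2) inv_closed'[OF n(2,1)]] * gc[OF inv_closed'[OF n(2,1)]] by simp
      then show False using inv_r[OF n(2,1)] g1 by simp
    qed
  qed
  moreover have "g ` carrier R = carrier R"
    using End_ring_inj_imp_surj[OF K fin _ \<open>inj_on g (carrier R)\<close>] gE End_ring_mono[OF KM] by blast
  ultimately have "g \<in> Gal R M"
    using gE g1 gm by (intro GalI) (auto simp: bij_betw_def)
  moreover have "a = g x" if "x \<in> carrier R" "a \<in> carrier R" "twisted_comm R x a e = op_zero R" for x a
    using uniq[OF that(1,2)] tc[OF that(3,1,2)] by blast
  ultimately show ?thesis by blast
qed

text \<open>The additively closed \<open>W\<close> is arbitrary so that the result serves twice: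
  with the sum over all automorphisms for the decomposition, and with the operators satisfying
  \<open>f x = x \<otimes> f \<one>\<close> for recovering the field.\<close>

theorem End_ring_span:
  assumes K: "subfield K R" and fin: "finite_dimension K (carrier R)" and N: "normal_extension R K"
    and M: "M \<subseteq> carrier R" and KM: "K \<subseteq> M"
    and W: "op_zero R \<in> W" "\<And>f g. f \<in> W \<Longrightarrow> g \<in> W \<Longrightarrow> op_add R f g \<in> W"
      "\<And>d g. d \<in> diff_ops R M \<Longrightarrow> g \<in> Gal R M \<Longrightarrow> compose (carrier R) d g \<in> W"
  shows "carrier (End_ring R M) \<subseteq> W"
proof -
  obtain n where n: "dimension n K (carrier R)" using fin by blast
  obtain xs where xs: "set xs \<subseteq> carrier R" "Span K xs = carrier R"
    using exists_base[OF K n] by blast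
  have Kc: "K \<subseteq> carrier R" using K by (rule subfieldE(3))
  show ?thesis
  proof (rule simultaneous_gen_eigenspaces_span[OF Kc W(1,2), of _ xs])
    show "bimodule R (carrier (End_ring R M))" using M by (rule bimodule_End_ring)
    show "carrier (End_ring R M) \<subseteq> carrier (End_ring R K)" using KM by (rule End_ring_mono)
    show "x \<in> carrier R \<and> split_algebraic K x" if "x \<in> set xs" for x
      using that xs normal_extension_split_algebraic[OF K N] by auto
    fix ps V
    assume ps: "map fst ps = xs" "snd ` set ps \<subseteq> carrier R" and V: "bimodule R V" "V \<subseteq> carrier (End_ring R M)"
      and nil: "\<forall>(x, a)\<in>set ps. \<forall>f\<in>V. \<exists>k. (twisted_comm R x a ^^ k) f = op_zero R"
    show "V \<subseteq> W"
    proof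
      fix f assume f: "f \<in> V"
      show "f \<in> W"
      proof (cases "f = op_zero R")
        case False
        have psc: "set ps \<subseteq> carrier R \<times> carrier R"
          using ps xs(1) by force
        obtain e where e: "e \<in> V" "e \<noteq> op_zero R" "\<And>x a. (x, a) \<in> set ps \<Longrightarrow> twisted_comm R x a e = op_zero R"
          using common_eigenvector[OF V(1) f False psc nil] by blast
        have "\<exists>a\<in>carrier R. twisted_comm R x a e = op_zero R" if "x \<in> set xs" for x
          using that ps e(3) psc by force
        then obtain g where g: "g \<in> Gal R M"
          "\<And>x a. x \<in> carrier R \<Longrightarrow> a \<in> carrier R \<Longrightarrow> twisted_comm R x a e = op_zero R \<Longrightarrow> a = g x"
          using eigenvector_Gal[OF K fin M KM xs _ e(2)] V(2) e(1) by blast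
        obtain h where h: "h \<in> Gal R M" "\<And>x. x \<in> carrier R \<Longrightarrow> h (g x) = x" "\<And>x. x \<in> carrier R \<Longrightarrow> g (h x) = x"
          using Gal_inverse[OF M g(1)] by blast
        note G = GalD[OF g(1)] and H = GalD[OF h(1)]
        \<comment> \<open>The eigenvector \<open>e\<close> serves to find \<open>g\<close>; every
          \<open>f\<close> in \<open>V\<close> has the same eigenvalues. Undoing \<open>g\<close>
          moves \<open>f\<close> to the eigenspace of the identity.\<close>
        define d where "d = compose (carrier R) f h"
        have fE: "f \<in> carrier (End_ring R M)" using f V(2) by auto
        have fA: "f \<in> additive_End" using fE End_ring_mono[of "{}" M] by blast
        \<comment> \<open>Nilpotency for \<open>d\<close> is known at the elements
          \<open>g x\<close>, so the spanning set is transported by \<open>g\<close>.\<close>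
        have "d \<in> diff_ops R M"
        proof (rule diff_ops_of_nilpotent[OF K M KM, of "map g xs"])
          show "set (map g xs) \<subseteq> carrier R" using xs(1) G(4) by auto
          show "d \<in> carrier (End_ring R M)" unfolding d_def using M fE H(1) by (rule compose_End_ring)
          show "\<exists>k. (twisted_comm R z z ^^ k) d = op_zero R" if "z \<in> set (map g xs)" for z
          proof -
            obtain x where x: "x \<in> set xs" "z = g x" using \<open>z \<in> set (map g xs)\<close> by auto
            obtain a where a: "(x, a) \<in> set ps" using x(1) ps(1) by force
            then have xa: "x \<in> carrier R" "a \<in> carrier R" using psc by auto
            then have "z = a" using g(2) e(3)[OF a] x(2) by blast
            obtain k where k: "(twisted_comm R x a ^^ k) f = op_zero R" using nil a f by blast
            have "(twisted_comm R z z ^^ k) d = compose (carrier R) ((twisted_comm R x z ^^ k) f) h"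
              unfolding d_def using twisted_comm_pow_compose[OF h(1) _ _ fA, of z z k] x(2) xa G(4) h(2) by simp
            then show ?thesis using k \<open>z = a\<close> compose_op_zero[OF h(1)] by auto
          qed
          show "Span K (map g xs) = carrier R"
          proof -
            have gK: "g \<in> carrier (End_ring R K)" using G(1) End_ring_mono[OF KM] by blast
            have "g ` Span K ys \<subseteq> Span K (map g ys)" if "set ys \<subseteq> carrier R" for ys
              using that
            proof (induction ys)
              case (Cons y ys)
              have "g (k \<otimes> y \<oplus> v) = k \<otimes> g y \<oplus> g v" if "k \<in> K" "v \<in> Span K ys" for k v
                using that Cons.prems Kc Span_in_carrier[OF Kc, of ys]
                by (auto simp: End_ring_add[OF gK] End_ring_smult[OF gK] subset_iff simp del: Span.simps)
              then show ?case using Cons by (fastforce simp: line_extension_mem_iff)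
            qed (simp add: End_ring_zero[OF gK])
            from this[OF xs(1)] have "g ` carrier R \<subseteq> Span K (map g xs)" by (simp only: xs(2))
            moreover have "g ` carrier R = carrier R" using G(3) by (simp add: bij_betw_def)
            moreover have "Span K (map g xs) \<subseteq> carrier R"
              using xs(1) G(4) by (intro Span_in_carrier Kc) auto
            ultimately show ?thesis by simp
          qed
        qed
        moreover have "compose (carrier R) d g = f"
          using compose_End_ring[OF M compose_End_ring[OF M fE H(1)] G(1)] fE
          by (intro End_ring_eqI[of _ R M _ M]) (auto simp: d_def compose_def G(4) h(2))
        ultimately show ?thesis using W(3) g(1) by metis
      qed (use W in simp)
    qed
  qed
qed

end

subsection \<open>The decomposition of the endomorphism ring\<close>

text \<open>\<open>skew_sum\<close> is the union of these sets over finite \<open>F\<close>; fixing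
  \<open>F\<close> permits induction on it.\<close>

definition sum_over ::
    "('c, 'd) ring_scheme \<Rightarrow> 'c set \<Rightarrow> 'c set \<Rightarrow> 'c set" where
  "sum_over E D F = {finsum E f F | f. f \<in> (\<Pi> h\<in>F. D #>\<^bsub>E\<^esub> h)}"

lemma End_ring_op_add_op_zero: "f \<oplus>\<^bsub>End_ring R M\<^esub> g = op_add R f g" "\<zero>\<^bsub>End_ring R M\<^esub> = op_zero R"
  by (simp_all add: End_ring_ops op_add_def op_zero_def)

lemma End_ring_r_coset: "D #>\<^bsub>End_ring R M\<^esub> g = (\<lambda>d. compose (carrier R) d g) ` D"
  by (auto simp: r_coset_def End_ring_ops)

context field
begin

section \<open>Independence of the eigenspaces of distinct automorphisms\<close>

lemma twisted_comm_pow_pow_commute: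
  assumes "x \<in> carrier R" "a \<in> carrier R" "z \<in> carrier R" "b \<in> carrier R" "f \<in> additive_End"
  shows "(twisted_comm R x a ^^ k) ((twisted_comm R z b ^^ j) f) = (twisted_comm R z b ^^ j) ((twisted_comm R x a ^^ k) f)"
  using assms by (induction j) (simp_all add: twisted_comm_pow_commute twisted_comm_pow_additive_End)

lemma twisted_comm_pow_closed:
  "F \<subseteq> carrier R \<Longrightarrow> x \<in> carrier R \<Longrightarrow> a \<in> carrier R \<Longrightarrow> f \<in> carrier (End_ring R F)
    \<Longrightarrow> (twisted_comm R x a ^^ k) f \<in> carrier (End_ring R F)"
  by (rule twisted_comm_pow_bimodule[OF bimodule_End_ring])

lemma twisted_comm_pow_finsum:
  assumes F: "F \<subseteq> carrier R" and x: "x \<in> carrier R" "a \<in> carrier R"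
  shows "finite H \<Longrightarrow> \<phi> \<in> H \<rightarrow> carrier (End_ring R F) \<Longrightarrow>
    (twisted_comm R x a ^^ k) (finsum (End_ring R F) \<phi> H) = finsum (End_ring R F) (\<lambda>h. (twisted_comm R x a ^^ k) (\<phi> h)) H"
proof (induction H rule: finite_induct)
  interpret E: ring "End_ring R F" using F by (rule ring_End_ring)
  case empty
  then show ?case using x by (simp add: End_ring_op_add_op_zero twisted_comm_pow_op_zero)
next
  interpret E: ring "End_ring R F" using F by (rule ring_End_ring)
  case (insert g H)
  have FA: "f \<in> additive_End" if "f \<in> carrier (End_ring R F)" for f
    using that End_ring_mono[of "{}" F] by blast
  have g: "\<phi> g \<in> carrier (End_ring R F)" and H: "\<phi> \<in> H \<rightarrow> carrier (End_ring R F)"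
    using insert.prems by auto
  have H': "(\<lambda>h. (twisted_comm R x a ^^ k) (\<phi> h)) \<in> H \<rightarrow> carrier (End_ring R F)"
    using H twisted_comm_pow_closed[OF F x] by auto
  have s: "finsum (End_ring R F) \<phi> H \<in> carrier (End_ring R F)" using H by (rule E.finsum_closed)
  have "finsum (End_ring R F) \<phi> (insert g H) = op_add R (\<phi> g) (finsum (End_ring R F) \<phi> H)"
    using insert.hyps g H by (simp add: End_ring_op_add_op_zero)
  moreover have "finsum (End_ring R F) (\<lambda>h. (twisted_comm R x a ^^ k) (\<phi> h)) (insert g H)
      = op_add R ((twisted_comm R x a ^^ k) (\<phi> g)) (finsum (End_ring R F) (\<lambda>h. (twisted_comm R x a ^^ k) (\<phi> h)) H)"
    using insert.hyps g H' twisted_comm_pow_closed[OF F x g, of k] by (simp add: End_ring_op_add_op_zero)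
  ultimately show ?case
    using insert.IH[OF H] twisted_comm_pow_op_add[OF x FA[OF g] FA[OF s], of k] by simp
qed

lemma Gal_eqI:
  assumes "g \<in> Gal R M" "h \<in> Gal R M" "\<And>x. x \<in> carrier R \<Longrightarrow> g x = h x" shows "g = h"
  using End_ring_eqI[OF GalD(1)[OF assms(1)] GalD(1)[OF assms(2)] assms(3)] .

text \<open>A variant of Dedekind's independence of characters. For \<open>h\<close> in
  \<open>H\<close> choose \<open>l\<close> where \<open>g\<close> and \<open>h\<close> differ: a
  power of the operator for the eigenvalue \<open>g l\<close> removes the summand of
  \<open>g\<close> and respects the eigenspaces of the others. By induction it kills the summand of
  \<open>h\<close> too, which then belongs to two different eigenvalues at \<open>l\<close>.\<close>

lemma gen_eigen_independent:
  assumes F: "F \<subseteq> carrier R"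
  shows "finite H \<Longrightarrow> H \<subseteq> Gal R M \<Longrightarrow> \<phi> \<in> H \<rightarrow> carrier (End_ring R F) \<Longrightarrow>
    (\<forall>h\<in>H. \<forall>l\<in>carrier R. \<exists>k. (twisted_comm R l (h l) ^^ k) (\<phi> h) = op_zero R) \<Longrightarrow>
    finsum (End_ring R F) \<phi> H = op_zero R \<Longrightarrow> \<forall>h\<in>H. \<phi> h = op_zero R"
proof (induction H arbitrary: \<phi> rule: finite_induct)
  case empty
  then show ?case by simp
next
  case (insert g H)
  interpret E: ring "End_ring R F" using F by (rule ring_End_ring)
  have FA: "f \<in> additive_End" if "f \<in> carrier (End_ring R F)" for f
    using that End_ring_mono[of "{}" F] by blast
  have g: "\<phi> g \<in> carrier (End_ring R F)" "g \<in> Gal R M"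
    and H: "\<phi> \<in> H \<rightarrow> carrier (End_ring R F)" "H \<subseteq> Gal R M"
    using insert.prems by auto
  let ?s = "finsum (End_ring R F) \<phi> H"
  have s: "?s \<in> carrier (End_ring R F)" using H(1) by (rule E.finsum_closed)
  have sum: "op_add R (\<phi> g) ?s = op_zero R"
    using insert.hyps g H insert.prems(4) by (simp add: End_ring_op_add_op_zero)
  have z: "\<phi> h = op_zero R" if h: "h \<in> H" for h
  proof -
    have hG: "h \<in> Gal R M" "\<phi> h \<in> carrier (End_ring R F)" using h H by auto
    have "g \<noteq> h" using h insert.hyps by auto
    then obtain l where l: "l \<in> carrier R" "g l \<noteq> h l" using Gal_eqI[OF g(2) hG(1)] by blast
    have gl: "g l \<in> carrier R" "h l \<in> carrier R" using GalD(4) g(2) hG(1) l(1) by auto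
    obtain k where k: "(twisted_comm R l (g l) ^^ k) (\<phi> g) = op_zero R" using insert.prems(3) l(1) by blast
    define T where "T = (twisted_comm R l (g l) ^^ k)"
    have "T (op_add R (\<phi> g) ?s) = T ?s"
      using k l gl g s FA by (simp add: T_def twisted_comm_pow_op_add op_add_op_zero twisted_comm_pow_additive_End)
    then have "T ?s = op_zero R" using sum l gl by (simp add: T_def twisted_comm_pow_op_zero)
    then have Ts: "finsum (End_ring R F) (\<lambda>h. T (\<phi> h)) H = op_zero R"
      using twisted_comm_pow_finsum[OF F l(1) gl(1) insert.hyps(1) H(1), of k] by (simp add: T_def)
    have "\<forall>h\<in>H. T (\<phi> h) = op_zero R"
    proof (rule insert.IH[OF H(2) _ _ Ts])
      show "(\<lambda>h. T (\<phi> h)) \<in> H \<rightarrow> carrier (End_ring R F)"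
        using H(1) twisted_comm_pow_closed[OF F l(1) gl(1)] by (auto simp: T_def)
      show "\<forall>h\<in>H. \<forall>m\<in>carrier R. \<exists>j. (twisted_comm R m (h m) ^^ j) (T (\<phi> h)) = op_zero R"
      proof (intro ballI)
        fix h' m assume h': "h' \<in> H" and m: "m \<in> carrier R"
        then obtain j where j: "(twisted_comm R m (h' m) ^^ j) (\<phi> h') = op_zero R" using insert.prems(3) by blast
        have "h' m \<in> carrier R" "\<phi> h' \<in> additive_End" using h' H m FA GalD(4)[of h' M m] by auto
        then have "(twisted_comm R m (h' m) ^^ j) (T (\<phi> h')) = op_zero R"
          using j l gl m by (simp add: T_def twisted_comm_pow_pow_commute[of m "h' m"] twisted_comm_pow_op_zero)
        then show "\<exists>j. (twisted_comm R m (h' m) ^^ j) (T (\<phi> h')) = op_zero R" by blast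
      qed
    qed
    then have Th: "(twisted_comm R l (g l) ^^ k) (\<phi> h) = op_zero R" using h by (simp add: T_def)
    obtain j where j: "(twisted_comm R l (h l) ^^ j) (\<phi> h) = op_zero R" using insert.prems(3) h l(1) by blast
    show ?thesis using gen_eigen_disjoint[OF l(1) gl l(2) FA[OF hG(2)] Th j] .
  qed
  have "?s = finsum (End_ring R F) (\<lambda>_. op_zero R) H"
    using z op_zero_closed[OF F] by (intro E.finsum_cong') auto
  also have "\<dots> = op_zero R" by (simp add: End_ring_op_add_op_zero(2)[where R=R and M=F, symmetric])
  finally have "\<phi> g = op_zero R" using sum FA[OF g(1)] by (simp add: op_add_op_zero)
  then show ?case using z by simp
qed

text \<open>Nilpotency of the commutator of a differential operator with \<open>g l\<close>,
  transported by \<open>twisted_comm_pow_compose\<close>.\<close>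

lemma r_coset_gen_eigen:
  assumes M: "M \<subseteq> carrier R" and g: "g \<in> Gal R M" and f: "f \<in> diff_ops R M #>\<^bsub>End_ring R F\<^esub> g"
    and l: "l \<in> carrier R"
  shows "\<exists>k. (twisted_comm R l (g l) ^^ k) f = op_zero R"
proof -
  obtain d where d: "d \<in> diff_ops R M" "f = compose (carrier R) d g"
    using f by (auto simp: End_ring_r_coset)
  have dA: "d \<in> additive_End" using d(1) bimoduleD(1)[OF bimodule_diff_ops[OF M]] by auto
  have gl: "g l \<in> carrier R" using GalD(4)[OF g l] .
  obtain k where "(twisted_comm R (g l) (g l) ^^ k) d = op_zero R"
    using diff_ops_nilpotent[OF M gl d(1)] by blast
  then have "(twisted_comm R l (g l) ^^ k) f = op_zero R"
    using twisted_comm_pow_compose[OF g l gl dA] compose_op_zero[OF g] by (simp add: d(2))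
  then show ?thesis by blast
qed

lemma r_coset_End_ring:
  assumes M: "M \<subseteq> carrier R" and g: "g \<in> Gal R M"
  shows "diff_ops R M #>\<^bsub>End_ring R F\<^esub> g \<subseteq> carrier (End_ring R M)"
  using compose_End_ring[OF M _ GalD(1)[OF g]] diff_ops_End_ring[OF M]
  by (auto simp: End_ring_r_coset)

lemma skew_direct_diff_ops:
  assumes M: "M \<subseteq> carrier R" and F: "F \<subseteq> M"
  shows "skew_direct (End_ring R F) (diff_ops R M) (Gal R M)"
  unfolding skew_direct_def End_ring_op_add_op_zero(2)
proof (intro allI impI, elim conjE)
  fix H f assume H: "finite H" "H \<subseteq> Gal R M" and f: "f \<in> (\<Pi> h\<in>H. diff_ops R M #>\<^bsub>End_ring R F\<^esub> h)"
    and s: "finsum (End_ring R F) f H = op_zero R"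
  have Fc: "F \<subseteq> carrier R" using F M by auto
  have "f \<in> H \<rightarrow> carrier (End_ring R F)"
  proof
    fix h assume h: "h \<in> H"
    then have "f h \<in> carrier (End_ring R M)"
      using f r_coset_End_ring[OF M, of h F] H(2) by blast
    then show "f h \<in> carrier (End_ring R F)" using End_ring_mono[OF F] by blast
  qed
  moreover have "\<forall>h\<in>H. \<forall>l\<in>carrier R. \<exists>k. (twisted_comm R l (h l) ^^ k) (f h) = op_zero R"
  proof (intro ballI)
    fix h l assume h: "h \<in> H" and l: "l \<in> carrier R"
    have "h \<in> Gal R M" "f h \<in> diff_ops R M #>\<^bsub>End_ring R F\<^esub> h" using h H(2) f by auto
    then show "\<exists>k. (twisted_comm R l (h l) ^^ k) (f h) = op_zero R"
      using r_coset_gen_eigen[OF M _ _ l] by blast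
  qed
  ultimately show "\<forall>h\<in>H. f h = op_zero R"
    using gen_eigen_independent[OF Fc H _ _ s] by blast
qed

section \<open>Sums over sets of automorphisms and their dimension\<close>

lemma sum_over_insert:
  assumes E: "ring E" and g: "finite H" "g \<notin> H"
    and D: "\<And>h. h \<in> insert g H \<Longrightarrow> D #>\<^bsub>E\<^esub> h \<subseteq> carrier E"
  shows "sum_over E D (insert g H) = (D #>\<^bsub>E\<^esub> g) <+>\<^bsub>E\<^esub> sum_over E D H"
proof -
  interpret E: ring E by fact
  have Pi: "f \<in> H \<rightarrow> carrier E" if "f \<in> (\<Pi> h\<in>H. D #>\<^bsub>E\<^esub> h)" for f using that D by blast
  show ?thesis
  proof
    show "sum_over E D (insert g H) \<subseteq> (D #>\<^bsub>E\<^esub> g) <+>\<^bsub>E\<^esub> sum_over E D H"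
    proof
      fix x assume "x \<in> sum_over E D (insert g H)"
      then obtain f where f: "f \<in> (\<Pi> h\<in>insert g H. D #>\<^bsub>E\<^esub> h)" "x = finsum E f (insert g H)"
        by (auto simp: sum_over_def)
      then have fH: "f \<in> (\<Pi> h\<in>H. D #>\<^bsub>E\<^esub> h)" and fg: "f g \<in> D #>\<^bsub>E\<^esub> g" by auto
      have "x = f g \<oplus>\<^bsub>E\<^esub> finsum E f H"
        using f(2) g Pi[OF fH] subsetD[OF D[OF insertI1] fg] by simp
      then show "x \<in> (D #>\<^bsub>E\<^esub> g) <+>\<^bsub>E\<^esub> sum_over E D H"
        using fg fH by (auto simp: set_add_def' sum_over_def)
    qed
    show "(D #>\<^bsub>E\<^esub> g) <+>\<^bsub>E\<^esub> sum_over E D H \<subseteq> sum_over E D (insert g H)"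
    proof
      fix x assume "x \<in> (D #>\<^bsub>E\<^esub> g) <+>\<^bsub>E\<^esub> sum_over E D H"
      then obtain a f where a: "a \<in> D #>\<^bsub>E\<^esub> g" and f: "f \<in> (\<Pi> h\<in>H. D #>\<^bsub>E\<^esub> h)" "x = a \<oplus>\<^bsub>E\<^esub> finsum E f H"
        by (auto simp: set_add_def' sum_over_def)
      have eq: "finsum E (f(g := a)) H = finsum E f H"
        using Pi[OF f(1)] g by (intro E.finsum_cong') auto
      have "x = finsum E (f(g := a)) (insert g H)"
        using f(2) g Pi[OF f(1)] subsetD[OF D[OF insertI1] a] eq by (subst E.finsum_insert) auto
      moreover have "f(g := a) \<in> (\<Pi> h\<in>insert g H. D #>\<^bsub>E\<^esub> h)" using f a g by auto
      ultimately show "x \<in> sum_over E D (insert g H)" unfolding sum_over_def by blast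
    qed
  qed
qed

lemma sum_over_End_ring:
  assumes M: "M \<subseteq> carrier R" and F: "F \<subseteq> M" and H: "finite H" "H \<subseteq> Gal R M"
  shows "sum_over (End_ring R F) (diff_ops R M) H \<subseteq> carrier (End_ring R M)"
  using H
proof (induction H rule: finite_induct)
  interpret E: ring "End_ring R F" using F M by (intro ring_End_ring) auto
  case empty
  then show ?case using op_zero_closed[OF M] by (simp add: sum_over_def End_ring_op_add_op_zero)
next
  interpret E: ring "End_ring R F" using F M by (intro ring_End_ring) auto
  case (insert g H)
  have "sum_over (End_ring R F) (diff_ops R M) (insert g H) =
    (diff_ops R M #>\<^bsub>End_ring R F\<^esub> g) <+>\<^bsub>End_ring R F\<^esub> sum_over (End_ring R F) (diff_ops R M) H"
    using insert.prems r_coset_End_ring[OF M] End_ring_mono[OF F]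
    by (intro sum_over_insert E.ring_axioms insert.hyps) blast
  moreover have "diff_ops R M #>\<^bsub>End_ring R F\<^esub> g \<subseteq> carrier (End_ring R M)"
    using r_coset_End_ring[OF M] insert.prems by simp
  moreover have "sum_over (End_ring R F) (diff_ops R M) H \<subseteq> carrier (End_ring R M)"
    using insert by simp
  moreover have "A <+>\<^bsub>End_ring R F\<^esub> B \<subseteq> carrier (End_ring R M)"
    if "A \<subseteq> carrier (End_ring R M)" "B \<subseteq> carrier (End_ring R M)" for A B
  proof
    fix x assume "x \<in> A <+>\<^bsub>End_ring R F\<^esub> B"
    then obtain a b where "a \<in> A" "b \<in> B" "x = op_add R a b"
      unfolding set_add_def' End_ring_op_add_op_zero by blast
    then show "x \<in> carrier (End_ring R M)" using op_add_closed[OF M] that by (simp add: subset_iff)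
  qed
  ultimately show ?case by simp
qed

text \<open>With the index set fixed to all of \<open>Gal R M\<close>, sums can be added termwise,
  as the target of \<open>End_ring_span\<close> requires. The finiteness assumed here is supplied by
  the dimension bound in \<open>dimension_diff_ops\<close>.\<close>

lemma sum_over_eq_End_ring:
  assumes K: "subfield K R" and fin: "finite_dimension K (carrier R)" and N: "normal_extension R K"
    and M: "M \<subseteq> carrier R" and KM: "K \<subseteq> M" and F: "F \<subseteq> M" and G: "finite (Gal R M)"
  shows "carrier (End_ring R M) = sum_over (End_ring R F) (diff_ops R M) (Gal R M)"
proof
  show "sum_over (End_ring R F) (diff_ops R M) (Gal R M) \<subseteq> carrier (End_ring R M)"
    using sum_over_End_ring[OF M F G] by simp
  interpret E: ring "End_ring R F" using F M by (intro ring_End_ring) auto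
  let ?D = "\<lambda>h. diff_ops R M #>\<^bsub>End_ring R F\<^esub> h"
  note B = bimoduleD[OF bimodule_diff_ops[OF M]]
  have zc: "op_zero R \<in> ?D h" if "h \<in> Gal R M" for h
    using B(2) compose_op_zero[OF that] unfolding End_ring_r_coset by (metis imageI)
  have De: "?D h \<subseteq> carrier (End_ring R F)" if "h \<in> Gal R M" for h
    using r_coset_End_ring[OF M that] End_ring_mono[OF F] by blast
  show "carrier (End_ring R M) \<subseteq> sum_over (End_ring R F) (diff_ops R M) (Gal R M)"
  proof (rule End_ring_span[OF K fin N M KM])
    have "finsum (End_ring R F) (\<lambda>_. op_zero R) (Gal R M) = op_zero R"
      by (simp add: End_ring_op_add_op_zero(2)[where R=R and M=F, symmetric])
    then show "op_zero R \<in> sum_over (End_ring R F) (diff_ops R M) (Gal R M)"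
      unfolding sum_over_def using zc by (intro CollectI exI[of _ "\<lambda>_. op_zero R"]) auto
  next
    fix a b assume "a \<in> sum_over (End_ring R F) (diff_ops R M) (Gal R M)"
      "b \<in> sum_over (End_ring R F) (diff_ops R M) (Gal R M)"
    then obtain \<phi> \<psi> where p: "\<phi> \<in> (\<Pi> h\<in>Gal R M. ?D h)" "\<psi> \<in> (\<Pi> h\<in>Gal R M. ?D h)"
      "a = finsum (End_ring R F) \<phi> (Gal R M)" "b = finsum (End_ring R F) \<psi> (Gal R M)"
      unfolding sum_over_def by blast
    have "op_add R a b = finsum (End_ring R F) (\<lambda>h. \<phi> h \<oplus>\<^bsub>End_ring R F\<^esub> \<psi> h) (Gal R M)"
      unfolding p(3,4) End_ring_op_add_op_zero(1)[where R=R and M=F, symmetric]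
      using p(1,2) De by (intro E.finsum_addf[symmetric]) blast+
    moreover have "(\<lambda>h. \<phi> h \<oplus>\<^bsub>End_ring R F\<^esub> \<psi> h) \<in> (\<Pi> h\<in>Gal R M. ?D h)"
    proof
      fix h assume h: "h \<in> Gal R M"
      then obtain d e where "d \<in> diff_ops R M" "e \<in> diff_ops R M"
        and de: "\<phi> h = compose (carrier R) d h" "\<psi> h = compose (carrier R) e h"
        using p(1,2) unfolding End_ring_r_coset by blast
      then have "op_add R d e \<in> diff_ops R M" using B(3) by blast
      moreover have "\<phi> h \<oplus>\<^bsub>End_ring R F\<^esub> \<psi> h = compose (carrier R) (op_add R d e) h"
        using GalD(4)[OF h] by (auto simp: de End_ring_op_add_op_zero op_add_def compose_def fun_eq_iff)
      ultimately show "\<phi> h \<oplus>\<^bsub>End_ring R F\<^esub> \<psi> h \<in> ?D h" unfolding End_ring_r_coset by blast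
    qed
    ultimately show "op_add R a b \<in> sum_over (End_ring R F) (diff_ops R M) (Gal R M)"
      unfolding sum_over_def by blast
  next
    fix d g assume d: "d \<in> diff_ops R M" and g: "g \<in> Gal R M"
    then have dg: "compose (carrier R) d g \<in> ?D g" unfolding End_ring_r_coset by blast
    \<comment> \<open>A single product is padded with zeros at the other automorphisms.\<close>
    let ?\<phi> = "\<lambda>h. if g = h then compose (carrier R) d h else \<zero>\<^bsub>End_ring R F\<^esub>"
    have "finsum (End_ring R F) ?\<phi> (Gal R M) = compose (carrier R) d g"
    proof -
      have "compose (carrier R) d h \<in> carrier (End_ring R F)" if "h \<in> Gal R M" for h
        using De[OF that] d unfolding End_ring_r_coset by blast
      then show ?thesis
        using E.finsum_singleton[OF g G, of "\<lambda>h. compose (carrier R) d h"] by blast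
    qed
    moreover have "?\<phi> \<in> (\<Pi> h\<in>Gal R M. ?D h)" using dg zc by (auto simp: End_ring_op_add_op_zero)
    ultimately show "compose (carrier R) d g \<in> sum_over (End_ring R F) (diff_ops R M) (Gal R M)"
      unfolding sum_over_def mem_Collect_eq by (intro exI[of _ ?\<phi>] conjI[OF sym])
  qed
qed

lemma bimodule_subalgebra_mulop:
  assumes F: "F \<subseteq> carrier R" and U: "bimodule R U" "U \<subseteq> carrier (End_ring R F)" and V: "V \<subseteq> carrier R"
  shows "subalgebra (mulop R ` V) U (End_ring R F)"
proof (rule subalgebra.intro)
  interpret E: ring "End_ring R F" using F by (rule ring_End_ring)
  note B = bimoduleD[OF U(1)]
  have lm: "mulop R l \<otimes>\<^bsub>End_ring R F\<^esub> f = left_scale R l f" if "l \<in> carrier R" "f \<in> U" for l f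
  proof -
    have "f x \<in> carrier R" if "x \<in> carrier R" for x
      using End_ring_closed[OF subsetD[OF U(2) \<open>f \<in> U\<close>] that] .
    then show ?thesis by (auto simp: End_ring_ops left_scale_def mulop_def compose_def fun_eq_iff)
  qed
  show "subalgebra_axioms (mulop R ` V) U (End_ring R F)"
    using B(4) V by (auto intro!: subalgebra_axioms.intro simp: lm subset_iff)
  show "subgroup U (add_monoid (End_ring R F))"
  proof (rule E.add.subgroupI)
    fix f assume f: "f \<in> U"
    have "\<ominus>\<^bsub>End_ring R F\<^esub> f = left_scale R (\<ominus> \<one>) f"
      using f U(2) End_ring_a_inv[OF F, of f] End_ring_closed[of f R F]
      by (auto simp: left_scale_def l_minus fun_eq_iff subset_iff)
    then show "\<ominus>\<^bsub>End_ring R F\<^esub> f \<in> U" using B(4)[of "\<ominus> \<one>"] f by simp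
  qed (use B U in \<open>auto simp: End_ring_op_add_op_zero\<close>)
qed

text \<open>Right multiplication by the invertible operator \<open>g\<close> is linear over the copy
  of \<open>L\<close> acting on the left, so every summand has the dimension \<open>r\<close> of the
  differential operators. Directness bounds \<open>card H * r\<close> by \<open>n\<close> for finite
  \<open>H\<close>, which first gives finiteness of the Galois group and then, with the full sum,
  equality.\<close>

lemma dimension_diff_ops:
  assumes K: "subfield K R" and fin: "finite_dimension K (carrier R)" and N: "normal_extension R K"
    and M: "subfield M R" and KM: "K \<subseteq> M" and F: "F \<subseteq> M" and n: "dimension n M (carrier R)"
  shows "finite (Gal R M)"
    and "\<exists>r. ring.dimension (End_ring R F) r (mulop R ` carrier R) (diff_ops R M) \<and> card (Gal R M) * r = n"
proof -
  have Mc: "M \<subseteq> carrier R" using M by (rule subfieldE(3))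
  then have Fc: "F \<subseteq> carrier R" using F by auto
  interpret E: ring "End_ring R F" using Fc by (rule ring_End_ring)
  let ?L = "mulop R ` carrier R" and ?D = "diff_ops R M"
  let ?S = "sum_over (End_ring R F) ?D"
  have sub: "carrier (End_ring R M) \<subseteq> carrier (End_ring R F)" using F by (rule End_ring_mono)
  have L: "subfield ?L (End_ring R F)" using Fc carrier_is_subfield by (rule subfield_mulop)
  have EM: "E.dimension n ?L (carrier (End_ring R M))" using dimension_End_ring[OF M n F] .
  have DF: "?D \<subseteq> carrier (End_ring R F)" using diff_ops_End_ring[OF Mc] sub by blast
  have "subalgebra ?L ?D (End_ring R F)"
    by (rule bimodule_subalgebra_mulop[OF Fc bimodule_diff_ops[OF Mc] DF order_refl])
  then have "E.finite_dimension ?L ?D"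
    using E.subalbegra_incl_imp_finite_dimension[OF L E.finite_dimensionI[OF EM]] diff_ops_End_ring[OF Mc] by blast
  then obtain r where r: "E.dimension r ?L ?D" by blast
  have Dg: "E.dimension r ?L (?D #>\<^bsub>End_ring R F\<^esub> g)" if g: "g \<in> Gal R M" for g
  proof -
    have gF: "g \<in> carrier (End_ring R F)" using GalD(1)[OF g] sub by blast
    obtain h where h: "h \<in> Gal R M" "\<And>x. x \<in> carrier R \<Longrightarrow> g (h x) = x" using Gal_inverse[OF Mc g] by blast
    have hF: "h \<in> carrier (End_ring R F)" using GalD(1)[OF h(1)] sub by blast
    have gh: "g \<otimes>\<^bsub>End_ring R F\<^esub> h = \<one>\<^bsub>End_ring R F\<^esub>"
      using h by (auto simp: End_ring_ops compose_def fun_eq_iff)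
    have "E.dimension r ?L ((\<lambda>d. d \<otimes>\<^bsub>End_ring R F\<^esub> g) ` ?D)"
    proof (rule E.dimension_image[OF r L])
      show "inj_on (\<lambda>d. d \<otimes>\<^bsub>End_ring R F\<^esub> g) (carrier (End_ring R F))"
        by (rule inj_on_inverseI[of _ "\<lambda>d. d \<otimes>\<^bsub>End_ring R F\<^esub> h"]) (simp add: E.m_assoc gF hF gh)
    qed (use gF subfieldE(3)[OF L] in \<open>auto simp: E.l_distr E.m_assoc\<close>)
    then show ?thesis by (simp add: End_ring_r_coset End_ring_ops)
  qed
  have dimS: "E.dimension (card H * r) ?L (?S H)" if "finite H" "H \<subseteq> Gal R M" for H
    using that
  proof (induction H rule: finite_induct)
    case empty
    then show ?case by (simp add: sum_over_def)
  next
    case (insert g H)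
    have cl: "?D #>\<^bsub>End_ring R F\<^esub> h \<subseteq> carrier (End_ring R F)" if "h \<in> insert g H" for h
      using that insert.prems r_coset_End_ring[OF Mc, of h F] sub by blast
    have "(?D #>\<^bsub>End_ring R F\<^esub> g) \<inter> ?S H = {\<zero>\<^bsub>End_ring R F\<^esub>}"
    proof
      show "(?D #>\<^bsub>End_ring R F\<^esub> g) \<inter> ?S H \<subseteq> {\<zero>\<^bsub>End_ring R F\<^esub>}"
      proof
        fix x assume x: "x \<in> (?D #>\<^bsub>End_ring R F\<^esub> g) \<inter> ?S H"
        then obtain f where f: "f \<in> (\<Pi> h\<in>H. ?D #>\<^bsub>End_ring R F\<^esub> h)" "x = finsum (End_ring R F) f H"
          by (auto simp: sum_over_def)
        have fc: "f \<in> H \<rightarrow> carrier (End_ring R F)" using f(1) cl by blast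
        have gG: "g \<in> Gal R M" using insert.prems by simp
        have xg: "x \<in> ?D #>\<^bsub>End_ring R F\<^esub> g" using x by simp
        have xc: "x \<in> carrier (End_ring R F)" using f(2) fc E.finsum_closed by simp
        \<comment> \<open>An element \<open>x\<close> common to both summands, entered as its
          negative at \<open>g\<close> next to its expansion over \<open>H\<close>, gives a
          vanishing sum; directness forces \<open>x\<close> to be zero.\<close>
        define \<phi> where "\<phi> = f(g := \<ominus>\<^bsub>End_ring R F\<^esub> x)"
        have mx: "\<ominus>\<^bsub>End_ring R F\<^esub> x \<in> ?D #>\<^bsub>End_ring R F\<^esub> g"
          using E.space_subgroup_props(4)[OF L Dg[OF gG] xg] .
        have "finsum (End_ring R F) \<phi> H = x"
          unfolding f(2) using fc insert.hyps by (intro E.finsum_cong') (auto simp: \<phi>_def)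
        moreover have "\<phi> \<in> H \<rightarrow> carrier (End_ring R F)" using fc insert.hyps by (auto simp: \<phi>_def)
        ultimately have "finsum (End_ring R F) \<phi> (insert g H) = \<zero>\<^bsub>End_ring R F\<^esub>"
          using insert.hyps xc by (simp add: \<phi>_def E.l_neg)
        moreover have "\<phi> \<in> (\<Pi> h\<in>insert g H. ?D #>\<^bsub>End_ring R F\<^esub> h)" using f(1) mx by (auto simp: \<phi>_def)
        ultimately have "\<phi> g = \<zero>\<^bsub>End_ring R F\<^esub>"
          using skew_direct_diff_ops[OF Mc F, unfolded skew_direct_def, rule_format, of "insert g H" \<phi> g]
            insert.hyps(1) insert.prems by simp
        then show "x \<in> {\<zero>\<^bsub>End_ring R F\<^esub>}" using xc by (simp add: \<phi>_def)
      qed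
      show "{\<zero>\<^bsub>End_ring R F\<^esub>} \<subseteq> (?D #>\<^bsub>End_ring R F\<^esub> g) \<inter> ?S H"
        using E.space_subgroup_props(2)[OF L Dg] E.space_subgroup_props(2)[OF L insert.IH] insert.prems by auto
    qed
    then have "E.dimension (r + card H * r) ?L ((?D #>\<^bsub>End_ring R F\<^esub> g) <+>\<^bsub>End_ring R F\<^esub> ?S H)"
      using E.dimension_direct_sum_space[OF L Dg insert.IH] insert.prems by auto
    moreover have "?S (insert g H) = (?D #>\<^bsub>End_ring R F\<^esub> g) <+>\<^bsub>End_ring R F\<^esub> ?S H"
      by (rule sum_over_insert[OF E.ring_axioms insert.hyps cl])
    ultimately show ?case using insert.hyps by simp
  qed
  \<comment> \<open>Only a positive \<open>r\<close> turns the bound on \<open>card H * r\<close>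
    into one on \<open>card H\<close>; the identity operator is a nonzero differential
    operator.\<close>
  have "r \<noteq> 0"
  proof
    assume "r = 0"
    then have "?D = {\<zero>\<^bsub>End_ring R F\<^esub>}" using r E.dimension_zero[OF L] by simp
    moreover have "mulop R \<one> \<in> ?D" using mulop_diff_ops by blast
    moreover have "mulop R \<one> = \<one>\<^bsub>End_ring R F\<^esub>" by (auto simp: mulop_def End_ring_ops)
    ultimately show False using End_ring_one_not_zero[of F] by simp
  qed
  have "card H \<le> n" if H: "finite H" "H \<subseteq> Gal R M" for H
  proof -
    obtain Us where Us: "E.independent ?L Us" "length Us = card H * r" "E.Span ?L Us = ?S H" "set Us \<subseteq> carrier (End_ring R F)"
      using E.exists_base[OF L dimS[OF H]] by blast
    have "set Us \<subseteq> ?S H" using E.Span_base_incl[OF L Us(4)] Us(3) by simp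
    then have "set Us \<subseteq> carrier (End_ring R M)" using sum_over_End_ring[OF Mc F H] by blast
    then have "card H * r \<le> n" using E.independent_length_le_dimension[OF L EM Us(1)] Us(2) by simp
    moreover have "card H \<le> card H * r" using \<open>r \<noteq> 0\<close> by simp
    ultimately show ?thesis by (rule order_trans[rotated])
  qed
  then show G: "finite (Gal R M)"
    using finite_if_finite_subsets_card_bdd[of "Gal R M" n] by blast
  have "E.dimension (card (Gal R M) * r) ?L (carrier (End_ring R M))"
    using dimS[OF G order_refl] sum_over_eq_End_ring[OF K fin N Mc KM F G] by simp
  then have "card (Gal R M) * r = n" using E.dimension_is_inj[OF L _ EM] by blast
  then show "\<exists>r. E.dimension r ?L ?D \<and> card (Gal R M) * r = n" using r by blast
qed

end

subsection \<open>The correspondence\<close>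

context field
begin

section \<open>Comparing operators over \<open>K\<close> and over \<open>M\<close>\<close>

lemma commute_mulop_iff:
  assumes "f \<in> carrier (End_ring R F)" "m \<in> carrier R"
  shows "f \<otimes>\<^bsub>End_ring R N\<^esub> mulop R m = mulop R m \<otimes>\<^bsub>End_ring R N\<^esub> f
    \<longleftrightarrow> (\<forall>x\<in>carrier R. f (m \<otimes> x) = m \<otimes> f x)"
  using End_ring_closed[OF assms(1)] assms(2)
  by (auto simp: End_ring_ops compose_def mulop_def fun_eq_iff)

lemma End_ring_iff_commute:
  assumes M: "M \<subseteq> carrier R" and KM: "K \<subseteq> M"
  shows "f \<in> carrier (End_ring R M) \<longleftrightarrow> f \<in> carrier (End_ring R K) \<and>
    (\<forall>m\<in>M. f \<otimes>\<^bsub>End_ring R K\<^esub> mulop R m = mulop R m \<otimes>\<^bsub>End_ring R K\<^esub> f)"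
proof
  assume f: "f \<in> carrier (End_ring R M)"
  then show "f \<in> carrier (End_ring R K) \<and>
    (\<forall>m\<in>M. f \<otimes>\<^bsub>End_ring R K\<^esub> mulop R m = mulop R m \<otimes>\<^bsub>End_ring R K\<^esub> f)"
    using End_ring_mono[OF KM, of R] commute_mulop_iff[OF f] M End_ring_smult[OF f] by (simp add: subset_iff)
next
  assume f: "f \<in> carrier (End_ring R K) \<and>
    (\<forall>m\<in>M. f \<otimes>\<^bsub>End_ring R K\<^esub> mulop R m = mulop R m \<otimes>\<^bsub>End_ring R K\<^esub> f)"
  then have "f (m \<otimes> x) = m \<otimes> f x" if "m \<in> M" "x \<in> carrier R" for m x
    using commute_mulop_iff[of f K m K] that M by (simp add: subset_iff)
  then show "f \<in> carrier (End_ring R M)" using f by (simp add: End_ring_mem)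
qed

lemma field_to_algebra_eq:
  assumes "M \<subseteq> carrier R" "K \<subseteq> M"
  shows "field_to_algebra R K M = carrier (End_ring R M)"
  using End_ring_iff_commute[OF assms] by (auto simp: field_to_algebra_def centralizer_def)

text \<open>Commutators are given by the same formula over both fields and preserve
  \<open>M\<close>-linearity, so the filtration by order over \<open>M\<close> is the restriction of
  the one over \<open>K\<close>.\<close>

lemma diff_ops_upto_eq_Int:
  assumes M: "M \<subseteq> carrier R" and KM: "K \<subseteq> M"
  shows "diff_ops_upto R M i = diff_ops_upto R K i \<inter> carrier (End_ring R M)"
proof (induction i)
  case 0
  then show ?case using mulop_closed[OF _ M] by auto
next
  case (Suc i)
  have "K \<subseteq> carrier R" using M KM by auto
  then show ?case
    using Suc M End_ring_mono[OF KM, of R] twisted_comm_closed[OF M] by (auto simp: diff_ops_upto_Suc)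
qed

lemma diff_ops_eq_Int:
  assumes "M \<subseteq> carrier R" "K \<subseteq> M"
  shows "diff_ops R M = diff_ops R K \<inter> carrier (End_ring R M)"
  using diff_ops_upto_eq_Int[OF assms] by (auto simp: diff_ops_def)

lemma diff_ops_commuting_eq:
  assumes M: "M \<subseteq> carrier R" and KM: "K \<subseteq> M"
  shows "diff_ops_commuting R K M = diff_ops R M"
proof -
  have "diff_ops R K \<subseteq> carrier (End_ring R K)" using M KM by (intro diff_ops_End_ring) auto
  then show ?thesis
    using End_ring_iff_commute[OF M KM] by (auto simp: diff_ops_commuting_def diff_ops_eq_Int[OF M KM])
qed

lemma Gal_eq_Int: "K \<subseteq> M \<Longrightarrow> Gal R M = Gal R K \<inter> carrier (End_ring R M)"
  using End_ring_mono[of K M R] by (auto simp: Gal_def)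

lemma Gal_fixing_eq:
  assumes M: "M \<subseteq> carrier R" and KM: "K \<subseteq> M"
  shows "Gal_fixing R K M = Gal R M"
proof
  show "Gal_fixing R K M \<subseteq> Gal R M"
  proof
    fix g assume "g \<in> Gal_fixing R K M"
    then have g: "g \<in> Gal R K" "\<And>m. m \<in> M \<Longrightarrow> g m = m" by (auto simp: Gal_fixing_def)
    then have "g \<in> carrier (End_ring R M)"
      using GalD[OF g(1)] M by (auto simp: End_ring_mem[of g R M] End_ring_mem[of g R K] subset_iff)
    then show "g \<in> Gal R M" using g(1) Gal_eq_Int[OF KM] by blast
  qed
  show "Gal R M \<subseteq> Gal_fixing R K M"
  proof
    fix g assume g: "g \<in> Gal R M"
    have "g m = m" if "m \<in> M" for m
      using End_ring_smult[OF GalD(1)[OF g] that, of \<one>] GalD(2)[OF g] M that by auto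
    then show "g \<in> Gal_fixing R K M" using g Gal_eq_Int[OF KM] by (auto simp: Gal_fixing_def)
  qed
qed

lemma End_ring_subalgebras_over:
  assumes M: "M \<subseteq> carrier R" and KM: "K \<subseteq> M"
  shows "carrier (End_ring R M) \<in> subalgebras_over R K"
proof -
  have Kc: "K \<subseteq> carrier R" using M KM by auto
  interpret E: ring "End_ring R K" using Kc by (rule ring_End_ring)
  note B = bimodule_End_ring[OF M]
  have sub: "carrier (End_ring R M) \<subseteq> carrier (End_ring R K)" using KM by (rule End_ring_mono)
  have sa: "subalgebra (mulop R ` K) (carrier (End_ring R M)) (End_ring R K)"
    using bimodule_subalgebra_mulop[OF Kc B sub Kc] .
  have "subring (carrier (End_ring R M)) (End_ring R K)"
  proof (rule E.subringI[OF sub])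
    show "\<one>\<^bsub>End_ring R K\<^esub> \<in> carrier (End_ring R M)" using M by (auto simp: End_ring_ops End_ring_mem)
    fix f g assume fg: "f \<in> carrier (End_ring R M)" "g \<in> carrier (End_ring R M)"
    show "f \<otimes>\<^bsub>End_ring R K\<^esub> g \<in> carrier (End_ring R M)"
      using compose_End_ring[OF M fg] by (simp add: End_ring_ops)
    show "f \<oplus>\<^bsub>End_ring R K\<^esub> g \<in> carrier (End_ring R M)"
      using op_add_closed[OF M fg] by (simp add: End_ring_op_add_op_zero)
  next
    fix f assume f: "f \<in> carrier (End_ring R M)"
    then show "\<ominus>\<^bsub>End_ring R K\<^esub> f \<in> carrier (End_ring R M)"
      using subgroup.m_inv_closed[OF subalgebra.axioms(1)[OF sa] f] by (simp add: a_inv_def)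
  qed
  moreover have "mulop R ` carrier R \<subseteq> carrier (End_ring R M)" using mulop_closed[OF _ M] by auto
  ultimately show ?thesis using sa by (simp add: subalgebras_over_def)
qed

lemma finite_dimension_over_larger:
  assumes K: "subfield K R" and M: "subfield M R" and KM: "K \<subseteq> M" and fin: "finite_dimension K (carrier R)"
  shows "finite_dimension M (carrier R)"
proof -
  obtain n where "dimension n K (carrier R)" using fin by blast
  then obtain xs where xs: "set xs \<subseteq> carrier R" "Span K xs = carrier R" using exists_base[OF K] by blast
  have "subalgebra M (Span M xs) R" by (rule Span_is_subalgebra[OF M xs(1)])
  then have "subalgebra K (Span M xs) R"
    using KM by (auto simp: subalgebra_def subalgebra_axioms_def)
  then have "carrier R \<subseteq> Span M xs"
    using subalgebra_Span_incl[OF K _ Span_base_incl[OF M xs(1)]] unfolding xs(2) by blast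
  then have "Span M xs = carrier R" using Span_in_carrier[OF subfieldE(3)[OF M] xs(1)] by blast
  then show ?thesis using Span_finite_dimension[OF M xs(1)] by simp
qed

section \<open>From algebras back to fields\<close>

lemma subalgebras_over_imp_End_ring:
  assumes K: "subfield K R" and fin: "finite_dimension K (carrier R)" and A: "A \<in> subalgebras_over R K"
  shows "\<exists>M\<in>intermediate_fields R K. A = carrier (End_ring R M)"
proof -
  have "subring A (End_ring R K)" "mulop R ` carrier R \<subseteq> A"
    using A by (simp_all add: subalgebras_over_def)
  then interpret operator_algebra R K A
    by (intro operator_algebra.intro operator_algebra_axioms.intro field_axioms K)
  have "finite_dimension (field_centralizer R K A) (carrier R)"
    using finite_dimension_over_larger[OF K subfield_field_centralizer K_le_field_centralizer fin] .
  then show ?thesis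
    using jacobson_bourbaki subfield_field_centralizer K_le_field_centralizer
    by (auto simp: intermediate_fields_def)
qed

text \<open>The equation \<open>f x = x \<otimes> f \<one>\<close> is additive in \<open>f\<close>,
  so by \<open>End_ring_span\<close> it need only be checked on a differential operator composed
  with an automorphism. Holding for all \<open>M\<close>-linear operators, it forces
  \<open>x\<close> into \<open>M\<close>.\<close>

lemma zeros_fixed_subset:
  assumes K: "subfield K R" and fin: "finite_dimension K (carrier R)" and N: "normal_extension R K"
    and M: "subfield M R" and KM: "K \<subseteq> M"
  shows "zeros_in R (carrier R) (diff_ops_plus R M) \<inter> fixed_in (carrier R) (Gal R M) \<subseteq> M"
proof
  have Mc: "M \<subseteq> carrier R" using M by (rule subfieldE(3))
  fix x assume "x \<in> zeros_in R (carrier R) (diff_ops_plus R M) \<inter> fixed_in (carrier R) (Gal R M)"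
  then have x: "x \<in> carrier R" and z: "\<And>d. d \<in> diff_ops_plus R M \<Longrightarrow> d x = \<zero>"
    and g: "\<And>g. g \<in> Gal R M \<Longrightarrow> g x = x" by (auto simp: zeros_in_def fixed_in_def)
  let ?W = "{f \<in> carrier (End_ring R M). f x = x \<otimes> f \<one>}"
  note B = bimoduleD[OF bimodule_diff_ops[OF Mc]]
  have "carrier (End_ring R M) \<subseteq> ?W"
  proof (rule End_ring_span[OF K fin N Mc KM])
    show "op_zero R \<in> ?W" using op_zero_closed[OF Mc] x by (simp add: op_zero_def)
    show "op_add R f h \<in> ?W" if "f \<in> ?W" "h \<in> ?W" for f h
      using that op_add_closed[OF Mc, of f h] x End_ring_closed[of _ R M \<one>] by (simp add: op_add_def r_distr)
    fix d h assume d: "d \<in> diff_ops R M" and h: "h \<in> Gal R M"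
    have dE: "d \<in> carrier (End_ring R M)" using d diff_ops_End_ring[OF Mc] by blast
    have d1: "d \<one> \<in> carrier R" "d x \<in> carrier R"
      using End_ring_closed[OF dE one_closed] End_ring_closed[OF dE x] .
    \<comment> \<open>Subtracting the multiplication by \<open>d \<one>\<close> makes
      \<open>d\<close> vanish at \<open>\<one>\<close> within the differential operators, so the
      assumption on \<open>x\<close> applies.\<close>
    define d' where "d' = op_add R d (mulop R (\<ominus> d \<one>))"
    have "mulop R (\<ominus> d \<one>) \<in> diff_ops R M"
      using subsetD[OF mulop_diff_ops imageI[OF a_inv_closed[OF d1(1)]]] .
    then have "d' \<in> diff_ops R M" unfolding d'_def by (rule B(3)[OF d])
    moreover have "d' \<one> = \<zero>" using d1 by (simp add: d'_def op_add_def mulop_def r_neg)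
    ultimately have "d' \<in> diff_ops_plus R M" by (simp add: diff_ops_plus_def)
    then have "d' x = \<zero>" by (rule z)
    then have "d x \<oplus> \<ominus> (d \<one> \<otimes> x) = \<zero>" using x d1 by (simp add: d'_def op_add_def mulop_def l_minus)
    then have "d x = d \<one> \<otimes> x" using x d1 by (simp add: a_minus_def[symmetric])
    then show "compose (carrier R) d h \<in> ?W"
      using compose_End_ring[OF Mc dE GalD(1)[OF h]] x d1 g[OF h] GalD(2)[OF h]
      by (simp add: compose_def m_comm)
  qed
  then show "x \<in> M"
    using mem_subfield_iff_End_ring[OF M finite_dimension_over_larger[OF K M KM fin] x] by blast
qed

text \<open>Evaluation of the commutation rule at \<open>\<one>\<close>, where the operators of
  \<open>D\<close> vanish.\<close>

lemma field_centralizer_subset_zeros: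
  assumes "K \<subseteq> carrier R" "D \<subseteq> diff_ops_plus R K"
  shows "field_centralizer R K D \<subseteq> zeros_in R (carrier R) D"
proof
  fix x assume x: "x \<in> field_centralizer R K D"
  then have xc: "x \<in> carrier R" by (simp add: field_centralizer_def)
  have "d x = \<zero>" if "d \<in> D" for d
  proof -
    have d: "d \<in> carrier (End_ring R K)" "d \<one> = \<zero>"
      using that assms diff_ops_End_ring[OF assms(1)] by (auto simp: diff_ops_plus_def)
    have "d \<otimes>\<^bsub>End_ring R K\<^esub> mulop R x = mulop R x \<otimes>\<^bsub>End_ring R K\<^esub> d"
      using x that by (auto simp: field_centralizer_def)
    then have "d (x \<otimes> \<one>) = x \<otimes> d \<one>" using commute_mulop_iff[OF d(1) xc] one_closed by blast
    then show ?thesis using xc d(2) by simp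
  qed
  then show "x \<in> zeros_in R (carrier R) D" using xc by (simp add: zeros_in_def)
qed

lemma subset_field_centralizer:
  assumes M: "M \<subseteq> carrier R" and KM: "K \<subseteq> M" and D: "D \<subseteq> carrier (End_ring R M)"
  shows "M \<subseteq> field_centralizer R K D"
  using End_ring_iff_commute[OF M KM] D M by (auto simp: field_centralizer_def)

text \<open>Commuting with the multiplications forces \<open>e\<close> to be multiplication by
  \<open>e \<one>\<close>; commuting with the remaining operators then forces
  \<open>e \<one>\<close> into \<open>M\<close>.\<close>

lemma centralizer_End_ring:
  assumes K: "subfield K R" and fin: "finite_dimension K (carrier R)" and M: "subfield M R" and KM: "K \<subseteq> M"
  shows "centralizer (End_ring R K) (carrier (End_ring R M)) = mulop R ` M"
proof
  have Mc: "M \<subseteq> carrier R" using M by (rule subfieldE(3))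
  have Kc: "K \<subseteq> carrier R" using K by (rule subfieldE(3))
  note fM = finite_dimension_over_larger[OF K M KM fin]
  show "mulop R ` M \<subseteq> centralizer (End_ring R K) (carrier (End_ring R M))"
  proof (intro subsetI, elim imageE)
    fix c m assume m: "m \<in> M" "c = mulop R m"
    then show "c \<in> centralizer (End_ring R K) (carrier (End_ring R M))"
      using mulop_closed[of m K] Mc Kc End_ring_iff_commute[OF Mc KM] by (auto simp: centralizer_def)
  qed
  show "centralizer (End_ring R K) (carrier (End_ring R M)) \<subseteq> mulop R ` M"
  proof
    fix e assume e: "e \<in> centralizer (End_ring R K) (carrier (End_ring R M))"
    then have eE: "e \<in> carrier (End_ring R K)" by (simp add: centralizer_def)
    have com: "e (f x) = f (e x)" if f: "f \<in> carrier (End_ring R M)" and x: "x \<in> carrier R" for f x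
    proof -
      have "e \<otimes>\<^bsub>End_ring R K\<^esub> f = f \<otimes>\<^bsub>End_ring R K\<^esub> e" using e f by (auto simp: centralizer_def)
      from fun_cong[OF this, of x] x show ?thesis by (simp add: End_ring_ops compose_def)
    qed
    have e1: "e \<one> \<in> carrier R" using eE by (rule End_ring_closed) simp
    have ex: "e x = e \<one> \<otimes> x" if x: "x \<in> carrier R" for x
      using com[OF mulop_closed[OF x Mc] one_closed] x e1 by (simp add: mulop_def m_comm)
    have "f (e \<one>) = e \<one> \<otimes> f \<one>" if f: "f \<in> carrier (End_ring R M)" for f
      using com[OF f one_closed] ex[OF End_ring_closed[OF f one_closed]] by simp
    then have "e \<one> \<in> M" using mem_subfield_iff_End_ring[OF M fM e1] by blast
    moreover have "e = mulop R (e \<one>)"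
    proof (rule End_ring_eqI[OF eE mulop_closed[OF e1 Kc]])
      show "e x = mulop R (e \<one>) x" if "x \<in> carrier R" for x
        unfolding mulop_def restrict_apply'[OF that] by (rule ex[OF that])
    qed
    ultimately show "e \<in> mulop R ` M" by blast
  qed
qed

lemma skew_sum_eq_End_ring:
  assumes K: "subfield K R" and fin: "finite_dimension K (carrier R)" and N: "normal_extension R K"
    and M: "subfield M R" and KM: "K \<subseteq> M"
  shows "skew_sum (End_ring R K) (diff_ops R M) (Gal R M) = carrier (End_ring R M)"
proof
  have Mc: "M \<subseteq> carrier R" using M by (rule subfieldE(3))
  have sk: "skew_sum (End_ring R K) (diff_ops R M) (Gal R M)
      = (\<Union>F\<in>{F. finite F \<and> F \<subseteq> Gal R M}. sum_over (End_ring R K) (diff_ops R M) F)"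
    by (auto simp: skew_sum_def sum_over_def)
  show "skew_sum (End_ring R K) (diff_ops R M) (Gal R M) \<subseteq> carrier (End_ring R M)"
    unfolding sk using sum_over_End_ring[OF Mc KM] by blast
  obtain n where "dimension n M (carrier R)" using finite_dimension_over_larger[OF K M KM fin] by blast
  then have G: "finite (Gal R M)" using dimension_diff_ops(1)[OF K fin N M KM KM] by blast
  show "carrier (End_ring R M) \<subseteq> skew_sum (End_ring R K) (diff_ops R M) (Gal R M)"
    unfolding sk using sum_over_eq_End_ring[OF K fin N Mc KM KM G] G by blast
qed

end

section \<open>The bijection, the descriptions of its inverse, and the dimension formula\<close>

theorem theorem2p12:
  fixes L :: "('a, 'b) ring_scheme" and K :: "'a set"
  assumes "field L" and "subfield K L"
    and "ring.finite_dimension L K (carrier L)"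
    and "normal_extension L K"
  shows
    "(subalgebras_over L K = {field_to_algebra L K M | M. M \<in> intermediate_fields L K}
      \<and> (\<forall>M\<in>intermediate_fields L K.
           skew_direct (End_ring L K) (diff_ops L M) (Gal L M)
         \<and> skew_direct (End_ring L K) (diff_ops_commuting L K M) (Gal_fixing L K M)
         \<and> field_to_algebra L K M = skew_sum (End_ring L K) (diff_ops L M) (Gal L M)
         \<and> field_to_algebra L K M
             = skew_sum (End_ring L K) (diff_ops_commuting L K M) (Gal_fixing L K M)))
     \<and>
     (bij_betw (field_to_algebra L K) (intermediate_fields L K) (subalgebras_over L K)
      \<and> (\<forall>A\<in>subalgebras_over L K. \<forall>M.
           M = inv_into (intermediate_fields L K) (field_to_algebra L K) A \<longrightarrow>
             centralizer (End_ring L K) A = mulop L ` M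
           \<and> M = field_centralizer L K (A \<inter> diff_ops_plus L K)
                   \<inter> fixed_in (carrier L) (A \<inter> Gal L K)
           \<and> M = fixed_in (field_centralizer L K (A \<inter> diff_ops_plus L K)) (A \<inter> Gal L K)
           \<and> M = zeros_in L (carrier L) (A \<inter> diff_ops_plus L K)
                   \<inter> fixed_in (carrier L) (A \<inter> Gal L K)
           \<and> M = fixed_in (zeros_in L (carrier L) (A \<inter> diff_ops_plus L K)) (A \<inter> Gal L K))
      \<and> (\<forall>M\<in>intermediate_fields L K.
           inv_into (intermediate_fields L K) (field_to_algebra L K)
               (skew_sum (End_ring L K) (diff_ops L M) (Gal L M))
             = zeros_in L (carrier L) (diff_ops_plus L M) \<inter> fixed_in (carrier L) (Gal L M)))
     \<and>
     (\<forall>M\<in>intermediate_fields L K.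
         ring.finite_dimension (End_ring L K) (mulop L ` K) (diff_ops L M)
       \<and> ring.finite_dimension (End_ring L M) (mulop L ` M) (diff_ops L M)
       \<and> ring.dim L K M * card (Gal L M) * ring.dim (End_ring L K) (mulop L ` K) (diff_ops L M)
           = (ring.dim L K (carrier L))\<^sup>2
       \<and> card (Gal L M) * ring.dim (End_ring L M) (mulop L ` M) (diff_ops L M)
           = (ring.dim L M (carrier L))\<^sup>2)"
proof -
  interpret field L by fact
  note K = assms(2) and fin = assms(3) and N = assms(4)
  let ?I = "intermediate_fields L K" and ?\<Phi> = "field_to_algebra L K"
  have Kc: "K \<subseteq> carrier L" using K by (rule subfieldE(3))
  have I: "subfield M L" "K \<subseteq> M" "M \<subseteq> carrier L" if "M \<in> ?I" for M
    using that subfieldE(3)[of M L] by (auto simp: intermediate_fields_def)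
  have \<Phi>: "?\<Phi> M = carrier (End_ring L M)" if "M \<in> ?I" for M
    using field_to_algebra_eq[OF I(3,2)[OF that]] .
  have fM: "finite_dimension M (carrier L)" if "M \<in> ?I" for M
    using finite_dimension_over_larger[OF K I(1,2)[OF that] fin] .
  have skew: "skew_sum (End_ring L K) (diff_ops L M) (Gal L M) = ?\<Phi> M" if "M \<in> ?I" for M
    using skew_sum_eq_End_ring[OF K fin N I(1,2)[OF that]] \<Phi>[OF that] by simp
  have image: "subalgebras_over L K = ?\<Phi> ` ?I"
  proof
    show "subalgebras_over L K \<subseteq> ?\<Phi> ` ?I"
      using subalgebras_over_imp_End_ring[OF K fin] \<Phi> by blast
    show "?\<Phi> ` ?I \<subseteq> subalgebras_over L K"
      using End_ring_subalgebras_over I \<Phi> by (metis image_subsetI)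
  qed
  have inj: "inj_on ?\<Phi> ?I"
  proof (rule inj_onI)
    fix M M' assume M: "M \<in> ?I" "M' \<in> ?I" "?\<Phi> M = ?\<Phi> M'"
    then have "carrier (End_ring L M) = carrier (End_ring L M')" using \<Phi> by simp
    then have "x \<in> M \<longleftrightarrow> x \<in> M'" if "x \<in> carrier L" for x
      using mem_subfield_iff_End_ring[OF I(1)[OF M(1)] fM[OF M(1)] that]
        mem_subfield_iff_End_ring[OF I(1)[OF M(2)] fM[OF M(2)] that] by simp
    then show "M = M'" using I(3)[OF M(1)] I(3)[OF M(2)] by blast
  qed
  have plus: "?\<Phi> M \<inter> diff_ops_plus L K = diff_ops_plus L M" if "M \<in> ?I" for M
    using diff_ops_eq_Int[OF I(3,2)[OF that]] \<Phi>[OF that] by (auto simp: diff_ops_plus_def)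
  have gal: "?\<Phi> M \<inter> Gal L K = Gal L M" if "M \<in> ?I" for M
    using Gal_eq_Int[OF I(2)[OF that]] \<Phi>[OF that] by auto
  \<comment> \<open>These inclusions close a circle, so all descriptions of the inverse collapse to
    \<open>M\<close>.\<close>
  have chain: "M \<subseteq> field_centralizer L K (diff_ops_plus L M) \<inter> fixed_in (carrier L) (Gal L M)"
    "field_centralizer L K (diff_ops_plus L M) \<subseteq> zeros_in L (carrier L) (diff_ops_plus L M)"
    "zeros_in L (carrier L) (diff_ops_plus L M) \<inter> fixed_in (carrier L) (Gal L M) \<subseteq> M"
    if "M \<in> ?I" for M
  proof -
    note M = I[OF that]
    have "diff_ops_plus L M \<subseteq> carrier (End_ring L M)"
      using diff_ops_End_ring[OF M(3)] by (auto simp: diff_ops_plus_def)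
    then have "M \<subseteq> field_centralizer L K (diff_ops_plus L M)"
      by (rule subset_field_centralizer[OF M(3,2)])
    moreover have "M \<subseteq> fixed_in (carrier L) (Gal L M)"
      using M(3) Gal_fixing_eq[OF M(3,2)] by (auto simp: fixed_in_def Gal_fixing_def)
    ultimately show "M \<subseteq> field_centralizer L K (diff_ops_plus L M) \<inter> fixed_in (carrier L) (Gal L M)"
      by blast
    have "diff_ops_plus L M \<subseteq> diff_ops_plus L K" using plus[OF that] by blast
    then show "field_centralizer L K (diff_ops_plus L M) \<subseteq> zeros_in L (carrier L) (diff_ops_plus L M)"
      by (rule field_centralizer_subset_zeros[OF Kc])
    show "zeros_in L (carrier L) (diff_ops_plus L M) \<inter> fixed_in (carrier L) (Gal L M) \<subseteq> M"
      using zeros_fixed_subset[OF K fin N M(1,2)] .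
  qed
  have fixed: "fixed_in V H = V \<inter> fixed_in (carrier L) H" if "V \<subseteq> carrier L" for V and H :: "('a \<Rightarrow> 'a) set"
    using that by (auto simp: fixed_in_def)
  have fc: "field_centralizer L K S \<subseteq> carrier L" "zeros_in L (carrier L) S \<subseteq> carrier L" for S
    by (auto simp: field_centralizer_def zeros_in_def)
  show ?thesis
  proof (intro conjI ballI allI impI)
    show "subalgebras_over L K = {?\<Phi> M | M. M \<in> ?I}" using image by blast
    show "bij_betw ?\<Phi> ?I (subalgebras_over L K)" using inj image by (simp add: bij_betw_def)
  next
    fix M assume M: "M \<in> ?I"
    show sd: "skew_direct (End_ring L K) (diff_ops L M) (Gal L M)"
      using skew_direct_diff_ops[OF I(3,2)[OF M]] .
    show ss: "?\<Phi> M = skew_sum (End_ring L K) (diff_ops L M) (Gal L M)" using skew[OF M] by simp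
    show "skew_direct (End_ring L K) (diff_ops_commuting L K M) (Gal_fixing L K M)"
      "?\<Phi> M = skew_sum (End_ring L K) (diff_ops_commuting L K M) (Gal_fixing L K M)"
      using sd ss by (simp_all add: diff_ops_commuting_eq[OF I(3,2)[OF M]] Gal_fixing_eq[OF I(3,2)[OF M]])
    show "inv_into ?I ?\<Phi> (skew_sum (End_ring L K) (diff_ops L M) (Gal L M))
        = zeros_in L (carrier L) (diff_ops_plus L M) \<inter> fixed_in (carrier L) (Gal L M)"
      using inv_into_f_f[OF inj M] chain[OF M] unfolding skew[OF M] by blast
  next
    fix A M assume A: "A \<in> subalgebras_over L K" and "M = inv_into ?I ?\<Phi> A"
    then have M: "M \<in> ?I" "A = ?\<Phi> M"
      using image inv_into_into[of A ?\<Phi> ?I] f_inv_into_f[of A ?\<Phi> ?I] by auto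
    show "centralizer (End_ring L K) A = mulop L ` M"
      using centralizer_End_ring[OF K fin I(1,2)[OF M(1)]] by (simp add: M(2) \<Phi>[OF M(1)])
    have AD: "A \<inter> diff_ops_plus L K = diff_ops_plus L M" and AG: "A \<inter> Gal L K = Gal L M"
      using plus[OF M(1)] gal[OF M(1)] M(2) by auto
    show 1: "M = field_centralizer L K (A \<inter> diff_ops_plus L K) \<inter> fixed_in (carrier L) (A \<inter> Gal L K)"
      unfolding AD AG using chain[OF M(1)] by blast
    show 2: "M = zeros_in L (carrier L) (A \<inter> diff_ops_plus L K) \<inter> fixed_in (carrier L) (A \<inter> Gal L K)"
      unfolding AD AG using chain[OF M(1)] by blast
    show "M = fixed_in (field_centralizer L K (A \<inter> diff_ops_plus L K)) (A \<inter> Gal L K)"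
      "M = fixed_in (zeros_in L (carrier L) (A \<inter> diff_ops_plus L K)) (A \<inter> Gal L K)"
      using 1 2 by (simp_all only: fixed[OF fc(1)] fixed[OF fc(2)])
  next
    fix M assume M: "M \<in> ?I"
    note MM = I[OF M]
    obtain n where n: "dimension n M (carrier L)" using fM[OF M] by blast
    obtain l where l: "dimension l K (carrier L)" using fin by blast
    have "finite_dimension K M"
    proof (rule subalbegra_incl_imp_finite_dimension[OF K fin _ MM(3)])
      show "subalgebra K M L"
        using MM subring.axioms(1)[OF subfieldE(1)[OF MM(1)]] subringE(6)[OF subfieldE(1)[OF MM(1)]]
        by (auto intro!: subalgebra.intro subalgebra_axioms.intro)
    qed
    then obtain m where m: "dimension m K M" by blast
    have l_eq: "l = m * n"
      using telescopic_base[OF K MM(1) m n] dimension_is_inj[OF K _ l] by blast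
    note d = dimI[OF K l] dimI[OF K m] dimI[OF MM(1) n]
    \<comment> \<open>By the tower law the dimension over \<open>L\<close> is multiplied by
      \<open>k\<close>, the degree over \<open>F\<close>. Taking \<open>F\<close> to be
      \<open>K\<close> and then \<open>M\<close> gives the two forms of the dimension
      formula.\<close>
    have dd: "\<exists>r. ring.dimension (End_ring L F) (k * r) (mulop L ` F) (diff_ops L M) \<and> card (Gal L M) * r = n"
      if F: "subfield F L" "F \<subseteq> M" "dimension k F (carrier L)" for F k
    proof -
      have Fc: "F \<subseteq> carrier L" using F(1) by (rule subfieldE(3))
      interpret E: ring "End_ring L F" using Fc by (rule ring_End_ring)
      obtain r where r: "E.dimension r (mulop L ` carrier L) (diff_ops L M)" "card (Gal L M) * r = n"
        using dimension_diff_ops(2)[OF K fin N MM(1,2) F(2) n] by blast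
      have "E.dimension (k * r) (mulop L ` F) (diff_ops L M)"
        using E.telescopic_base[OF subfield_mulop[OF Fc F(1)] subfield_mulop[OF Fc carrier_is_subfield]
            dimension_mulop[OF Fc F(1,3)] r(1)] .
      then show ?thesis using r(2) by blast
    qed
    interpret EK: ring "End_ring L K" using Kc by (rule ring_End_ring)
    interpret EM: ring "End_ring L M" using MM(3) by (rule ring_End_ring)
    obtain r where r: "EK.dimension (l * r) (mulop L ` K) (diff_ops L M)" "card (Gal L M) * r = n"
      using dd[OF K MM(2) l] by blast
    obtain s where s: "EM.dimension (n * s) (mulop L ` M) (diff_ops L M)" "card (Gal L M) * s = n"
      using dd[OF MM(1) order_refl n] by blast
    show "EK.finite_dimension (mulop L ` K) (diff_ops L M)" using EK.finite_dimensionI[OF r(1)] .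
    show "EM.finite_dimension (mulop L ` M) (diff_ops L M)" using EM.finite_dimensionI[OF s(1)] .
    have dr: "EK.dim (mulop L ` K) (diff_ops L M) = l * r"
      using EK.dimI[OF subfield_mulop[OF Kc K] r(1)] by (simp add: over_def)
    have ds: "EM.dim (mulop L ` M) (diff_ops L M) = n * s"
      using EM.dimI[OF subfield_mulop[OF MM(3,1)] s(1)] by (simp add: over_def)
    \<comment> \<open>With \<open>card (Gal L M) * r = n\<close> and \<open>l = m * n\<close>, the
      product becomes the square of \<open>l\<close>.\<close>
    have "m * card (Gal L M) * (l * r) = m * (card (Gal L M) * r) * l" by simp
    then show "dim K M * card (Gal L M) * EK.dim (mulop L ` K) (diff_ops L M) = (dim K (carrier L))\<^sup>2"
      using d dr r(2) l_eq by (simp add: over_def power2_eq_square)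
    have "card (Gal L M) * (n * s) = n * (card (Gal L M) * s)" by simp
    then show "card (Gal L M) * EM.dim (mulop L ` M) (diff_ops L M) = (dim M (carrier L))\<^sup>2"
      using d ds s(2) by (simp add: over_def power2_eq_square)
  qed
qed

end
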